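(* There is a universal constant $C>0$ such that for any integers $k,n\ge 1$ with $k\ge 2\log_2 n+5$, and for an arbitrary $f_n:\{0,1\}^n\to\{0,1\}$, $$D(f_n\Box \mathrm{IP}_k)\le C\,\bigl(Q(f_n\Box \mathrm{IP}_k)\bigr)^7 .$$
   Context: $\mathrm{IP}_k:\{0,1\}^k\times\{0,1\}^k\to\{0,1\}$ is the Inner Product function $\mathrm{IP}_k(x,y)=\sum_i x_iy_i \bmod 2$. Block composition: for $f_n:\{0,1\}^n\to\{0,1\}$ and $g_k:\{0,1\}^k\times\{0,1\}^k\to\{0,1\}$, $f_n\Box g_k:\{0,1\}^{nk}\times\{0,1\}^{nk}\to\{0,1\}$ is $f_n\Box g_k(x,y)=f_n(g_k(x_1,y_1),\ldots,g_k(x_n,y_n))$, where $x=x_1\cdots x_n$, $y=y_1\cdots y_n$ with $x_i,y_i\in\{0,1\}^k$. For a function $F(x,y)$ with Alice knowing $x$ and Bob knowing $y$, in the two-way interactive communication model: $D(F)$ is the deterministic communication complexity (minimum worst-case number of bits exchanged by a deterministic protocol computing $F$), and $Q(F)$ is the bounded-error quantum communication complexity (minimum worst-case number of qubits exchanged by a quantum protocol, with unlimited prior shared entanglement, computing $F$ with error probability at most $1/3$ on every input). *)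

theory Defs
  imports Complex_Main
begin

section \<open>Boolean functions, inner product and block composition\<close>

definition cube :: "nat \<Rightarrow> bool list set" where
  "cube n = {x. length x = n}"

text \<open>Functions on the cube are total functions on Boolean lists; their values on lists of the
  wrong length play no role below.\<close>

definition IP :: "nat \<Rightarrow> bool list \<Rightarrow> bool list \<Rightarrow> bool" where
  "IP k x y \<longleftrightarrow> (\<Sum>i<k. of_bool (x ! i) * of_bool (y ! i) :: nat) mod 2 = 1"

definition block :: "nat \<Rightarrow> nat \<Rightarrow> bool list \<Rightarrow> bool list" where
  "block k i x = take k (drop (i * k) x)"

definition block_comp ::
  "nat \<Rightarrow> nat \<Rightarrow> (bool list \<Rightarrow> bool) \<Rightarrow> (bool list \<Rightarrow> bool list \<Rightarrow> bool) \<Rightarrow> bool list \<Rightarrow> bool list \<Rightarrow> bool"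
  where "block_comp n k f g x y = f (map (\<lambda>i. g (block k i x) (block k i y)) [0..<n])"

section \<open>Deterministic communication complexity\<close>

text \<open>Protocol trees: the transcript determines who speaks next and, at a leaf, the output.
  A bit \<^term>\<open>True\<close> leads to the first subtree.\<close>

datatype ('x, 'y) protocol =
    Output bool
  | Alice_says "'x \<Rightarrow> bool" "('x, 'y) protocol" "('x, 'y) protocol"
  | Bob_says "'y \<Rightarrow> bool" "('x, 'y) protocol" "('x, 'y) protocol"

primrec det_run :: "('x, 'y) protocol \<Rightarrow> 'x \<Rightarrow> 'y \<Rightarrow> bool" where
  "det_run (Output b) x y = b"
| "det_run (Alice_says a P P') x y = (if a x then det_run P x y else det_run P' x y)"
| "det_run (Bob_says b P P') x y = (if b y then det_run P x y else det_run P' x y)"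

primrec det_cost :: "('x, 'y) protocol \<Rightarrow> nat" where
  "det_cost (Output b) = 0"
| "det_cost (Alice_says a P P') = Suc (max (det_cost P) (det_cost P'))"
| "det_cost (Bob_says b P P') = Suc (max (det_cost P) (det_cost P'))"

definition det_computes ::
  "'x set \<Rightarrow> 'y set \<Rightarrow> ('x \<Rightarrow> 'y \<Rightarrow> bool) \<Rightarrow> ('x, 'y) protocol \<Rightarrow> bool" where
  "det_computes X Y F P \<longleftrightarrow> (\<forall>x\<in>X. \<forall>y\<in>Y. det_run P x y = F x y)"

definition det_cc :: "'x set \<Rightarrow> 'y set \<Rightarrow> ('x \<Rightarrow> 'y \<Rightarrow> bool) \<Rightarrow> nat" where
  "det_cc X Y F = (LEAST c. \<exists>P. det_computes X Y F P \<and> det_cost P = c)"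

section \<open>Quantum communication complexity with prior entanglement\<close>

text \<open>A computational basis state of the qubits in a finite set \<open>A\<close> is encoded by the set
  \<open>S \<subseteq> A\<close> of those qubits that have value 1. A state of the \<open>N\<close> qubits \<open>{..<N}\<close> is its
  family of amplitudes, and an operator on the qubits in \<open>A\<close> is its matrix, row index first;
  only entries indexed by subsets of \<open>{..<N}\<close>, respectively \<open>A\<close>, are relevant.\<close>

type_synonym qstate = "nat set \<Rightarrow> complex"
type_synonym qop = "nat set \<Rightarrow> nat set \<Rightarrow> complex"

definition is_qstate :: "nat \<Rightarrow> qstate \<Rightarrow> bool" where
  "is_qstate N \<psi> \<longleftrightarrow> (\<Sum>S\<in>Pow {..<N}. (cmod (\<psi> S))\<^sup>2) = 1"

definition unitary_on :: "nat set \<Rightarrow> qop \<Rightarrow> bool" where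
  "unitary_on A U \<longleftrightarrow> (\<forall>S\<in>Pow A. \<forall>T\<in>Pow A.
     (\<Sum>R\<in>Pow A. cnj (U R S) * U R T) = of_bool (S = T) \<and>
     (\<Sum>R\<in>Pow A. U S R * cnj (U T R)) = of_bool (S = T))"

text \<open>\<open>U\<close> on the qubits in \<open>A\<close>, tensored with the identity on all other qubits.\<close>

definition apply_op :: "nat set \<Rightarrow> qop \<Rightarrow> qstate \<Rightarrow> qstate" where
  "apply_op A U \<psi> S = (\<Sum>R\<in>Pow A. U (S \<inter> A) R * \<psi> (R \<union> (S - A)))"

definition outcome_prob :: "nat \<Rightarrow> qstate \<Rightarrow> nat \<Rightarrow> bool \<Rightarrow> real" where
  "outcome_prob N \<psi> q b = (\<Sum>S | S \<subseteq> {..<N} \<and> (q \<in> S) = b. (cmod (\<psi> S))\<^sup>2)"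

text \<open>At every moment each qubit is owned by exactly one player. In a step a player applies a
  unitary operator depending on that player's input to all qubits the player owns, and then passes
  one of them to the other player, at cost 1; a message of several qubits is a succession of such
  steps. Finally one of the players, fixed by the protocol, applies a last such unitary operator
  and measures one of the player's qubits, the outcome being the output.\<close>

datatype ('x, 'y) qprotocol =
    Alice_outputs "'x \<Rightarrow> qop" nat
  | Bob_outputs "'y \<Rightarrow> qop" nat
  | Alice_sends "'x \<Rightarrow> qop" nat "('x, 'y) qprotocol"
  | Bob_sends "'y \<Rightarrow> qop" nat "('x, 'y) qprotocol"

text \<open>In the following two functions \<open>A\<close> is the set of qubits currently owned by Alice; Bob owns
  \<open>{..<N} - A\<close>.\<close>

primrec q_valid :: "nat \<Rightarrow> nat set \<Rightarrow> ('x, 'y) qprotocol \<Rightarrow> bool" where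
  "q_valid N A (Alice_outputs U q) \<longleftrightarrow> (\<forall>x. unitary_on A (U x)) \<and> q \<in> A"
| "q_valid N A (Bob_outputs V q) \<longleftrightarrow> (\<forall>y. unitary_on ({..<N} - A) (V y)) \<and> q \<in> {..<N} - A"
| "q_valid N A (Alice_sends U q P) \<longleftrightarrow>
     (\<forall>x. unitary_on A (U x)) \<and> q \<in> A \<and> q_valid N (A - {q}) P"
| "q_valid N A (Bob_sends V q P) \<longleftrightarrow>
     (\<forall>y. unitary_on ({..<N} - A) (V y)) \<and> q \<in> {..<N} - A \<and> q_valid N (insert q A) P"

primrec q_prob ::
  "nat \<Rightarrow> nat set \<Rightarrow> qstate \<Rightarrow> ('x, 'y) qprotocol \<Rightarrow> 'x \<Rightarrow> 'y \<Rightarrow> bool \<Rightarrow> real" where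
  "q_prob N A \<psi> (Alice_outputs U q) x y b = outcome_prob N (apply_op A (U x) \<psi>) q b"
| "q_prob N A \<psi> (Bob_outputs V q) x y b = outcome_prob N (apply_op ({..<N} - A) (V y) \<psi>) q b"
| "q_prob N A \<psi> (Alice_sends U q P) x y b = q_prob N (A - {q}) (apply_op A (U x) \<psi>) P x y b"
| "q_prob N A \<psi> (Bob_sends V q P) x y b =
     q_prob N (insert q A) (apply_op ({..<N} - A) (V y) \<psi>) P x y b"

primrec q_cost :: "('x, 'y) qprotocol \<Rightarrow> nat" where
  "q_cost (Alice_outputs U q) = 0"
| "q_cost (Bob_outputs V q) = 0"
| "q_cost (Alice_sends U q P) = Suc (q_cost P)"
| "q_cost (Bob_sends V q P) = Suc (q_cost P)"

text \<open>The number \<open>N\<close> of qubits, the set \<open>A\<close> of qubits Alice owns initially and the initial state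
  \<open>\<psi>\<close> are chosen by the protocol independently of the input. As \<open>N\<close> is unbounded and \<open>\<psi>\<close> is
  arbitrary, this covers unlimited private workspace and unlimited prior entanglement.\<close>

definition q_computes ::
  "'x set \<Rightarrow> 'y set \<Rightarrow> ('x \<Rightarrow> 'y \<Rightarrow> bool) \<Rightarrow> nat \<Rightarrow> nat set \<Rightarrow> qstate \<Rightarrow> ('x, 'y) qprotocol \<Rightarrow> bool"
  where
  "q_computes X Y F N A \<psi> P \<longleftrightarrow>
     A \<subseteq> {..<N} \<and> is_qstate N \<psi> \<and> q_valid N A P \<and>
     (\<forall>x\<in>X. \<forall>y\<in>Y. q_prob N A \<psi> P x y (\<not> F x y) \<le> 1 / 3)"

definition quantum_cc :: "'x set \<Rightarrow> 'y set \<Rightarrow> ('x \<Rightarrow> 'y \<Rightarrow> bool) \<Rightarrow> nat" where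
  "quantum_cc X Y F = (LEAST c. \<exists>N A \<psi> P. q_computes X Y F N A \<psi> P \<and> q_cost P = c)"

end

theory Submission
  imports Defs "HOL-Analysis.Convex" "HOL-Computational_Algebra.Polynomial"
    "HOL-Library.Disjoint_Sets" "HOL-Library.FuncSet"
begin

text \<open>Let \<open>q\<close> be the quantum communication complexity. By backward induction along an optimal
  protocol, its acceptance probability is a sum of \<open>4 ^ q\<close> inner products of a vector depending on
  Alice's input and a vector depending on Bob's input, all of norm at most 1. Restrict Alice's blocks
  to nonzero strings. Then the \<open>n\<close> inner products are independent uniform bits and the rows
  of the sign matrix of a single block are orthogonal, so averaging the acceptance probability over
  all inputs with given inner products \<open>Z\<close> yields a function of \<open>Z\<close> that is \<open>1/3\<close>-close to \<open>f\<close> and whose Fourier coefficient at \<open>S\<close>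
  is at most \<open>4 ^ q * (2 ^ k - 1) powr (- card S / 2)\<close>. As \<open>2 ^ k \<ge> 32 * n\<^sup>2\<close>, truncating the Fourier
  series at degree \<open>2 * q + 2\<close> changes little.

  Flipping the blocks of a disjoint family of sensitive blocks independently with the same probability
  turns the truncated series into a bounded univariate polynomial whose derivative at an endpoint is
  proportional to the number of blocks. Markov's inequality therefore bounds the block sensitivity of
  \<open>f\<close> by \<open>O(q\<^sup>2)\<close>, so that \<open>f\<close> is decided by \<open>O(q ^ 6)\<close> queries to its variables. A query costs
  \<open>k + 1\<close> bits, and \<open>k = O(q)\<close> because the Fourier coefficients at the sets containing a sensitive
  variable cannot all be small.\<close>

section \<open>Block sensitivity and deterministic protocols\<close>

text \<open>A protocol may use any number of qubits and any entangled state, so no estimate may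
  depend on a dimension: communication enters only through the number of products, the initial state
  only through its norm 1. The zero string has to go because its row of signs is constant; the other
  rows are orthogonal to it and hence balanced. The truncation error is a sum over exponentially
  many sets. The bound on \<open>k\<close> makes the decay per element at most 1 / (5 n): the factor
  1 / n pays for the sum over all sets, since (1 + 1 / n) ^ n is at most 3, and the factor 1 / 5
  lets a degree linear in \<open>q\<close> outweigh 4 ^ q. The exponent 7 arises as 2 * 3 + 1: with
  block sensitivity b = O(q ^ 2), there are b rounds of b * b queries, and each query costs O(q)
  bits. As the claimed bound has no additive constant, the case q = 0 needs its own argument that
  the composed function is constant.\<close>

definition block_sensitivity_le :: "'a set \<Rightarrow> ('a set \<Rightarrow> bool) \<Rightarrow> nat \<Rightarrow> bool" where
  "block_sensitivity_le V f b \<longleftrightarrow> (\<forall>Z \<B>. Z \<subseteq> V \<longrightarrow> \<B> \<subseteq> Pow V \<longrightarrow> disjoint \<B> \<longrightarrow>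
     (\<forall>B\<in>\<B>. f (sym_diff Z B) \<noteq> f Z) \<longrightarrow> card \<B> \<le> b)"

text \<open>Minimality makes every element of \<open>B\<close> a sensitive variable of the flipped
  input. This bounds the size of \<open>B\<close> by the block sensitivity, and it also yields a
  sensitive variable of any nonconstant function.\<close>

lemma sensitive_block_minimal:
  assumes "finite D" "f (sym_diff Z D) \<noteq> f Z"
  obtains B where "B \<subseteq> D" "f (sym_diff Z B) \<noteq> f Z" "\<And>i. i \<in> B \<Longrightarrow> f (sym_diff Z (B - {i})) = f Z"
proof -
  obtain B where B: "B \<subseteq> D \<and> f (sym_diff Z B) \<noteq> f Z"
    and least: "\<And>B'. B' \<subseteq> D \<and> f (sym_diff Z B') \<noteq> f Z \<Longrightarrow> card B \<le> card B'"
    using ex_has_least_nat[of "\<lambda>B. B \<subseteq> D \<and> f (sym_diff Z B) \<noteq> f Z" D card] assms by blast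
  have "f (sym_diff Z (B - {i})) = f Z" if "i \<in> B" for i
  proof (rule ccontr)
    assume "f (sym_diff Z (B - {i})) \<noteq> f Z"
    then have "card B \<le> card (B - {i})" using B by (intro least) auto
    moreover have "finite B" using B assms finite_subset by auto
    ultimately show False using that card_Diff1_less[of B i] by linarith
  qed
  with B that show ?thesis by blast
qed

text \<open>Nisan's argument: take a largest disjoint family of minimal sensitive blocks. If an
  input agreed with \<open>Z\<close> on their union but had another value, its difference from
  \<open>Z\<close> would contain one more such block, disjoint from all of them. There are at most
  \<open>b\<close> blocks, each of size at most \<open>b\<close>.\<close>

lemma small_certificate:
  assumes "finite V" "Z \<subseteq> V" and bs: "block_sensitivity_le V f b"
  obtains Q where "Q \<subseteq> V" "card Q \<le> b * b" "\<And>Z'. Z' \<subseteq> V \<Longrightarrow> Z' \<inter> Q = Z \<inter> Q \<Longrightarrow> f Z' = f Z"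
proof -
  define min where "min = (\<lambda>B. B \<subseteq> V \<and> f (sym_diff Z B) \<noteq> f Z \<and> (\<forall>i\<in>B. f (sym_diff Z (B - {i})) = f Z))"
  define fam where "fam = (\<lambda>\<B>. disjoint \<B> \<and> (\<forall>B\<in>\<B>. min B))"
  have card_fam: "card \<B> \<le> b" if "fam \<B>" for \<B>
    using that bs[unfolded block_sensitivity_le_def, rule_format, OF assms(2), of \<B>]
    by (auto simp: fam_def min_def)
  have "\<exists>\<B>. fam \<B> \<and> (\<forall>\<B>'. fam \<B>' \<longrightarrow> card \<B>' \<le> card \<B>)"
    by (rule ex_has_greatest_nat[of _ "{}" _ "Suc b"])
      (use card_fam in \<open>auto simp: fam_def disjoint_def less_Suc_eq_le\<close>)
  then obtain \<B> where \<B>: "fam \<B>" and maxi: "\<And>\<B>'. fam \<B>' \<Longrightarrow> card \<B>' \<le> card \<B>" by blast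
  have sub: "\<B> \<subseteq> Pow V" using \<B> by (auto simp: fam_def min_def)
  have fin: "finite \<B>" using sub assms(1) finite_subset by blast
  have cardB: "card B \<le> b" if "B \<in> \<B>" for B
  proof -
    have B: "min B" using \<B> that by (auto simp: fam_def)
    \<comment> \<open>The hypothesis is applied at the flipped input: flipping one element back
      leaves \<open>B - {i}\<close>, which is not sensitive, so the singletons of \<open>B\<close>
      are disjoint sensitive blocks there.\<close>
    have "f (sym_diff (sym_diff Z B) {i}) \<noteq> f (sym_diff Z B)" if "i \<in> B" for i
    proof -
      have "sym_diff (sym_diff Z B) {i} = sym_diff Z (B - {i})" using that by auto
      then show ?thesis using B that by (auto simp: min_def)
    qed
    moreover have "sym_diff Z B \<subseteq> V" using B assms(2) by (auto simp: min_def)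
    moreover have "(\<lambda>i. {i}) ` B \<subseteq> Pow V" using B by (auto simp: min_def)
    moreover have "disjoint ((\<lambda>i. {i}) ` B)" by (auto simp: disjoint_def)
    ultimately have "card ((\<lambda>i. {i}) ` B) \<le> b"
      using bs[unfolded block_sensitivity_le_def, rule_format, of "sym_diff Z B" "(\<lambda>i. {i}) ` B"]
      by fast
    then show ?thesis by (simp add: card_image)
  qed
  have "card (\<Union>\<B>) \<le> (\<Sum>B\<in>\<B>. card B)" by (rule card_Union_le_sum_card)
  also have "\<dots> \<le> card \<B> * b" using sum_bounded_above[of \<B> card b] cardB by auto
  also have "\<dots> \<le> b * b" using card_fam[OF \<B>] by simp
  finally have card: "card (\<Union>\<B>) \<le> b * b" .
  show thesis
  proof (rule that[of "\<Union>\<B>"])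
    fix Z' assume Z': "Z' \<subseteq> V" "Z' \<inter> \<Union>\<B> = Z \<inter> \<Union>\<B>"
    show "f Z' = f Z"
    proof (rule ccontr)
      assume neq: "f Z' \<noteq> f Z"
      have eq: "sym_diff Z (sym_diff Z Z') = Z'" by auto
      have "finite (sym_diff Z Z')" using assms Z' finite_subset by (metis finite_Diff finite_Un)
      then obtain B where B: "B \<subseteq> sym_diff Z Z'" "f (sym_diff Z B) \<noteq> f Z"
          "\<And>i. i \<in> B \<Longrightarrow> f (sym_diff Z (B - {i})) = f Z"
        using sensitive_block_minimal[of "sym_diff Z Z'" f Z] eq neq by metis
      have disj: "B \<inter> \<Union>\<B> = {}" using B(1) Z'(2) by auto
      have "B \<noteq> {}" using B(2) by auto
      then have "B \<notin> \<B>" using disj by auto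
      have "min B" using B Z' assms(2) by (auto simp: min_def)
      then have "fam (insert B \<B>)" using \<B> disj by (auto simp: fam_def disjoint_def)
      then show False using maxi[of "insert B \<B>"] \<open>B \<notin> \<B>\<close> fin by simp
    qed
  qed (use sub card in auto)
qed

text \<open>Correctness is asked only on \<open>D\<close>, an arbitrary set of input pairs, because
  each answer shrinks it to the consistent pairs. The cost is an upper bound so that branches of
  different depth can be joined.\<close>

definition det_solvable :: "('x \<Rightarrow> 'y \<Rightarrow> bool) \<Rightarrow> nat \<Rightarrow> ('x \<times> 'y) set \<Rightarrow> bool" where
  "det_solvable F c D \<longleftrightarrow> (\<exists>P. det_cost P \<le> c \<and> (\<forall>(x, y)\<in>D. det_run P x y = F x y))"

lemma det_solvable_const:
  assumes "\<And>x y. (x, y) \<in> D \<Longrightarrow> F x y = b"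
  shows "det_solvable F c D"
  unfolding det_solvable_def using assms by (intro exI[of _ "Output b"]) auto

text \<open>The premise \<open>query\<close> is all that is assumed about communication: membership
  of \<open>i\<close> in the hidden set \<open>g x y\<close> can be settled with \<open>s\<close>
  bits. It is used for inner products, where \<open>s\<close> is \<open>k + 1\<close>, and for
  single bits of Alice's block, where \<open>s\<close> is 1.\<close>

lemma det_solvable_queries:
  assumes query: "\<And>i D c. i \<in> Q \<Longrightarrow> det_solvable F c {(x, y)\<in>D. i \<in> g x y} \<Longrightarrow>
      det_solvable F c {(x, y)\<in>D. i \<notin> g x y} \<Longrightarrow> det_solvable F (c + s) D"
    and "finite Q" and "\<And>R. R \<subseteq> Q \<Longrightarrow> det_solvable F c {(x, y)\<in>D. g x y \<inter> Q = R}"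
  shows "det_solvable F (c + card Q * s) D"
  using assms(2,1,3)
proof (induction Q arbitrary: D rule: finite_induct)
  case empty
  from empty(2)[of "{}"] show ?case by simp
next
  case (insert i Q)
  have "det_solvable F (c + card Q * s) {(x, y)\<in>D. i \<in> g x y}"
  proof (rule insert.IH)
    fix R assume "R \<subseteq> Q"
    then have "{(x, y) \<in> {(x, y)\<in>D. i \<in> g x y}. g x y \<inter> Q = R} =
        {(x, y)\<in>D. g x y \<inter> insert i Q = insert i R}"
      using insert.hyps by auto
    then show "det_solvable F c {(x, y) \<in> {(x, y)\<in>D. i \<in> g x y}. g x y \<inter> Q = R}"
      using insert.prems(2)[of "insert i R"] \<open>R \<subseteq> Q\<close> by auto
  qed (use insert.prems in auto)
  moreover have "det_solvable F (c + card Q * s) {(x, y)\<in>D. i \<notin> g x y}"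
  proof (rule insert.IH)
    fix R assume "R \<subseteq> Q"
    then have "{(x, y) \<in> {(x, y)\<in>D. i \<notin> g x y}. g x y \<inter> Q = R} =
        {(x, y)\<in>D. g x y \<inter> insert i Q = R}"
      using insert.hyps by auto
    then show "det_solvable F c {(x, y) \<in> {(x, y)\<in>D. i \<notin> g x y}. g x y \<inter> Q = R}"
      using insert.prems(2)[of R] \<open>R \<subseteq> Q\<close> by auto
  qed (use insert.prems in auto)
  ultimately have "det_solvable F (c + card Q * s + s) D" by (intro insert.prems(1)) auto
  then show ?case using insert.hyps by (simp add: algebra_simps)
qed

text \<open>Querying a certificate of a consistent 1-input destroys a sensitive block of every remaining
  0-input, namely the part of the certificate on which the two inputs differ.\<close>

lemma det_solvable_block_sensitivity_aux:
  fixes f :: "'a set \<Rightarrow> bool"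
  assumes "finite V" and g: "\<And>x y. (x, y) \<in> D \<Longrightarrow> g x y \<subseteq> V"
    and query: "\<And>i D c. i \<in> V \<Longrightarrow> det_solvable F c {(x, y)\<in>D. i \<in> g x y} \<Longrightarrow>
      det_solvable F c {(x, y)\<in>D. i \<notin> g x y} \<Longrightarrow> det_solvable F (c + s) D"
    and F: "\<And>x y. (x, y) \<in> D \<Longrightarrow> F x y = f (g x y)"
    and cert: "\<And>Z. Z \<subseteq> V \<Longrightarrow> f Z \<Longrightarrow>
      \<exists>Q\<subseteq>V. card Q \<le> c \<and> (\<forall>Z'\<subseteq>V. Z' \<inter> Q = Z \<inter> Q \<longrightarrow> f Z')"
    and "K \<subseteq> V"
    and bs: "\<And>Z \<B>. Z \<subseteq> V \<Longrightarrow> Z \<inter> K = \<rho> \<Longrightarrow> \<not> f Z \<Longrightarrow> \<B> \<subseteq> Pow (V - K) \<Longrightarrow> disjoint \<B> \<Longrightarrow>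
      (\<And>B. B \<in> \<B> \<Longrightarrow> f (sym_diff Z B)) \<Longrightarrow> card \<B> \<le> m"
  shows "det_solvable F (m * (c * s)) {(x, y)\<in>D. g x y \<inter> K = \<rho>}"
  using assms(6,7)
proof (induction m arbitrary: K \<rho>)
  case 0
  show ?case
  proof (cases "\<exists>Z'\<subseteq>V. Z' \<inter> K = \<rho> \<and> f Z'")
    case True
    then obtain Z' where Z': "Z' \<subseteq> V" "Z' \<inter> K = \<rho>" "f Z'" by blast
    have "f Z" if "Z \<subseteq> V" "Z \<inter> K = \<rho>" for Z
    proof (rule ccontr)
      assume "\<not> f Z"
      have "sym_diff Z (sym_diff Z Z') = Z'" by auto
      \<comment> \<open>\<open>Z\<close> and \<open>Z'\<close> agree on \<open>K\<close>, so their
        difference is a sensitive block outside \<open>K\<close>, and one block already exceeds the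
        bound 0.\<close>
      then have "card {sym_diff Z Z'} \<le> 0"
        using \<open>\<not> f Z\<close> that Z' by (intro "0.prems"(2)[of Z]) auto
      then show False by simp
    qed
    then show ?thesis using F g by (intro det_solvable_const[of _ _ True]) auto
  next
    case False
    then show ?thesis using F g by (intro det_solvable_const[of _ _ False]) auto
  qed
next
  case (Suc m)
  show ?case
  proof (cases "\<exists>Z'\<subseteq>V. Z' \<inter> K = \<rho> \<and> f Z'")
    case True
    then obtain Z' where Z': "Z' \<subseteq> V" "Z' \<inter> K = \<rho>" "f Z'" by blast
    obtain Q where Q: "Q \<subseteq> V" "card Q \<le> c" "\<And>Z. Z \<subseteq> V \<Longrightarrow> Z \<inter> Q = Z' \<inter> Q \<Longrightarrow> f Z"
      using cert[OF Z'(1,3)] by blast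
    have finQ: "finite Q" using Q(1) assms(1) finite_subset by blast
    have "det_solvable F (m * (c * s) + card Q * s) {(x, y)\<in>D. g x y \<inter> K = \<rho>}"
    proof (rule det_solvable_queries[where g = g])
      fix R assume "R \<subseteq> Q"
      have eq: "{(x, y) \<in> {(x, y)\<in>D. g x y \<inter> K = \<rho>}. g x y \<inter> Q = R} \<subseteq>
          {(x, y)\<in>D. g x y \<inter> (K \<union> Q) = \<rho> \<union> R}" by auto
      show "det_solvable F (m * (c * s)) {(x, y) \<in> {(x, y)\<in>D. g x y \<inter> K = \<rho>}. g x y \<inter> Q = R}"
      \<comment> \<open>New answers \<open>R\<close> that contradict the old answers
        \<open>\<rho>\<close> on the overlap of \<open>Q\<close> and \<open>K\<close> leave no input
        pair.\<close>
      proof (cases "\<rho> \<inter> Q = R \<inter> K \<and> \<rho> \<subseteq> K")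
        case cons: True
        have "det_solvable F (m * (c * s)) {(x, y)\<in>D. g x y \<inter> (K \<union> Q) = \<rho> \<union> R}"
        proof (rule Suc.IH)
          fix Z \<B>
          assume Z: "Z \<subseteq> V" "Z \<inter> (K \<union> Q) = \<rho> \<union> R" "\<not> f Z"
            and \<B>: "\<B> \<subseteq> Pow (V - (K \<union> Q))" "disjoint \<B>" "\<And>B. B \<in> \<B> \<Longrightarrow> f (sym_diff Z B)"
          have ZK: "Z \<inter> K = \<rho>" using Z(2) cons \<open>R \<subseteq> Q\<close> by blast
          \<comment> \<open>Flipping \<open>B\<close> imposes the certificate of \<open>Z'\<close>
            on \<open>Z\<close>, so \<open>B\<close> is sensitive. It lies in \<open>Q\<close>, away
            from the blocks of \<open>\<B>\<close>, and it avoids \<open>K\<close> because both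
            inputs restrict to \<open>\<rho>\<close> there. Adding it to \<open>\<B>\<close> lowers
            the bound by one.\<close>
          define B where "B = sym_diff Z Z' \<inter> Q"
          have BK: "B \<inter> K = {}" using ZK Z'(2) by (auto simp: B_def)
          have "f (sym_diff Z B)"
            by (rule Q(3)) (use Z Z' Q(1) in \<open>auto simp: B_def\<close>)
          moreover from this have "B \<noteq> {}" using Z(3) by auto
          moreover have "B \<subseteq> Q" by (auto simp: B_def)
          ultimately have "B \<notin> \<B>" using \<B>(1) by auto
          have "card (insert B \<B>) \<le> Suc m"
          proof (rule Suc.prems(2)[OF Z(1) ZK Z(3)])
            show "insert B \<B> \<subseteq> Pow (V - K)" using \<B>(1) BK \<open>B \<subseteq> Q\<close> Q(1) by auto
            have "B \<inter> B' = {}" "B' \<inter> B = {}" if "B' \<in> \<B>" for B'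
              using \<B>(1) \<open>B \<subseteq> Q\<close> that by blast+
            then show "disjoint (insert B \<B>)" using \<B>(2) unfolding disjoint_def by simp
          qed (use \<B>(3) \<open>f (sym_diff Z B)\<close> in auto)
          moreover have "finite \<B>"
            using \<B>(1) assms(1) by (meson finite_Diff finite_Pow_iff finite_subset)
          ultimately show "card \<B> \<le> m" using \<open>B \<notin> \<B>\<close> by simp
        qed (use Suc.prems Q(1) in auto)
        then show ?thesis using eq unfolding det_solvable_def by blast
      next
        case False
        then have "{(x, y) \<in> {(x, y)\<in>D. g x y \<inter> K = \<rho>}. g x y \<inter> Q = R} = {}" by auto
        then show ?thesis by (metis det_solvable_const empty_iff)
      qed
    next
      fix i D' c' assume "i \<in> Q"
        and "det_solvable F c' {(x, y)\<in>D'. i \<in> g x y}" "det_solvable F c' {(x, y)\<in>D'. i \<notin> g x y}"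
      then show "det_solvable F (c' + s) D'" using query Q(1) by blast
    qed (fact finQ)
    moreover have "m * (c * s) + card Q * s \<le> Suc m * (c * s)" using Q(2) by simp
    ultimately show ?thesis unfolding det_solvable_def by (meson order_trans)
  next
    case False
    then show ?thesis using F g by (intro det_solvable_const[of _ _ False]) auto
  qed
qed

text \<open>There are at most \<open>b\<close> rounds, as each lowers the bound on the disjoint
  sensitive blocks left at 0-inputs, and a round queries a certificate of at most
  \<open>b * b\<close> variables.\<close>

theorem det_solvable_block_sensitivity:
  assumes "finite V" and "\<And>x y. (x, y) \<in> D \<Longrightarrow> g x y \<subseteq> V"
    and "\<And>i D c. i \<in> V \<Longrightarrow> det_solvable F c {(x, y)\<in>D. i \<in> g x y} \<Longrightarrow>
      det_solvable F c {(x, y)\<in>D. i \<notin> g x y} \<Longrightarrow> det_solvable F (c + s) D"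
    and "\<And>x y. (x, y) \<in> D \<Longrightarrow> F x y = f (g x y)"
    and bs: "block_sensitivity_le V f b"
  shows "det_solvable F (b ^ 3 * s) D"
proof -
  have "det_solvable F (b * ((b * b) * s)) {(x, y)\<in>D. g x y \<inter> {} = {}}"
  proof (rule det_solvable_block_sensitivity_aux[where V = V and g = g and f = f])
    fix Z assume "Z \<subseteq> V" "f Z"
    then show "\<exists>Q\<subseteq>V. card Q \<le> b * b \<and> (\<forall>Z'\<subseteq>V. Z' \<inter> Q = Z \<inter> Q \<longrightarrow> f Z')"
      using small_certificate[OF assms(1) _ bs, of Z] by metis
  next
    fix Z \<B> assume "Z \<subseteq> V" "\<not> f Z" "\<B> \<subseteq> Pow (V - {})" "disjoint \<B>" "\<And>B. B \<in> \<B> \<Longrightarrow> f (sym_diff Z B)"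
    then show "card \<B> \<le> b" using bs unfolding block_sensitivity_le_def by auto
  qed (use assms in auto)
  then show ?thesis by (simp add: power3_eq_cube mult.assoc)
qed

section \<open>Markov's inequality at an endpoint\<close>

fun chebyshev :: "nat \<Rightarrow> real poly" where
  "chebyshev 0 = 1"
| "chebyshev (Suc 0) = [:0, 1:]"
| "chebyshev (Suc (Suc n)) = [:0, 2:] * chebyshev (Suc n) - chebyshev n"

lemma poly_chebyshev_cos: "poly (chebyshev n) (cos \<theta>) = cos (real n * \<theta>)"
proof (induction n rule: chebyshev.induct)
  case (3 n)
  have "cos (real (Suc n) * \<theta> + \<theta>) + cos (real (Suc n) * \<theta> - \<theta>) = 2 * cos \<theta> * cos (real (Suc n) * \<theta>)"
    unfolding cos_add cos_diff by (simp add: algebra_simps)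
  moreover have "real (Suc n) * \<theta> + \<theta> = real (Suc (Suc n)) * \<theta>" "real (Suc n) * \<theta> - \<theta> = real n * \<theta>"
    by (simp_all add: algebra_simps)
  ultimately have "cos (real (Suc (Suc n)) * \<theta>) = 2 * cos \<theta> * cos (real (Suc n) * \<theta>) - cos (real n * \<theta>)"
    by simp
  then show ?case using 3 by simp
qed simp_all

lemma degree_chebyshev_le: "degree (chebyshev n) \<le> n"
proof (induction n rule: chebyshev.induct)
  case (3 n)
  have "degree ([:0, 2:] * chebyshev (Suc n)) \<le> Suc (Suc n)"
    using degree_mult_le[of "[:0, 2:]" "chebyshev (Suc n)"] 3(1) by simp
  then show ?case using 3(2) by (simp add: degree_diff_le)
qed simp_all

lemma poly_chebyshev_1 [simp]: "poly (chebyshev n) 1 = 1"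
  using poly_chebyshev_cos[of n 0] by simp

text \<open>Differentiating the recurrence at 1 gives a(n+2) = 2 + 2 a(n+1) - a(n), which the
  squares satisfy.\<close>

lemma poly_pderiv_chebyshev_1: "poly (pderiv (chebyshev n)) 1 = (real n)\<^sup>2"
proof (induction n rule: chebyshev.induct)
  case (3 n)
  then show ?case
    by (simp only: chebyshev.simps pderiv_diff pderiv_mult)
      (simp add: pderiv_pCons power2_eq_square algebra_simps)
qed (simp_all add: pderiv_pCons)

text \<open>A polynomial with a larger derivative at 1 could be scaled so that its difference to the
  Chebyshev polynomial has a critical point at 1, while still oscillating at the extremal points
  of the latter: too many critical points.\<close>

lemma markov_endpoint_aux:
  fixes p :: "real poly"
  assumes "degree p \<le> d" and bound: "\<And>t. \<bar>t\<bar> \<le> 1 \<Longrightarrow> \<bar>poly p t\<bar> \<le> 1"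
  shows "poly (pderiv p) 1 \<le> (real d)\<^sup>2"
proof (rule ccontr)
  assume "\<not> ?thesis"
  then have big: "poly (pderiv p) 1 > (real d)\<^sup>2" by simp
  have "d > 0"
  proof (rule ccontr)
    assume "\<not> d > 0"
    then have "pderiv p = 0" using assms(1) by (simp add: pderiv_eq_0_iff)
    then show False using big by simp
  qed
  \<comment> \<open>This factor cancels the derivatives at 1, and \<open>l < 1\<close> keeps
    \<open>l * p\<close> strictly between the extreme values -1 and 1 of the Chebyshev
    polynomial.\<close>
  define l where "l = (real d)\<^sup>2 / poly (pderiv p) 1"
  have pos: "poly (pderiv p) 1 > 0" using big by (meson le_less_trans zero_le_power2)
  have l: "0 < l" "l < 1" using big pos \<open>d > 0\<close> by (auto simp: l_def)
  define q where "q = chebyshev d - smult l p"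
  have q1: "poly (pderiv q) 1 = 0"
    using pos by (simp add: q_def pderiv_diff pderiv_smult poly_pderiv_chebyshev_1 l_def)
  have degq: "degree q \<le> d"
    unfolding q_def using degree_chebyshev_le assms(1) degree_smult_le
    by (meson degree_diff_le order_trans)
  \<comment> \<open>The extremal points, decreasing from 1 to -1. The Chebyshev polynomial
    alternates between 1 and -1 on them, so \<open>q\<close> alternates in sign.\<close>
  define c where "c = (\<lambda>j. cos (real j * pi / real d))"
  have c_bound: "\<bar>c j\<bar> \<le> 1" for j by (simp add: c_def)
  have c_less: "c (Suc j) < c j" if "j < d" for j
  proof -
    have "real (Suc j) * pi \<le> real d * pi" using that by (intro mult_right_mono) auto
    then have "real (Suc j) * pi / real d \<le> pi" using \<open>d > 0\<close> by (simp add: divide_le_eq mult.commute)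
    then show ?thesis unfolding c_def using \<open>d > 0\<close>
      by (intro cos_monotone_0_pi divide_strict_right_mono) auto
  qed
  have q_sign: "(-1) ^ j * poly q (c j) > 0" for j
  proof -
    have "poly (chebyshev d) (c j) = cos (real j * pi)"
      unfolding c_def poly_chebyshev_cos using \<open>d > 0\<close> by simp
    then have T: "poly (chebyshev d) (c j) = (-1) ^ j" by (simp add: mult.commute)
    have "l * \<bar>poly p (c j)\<bar> \<le> l * 1" using bound[OF c_bound[of j]] l(1) by (intro mult_left_mono) auto
    moreover have "\<bar>l * poly p (c j)\<bar> = l * \<bar>poly p (c j)\<bar>" using l by (simp add: abs_mult)
    ultimately have small: "\<bar>l * poly p (c j)\<bar> < 1" using l by linarith
    have q: "poly q (c j) = (-1) ^ j - l * poly p (c j)" by (simp add: q_def T)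
    consider "(-1) ^ j = (1::real)" | "(-1) ^ j = (-1::real)" by (cases "even j") auto
    then show ?thesis using small by cases (simp_all add: q abs_less_iff)
  qed
  have "\<exists>r. c (Suc j) < r \<and> r < c j \<and> poly q r = 0" if "j < d" for j
  proof -
    have "((-1) ^ j * poly q (c j)) * ((-1) ^ Suc j * poly q (c (Suc j))) > 0"
      by (intro mult_pos_pos q_sign)
    moreover have "((-1) ^ j * a) * ((-1) ^ Suc j * b) = - (b * a)" for a b :: real
      by (cases "even j") auto
    ultimately have "poly q (c (Suc j)) * poly q (c j) < 0" by (metis neg_0_less_iff_less)
    then show ?thesis using poly_IVT[OF c_less[OF that]] by blast
  qed
  then obtain r where r: "\<And>j. j < d \<Longrightarrow> c (Suc j) < r j \<and> r j < c j \<and> poly q (r j) = 0" by metis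
  have r_less: "r (Suc j) < r j" if "Suc j < d" for j
    using r[of j] r[of "Suc j"] that by linarith
  \<comment> \<open>Rolle between consecutive zeros: the \<open>d\<close> zeros of \<open>q\<close>
    give \<open>d - 1\<close> critical points below 1, and 1 is one more. That is too many for a
    nonzero derivative of degree at most \<open>d - 1\<close>.\<close>
  have "\<exists>s. r (Suc j) < s \<and> s < r j \<and> poly (pderiv q) s = 0" if "Suc j < d" for j
  proof -
    have "\<exists>s>r (Suc j). s < r j \<and> poly q (r j) - poly q (r (Suc j)) = (r j - r (Suc j)) * poly (pderiv q) s"
      by (rule poly_MVT) (rule r_less[OF that])
    then show ?thesis using r[of j] r[of "Suc j"] that r_less[OF that] by auto
  qed
  then obtain s where s: "\<And>j. Suc j < d \<Longrightarrow> r (Suc j) < s j \<and> s j < r j \<and> poly (pderiv q) (s j) = 0"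
    by metis
  have s_anti: "s j < s i" if "i < j" "Suc j < d" for i j
    using that
  proof (induction j)
    case (Suc j)
    have "s (Suc j) < s j" using s[of j] s[of "Suc j"] Suc.prems by auto
    then show ?case using Suc by (cases "i = j") auto
  qed simp
  have s_less_1: "s j < 1" if "Suc j < d" for j
    using s[OF that] r[of j] that c_bound[of j] by linarith
  have "inj_on s {..<d - 1}"
  proof (rule inj_onI)
    fix i j assume "i \<in> {..<d - 1}" "j \<in> {..<d - 1}" "s i = s j"
    then have "Suc i < d" "Suc j < d" "s i = s j" by auto
    then show "i = j" using s_anti[of i j] s_anti[of j i] by (cases i j rule: linorder_cases) auto
  qed
  then have "card (s ` {..<d - 1}) = d - 1" by (simp add: card_image)
  moreover have "s j \<noteq> 1" if "j < d - 1" for j using s_less_1[of j] that by fastforce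
  then have "1 \<notin> s ` {..<d - 1}" by force
  ultimately have "card (insert 1 (s ` {..<d - 1})) = d"
    using \<open>d > 0\<close> by simp
  moreover have "insert 1 (s ` {..<d - 1}) \<subseteq> {x. poly (pderiv q) x = 0}"
    using q1 s by auto
  moreover have "pderiv q \<noteq> 0"
  proof
    assume "pderiv q = 0"
    then obtain a where "q = [:a:]" by (metis pderiv_iszero)
    then show False using q_sign[of 0] q_sign[of 1] by simp
  qed
  ultimately have "d \<le> degree (pderiv q)"
    by (metis card_poly_roots_bound card_mono poly_roots_finite order_trans)
  then show False using degq \<open>d > 0\<close> by (simp add: degree_pderiv)
qed

text \<open>The range [m - h, m + h] is rescaled to [-1, 1]; the signs 1 and -1 for
  \<open>\<epsilon>\<close> give the two halves of the absolute value.\<close>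

theorem markov_endpoint:
  fixes p :: "real poly"
  assumes "degree p \<le> d" "h > 0" and bound: "\<And>t. \<bar>t\<bar> \<le> 1 \<Longrightarrow> \<bar>poly p t - m\<bar> \<le> h"
  shows "\<bar>poly (pderiv p) 1\<bar> \<le> h * (real d)\<^sup>2"
proof -
  have "\<epsilon> * poly (pderiv p) 1 \<le> h * (real d)\<^sup>2" if "\<bar>\<epsilon>\<bar> = 1" for \<epsilon>
  proof -
    define p' where "p' = smult (\<epsilon> / h) (p - [:m:])"
    have "poly (pderiv p') 1 \<le> (real d)\<^sup>2"
    proof (rule markov_endpoint_aux)
      show "degree p' \<le> d" unfolding p'_def
        using degree_diff_le[of p d "[:m:]"] assms(1) by (intro order_trans[OF degree_smult_le]) simp
      show "\<bar>poly p' t\<bar> \<le> 1" if "\<bar>t\<bar> \<le> 1" for t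
        using bound[OF that] \<open>\<bar>\<epsilon>\<bar> = 1\<close> \<open>h > 0\<close> by (simp add: p'_def abs_mult)
    qed
    moreover have "poly (pderiv p') 1 = \<epsilon> * poly (pderiv p) 1 / h"
      by (simp add: p'_def pderiv_smult pderiv_diff pderiv_pCons)
    ultimately show ?thesis using \<open>h > 0\<close> by (simp add: field_simps)
  qed
  from this[of 1] this[of "-1"] show ?thesis by simp
qed

section \<open>Polynomials of low degree and disjoint sensitive blocks\<close>

text \<open>The Walsh function of \<open>S\<close>, a Boolean input being identified with the set
  \<open>Z\<close> of its coordinates of value 1. Flipping a block then becomes
  \<open>sym_diff\<close>, and acts on a character as multiplication by a sign.\<close>

definition character :: "'a set \<Rightarrow> 'a set \<Rightarrow> real" where
  "character S Z = (-1) ^ card (S \<inter> Z)"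

lemma character_cases: "character S Z = 1 \<or> character S Z = -1"
  by (cases "even (card (S \<inter> Z))") (auto simp: character_def)

lemma abs_character [simp]: "\<bar>character S Z\<bar> = 1"
  by (simp add: character_def power_abs)

lemma character_empty [simp]: "character S {} = 1" "character {} Z = 1"
  by (simp_all add: character_def)

lemma character_sym_diff:
  assumes "finite S"
  shows "character S (sym_diff Z B) = character S Z * character S B"
proof -
  have "card (S \<inter> Z) = card (S \<inter> (Z - B)) + card (S \<inter> (Z \<inter> B))"
    using assms by (subst card_Un_disjoint[symmetric]) (auto intro!: arg_cong[of _ _ card])
  moreover have "card (S \<inter> B) = card (S \<inter> (B - Z)) + card (S \<inter> (Z \<inter> B))"
    using assms by (subst card_Un_disjoint[symmetric]) (auto intro!: arg_cong[of _ _ card])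
  moreover have "card (S \<inter> sym_diff Z B) = card (S \<inter> (Z - B)) + card (S \<inter> (B - Z))"
    using assms by (subst card_Un_disjoint[symmetric]) (auto intro!: arg_cong[of _ _ card])
  ultimately have "card (S \<inter> Z) + card (S \<inter> B) = card (S \<inter> sym_diff Z B) + 2 * card (S \<inter> (Z \<inter> B))"
    by simp
  then have "character S Z * character S B = (-1) ^ (card (S \<inter> sym_diff Z B) + 2 * card (S \<inter> (Z \<inter> B)))"
    unfolding character_def by (simp flip: power_add)
  then show ?thesis by (simp add: character_def power_add)
qed

lemma character_disjoint_Union:
  assumes "finite S" "finite \<B>" "disjoint \<B>"
  shows "character S (\<Union>\<B>) = (\<Prod>B\<in>\<B>. character S B)"
  using assms(2,3)
proof (induction \<B> rule: finite_induct)
  case (insert B \<B>)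
  then have "\<Union>\<B> \<inter> B = {}" "disjoint \<B>" by (auto simp: disjoint_def)
  then have "\<Union>(insert B \<B>) = sym_diff (\<Union>\<B>) B" by auto
  then show ?case using insert \<open>disjoint \<B>\<close> character_sym_diff[OF assms(1), of "\<Union>\<B>" B]
    by (simp add: mult.commute)
qed simp

text \<open>The weight of \<open>Y\<close> is the probability that exactly the blocks in
  \<open>Y\<close> are flipped, so by independence the expectation of the product factors.\<close>

lemma sum_flip_prod:
  fixes c :: "'b \<Rightarrow> real"
  assumes "finite A"
  shows "(\<Sum>Y\<in>Pow A. ((\<Prod>B\<in>Y. (1 - t) / 2) * (\<Prod>B\<in>A - Y. (1 + t) / 2)) * (\<Prod>B\<in>Y. c B)) =
    (\<Prod>B\<in>A. (1 + t) / 2 + (1 - t) / 2 * c B)"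
proof -
  have "(\<Prod>B\<in>A. (1 - t) / 2 * c B + (1 + t) / 2) =
      (\<Sum>Y\<in>Pow A. (\<Prod>B\<in>Y. (1 - t) / 2 * c B) * (\<Prod>B\<in>A - Y. (1 + t) / 2))"
    by (rule prod_add[OF assms])
  then show ?thesis by (simp only: prod.distrib mult_ac add.commute)
qed

text \<open>If every block is flipped independently with probability \<open>(1 - t) / 2\<close>, then the expected
  value of \<open>p\<close> is a polynomial in \<open>t\<close> of the same degree, and its derivative at 1 sees all
  sensitive blocks at once.\<close>

theorem disjoint_blocks_le_degree:
  fixes c :: "'a set \<Rightarrow> real"
  assumes "finite V" and p: "\<And>Z. p Z = (\<Sum>S | S \<subseteq> V \<and> card S \<le> d. c S * character S Z)"
    and "h > 0" and bound: "\<And>Z. Z \<subseteq> V \<Longrightarrow> \<bar>p Z - m\<bar> \<le> h"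
    and "Z \<subseteq> V" "\<B> \<subseteq> Pow V" "disjoint \<B>" "{} \<notin> \<B>"
    and gap: "\<And>B. B \<in> \<B> \<Longrightarrow> \<epsilon> * (p (sym_diff Z B) - p Z) \<ge> \<delta>" and "\<bar>\<epsilon>\<bar> = 1"
  shows "real (card \<B>) * \<delta> \<le> 2 * h * (real d)\<^sup>2"
proof -
  have finS: "finite S" if "S \<subseteq> V" for S using that assms(1) finite_subset by blast
  have fin\<B>: "finite \<B>" using assms(1,6) finite_subset by blast
  define I where "I = {S. S \<subseteq> V \<and> card S \<le> d}"
  have finI: "finite I" using assms(1) by (simp add: I_def)
  \<comment> \<open>Only flips of these blocks change the sign of \<open>character S\<close>. Being
    disjoint, they meet \<open>S\<close> in different elements; hence the degree bound.\<close>
  define odd_blocks where "odd_blocks = (\<lambda>S. {B\<in>\<B>. character S B = -1})"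
  have card_odd: "card (odd_blocks S) \<le> card S" if "S \<subseteq> V" for S
  proof -
    have "S \<inter> B \<noteq> {}" if "B \<in> odd_blocks S" for B
      using that by (auto simp: odd_blocks_def character_def)
    then have "\<exists>i. i \<in> S \<inter> B" if "B \<in> odd_blocks S" for B
      using that by blast
    then obtain i where i: "\<And>B. B \<in> odd_blocks S \<Longrightarrow> i B \<in> S \<inter> B" by metis
    have "inj_on i (odd_blocks S)"
    proof (rule inj_onI)
      fix A B assume AB: "A \<in> odd_blocks S" "B \<in> odd_blocks S" "i A = i B"
      then have "A \<inter> B \<noteq> {}" using i[of A] i[of B] by auto
      then show "A = B" using AB(1,2) assms(7) by (auto simp: odd_blocks_def disjoint_def)
    qed
    then show ?thesis using i finS[OF that] by (intro card_inj_on_le[of i]) auto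
  qed
  define P where "P = (\<Sum>S\<in>I. monom (c S * character S Z) (card (odd_blocks S)))"
  have poly_P: "poly P t = (\<Sum>S\<in>I. c S * character S Z * t ^ card (odd_blocks S))" for t
    by (simp add: P_def poly_sum poly_monom)
  \<comment> \<open>A block in \<open>odd_blocks S\<close> contributes (1 + t) / 2 - (1 - t) / 2 =
    t, any other block 1.\<close>
  have prod_odd: "(\<Prod>B\<in>\<B>. (1 + t) / 2 + (1 - t) / 2 * character S B) = t ^ card (odd_blocks S)" for t S
  proof -
    have "(\<Prod>B\<in>\<B>. (1 + t) / 2 + (1 - t) / 2 * character S B) = (\<Prod>B\<in>\<B>. if B \<in> odd_blocks S then t else 1)"
    proof (rule prod.cong)
      fix B assume "B \<in> \<B>"
      then show "(1 + t) / 2 + (1 - t) / 2 * character S B = (if B \<in> odd_blocks S then t else 1)"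
        using character_cases[of S B] by (auto simp: odd_blocks_def field_simps)
    qed simp
    also have "\<dots> = (\<Prod>B\<in>odd_blocks S. t)"
      using fin\<B> by (intro prod.mono_neutral_cong_right) (auto simp: odd_blocks_def)
    finally show ?thesis by simp
  qed
  define w where "w = (\<lambda>t Y. (\<Prod>B\<in>Y. (1 - t) / 2 :: real) * (\<Prod>B\<in>\<B> - Y. (1 + t) / 2))"
  have average: "(\<Sum>Y\<in>Pow \<B>. w t Y * p (sym_diff Z (\<Union>Y))) = poly P t" for t
  proof -
    have "p (sym_diff Z (\<Union>Y)) = (\<Sum>S\<in>I. c S * character S Z * (\<Prod>B\<in>Y. character S B))"
      if "Y \<in> Pow \<B>" for Y
    proof -
      have "finite Y" using that fin\<B> finite_subset by blast
      moreover have "disjoint Y" using that assms(7) unfolding disjoint_def by (meson PowD subsetD)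
      ultimately show ?thesis
        unfolding p I_def[symmetric]
        by (intro sum.cong) (simp_all add: character_sym_diff character_disjoint_Union finS I_def)
    qed
    then have "(\<Sum>Y\<in>Pow \<B>. w t Y * p (sym_diff Z (\<Union>Y))) =
        (\<Sum>Y\<in>Pow \<B>. \<Sum>S\<in>I. c S * character S Z * (w t Y * (\<Prod>B\<in>Y. character S B)))"
      by (intro sum.cong) (simp_all add: sum_distrib_left mult_ac)
    also have "\<dots> = (\<Sum>S\<in>I. c S * character S Z * (\<Sum>Y\<in>Pow \<B>. w t Y * (\<Prod>B\<in>Y. character S B)))"
      by (subst sum.swap) (simp add: sum_distrib_left)
    also have "\<dots> = poly P t"
      unfolding w_def sum_flip_prod[OF fin\<B>] prod_odd poly_P ..
    finally show ?thesis .
  qed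
  \<comment> \<open>For t in [-1, 1] the weights form a probability distribution, so
    \<open>poly P t\<close> is a mean of values of \<open>p\<close> and inherits their
    bounds.\<close>
  have "\<bar>poly P t - m\<bar> \<le> h" if "\<bar>t\<bar> \<le> 1" for t
  proof -
    have w_nonneg: "w t Y \<ge> 0" for Y
      using that by (auto simp: w_def intro!: mult_nonneg_nonneg prod_nonneg)
    have sum_w: "(\<Sum>Y\<in>Pow \<B>. w t Y) = 1"
      using sum_flip_prod[OF fin\<B>, of t "\<lambda>_. 1"] by (simp add: w_def field_simps)
    have "poly P t - m = (\<Sum>Y\<in>Pow \<B>. w t Y * (p (sym_diff Z (\<Union>Y)) - m))"
      using sum_w by (simp add: right_diff_distrib sum_subtractf average flip: sum_distrib_right)
    also have "\<bar>\<dots>\<bar> \<le> (\<Sum>Y\<in>Pow \<B>. w t Y * h)"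
    proof (intro order_trans[OF sum_abs] sum_mono)
      fix Y assume "Y \<in> Pow \<B>"
      then have "sym_diff Z (\<Union>Y) \<subseteq> V" using assms(5,6) by blast
      then show "\<bar>w t Y * (p (sym_diff Z (\<Union>Y)) - m)\<bar> \<le> w t Y * h"
        using bound w_nonneg[of Y] by (simp add: abs_mult mult_left_mono)
    qed
    also have "\<dots> = h" using sum_w by (simp flip: sum_distrib_right)
    finally show ?thesis .
  qed
  moreover have "degree P \<le> d"
    unfolding P_def
  proof (intro degree_sum_le finI)
    fix S assume "S \<in> I"
    then show "degree (monom (c S * character S Z) (card (odd_blocks S))) \<le> d"
      using card_odd[of S] degree_monom_le[of "c S * character S Z" "card (odd_blocks S)"]
      by (simp add: I_def)
  qed
  ultimately have deriv: "\<bar>poly (pderiv P) 1\<bar> \<le> h * (real d)\<^sup>2"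
    using \<open>h > 0\<close> by (intro markov_endpoint[where m = m]) auto
  have "poly (pderiv P) 1 = (\<Sum>S\<in>I. c S * character S Z * real (card (odd_blocks S)))"
    by (simp add: P_def higher_pderiv_sum[of 1, simplified] pderiv_monom poly_sum poly_monom mult_ac)
  \<comment> \<open>The derivative at 1 counts each coefficient once per odd block. Flipping the
    blocks one at a time counts the same pairs, each with the sign change -2.\<close>
  moreover have "(\<Sum>B\<in>\<B>. p (sym_diff Z B) - p Z) =
      (\<Sum>S\<in>I. c S * character S Z * (\<Sum>B\<in>\<B>. character S B - 1))"
  proof -
    have "(\<Sum>B\<in>\<B>. p (sym_diff Z B) - p Z) = (\<Sum>B\<in>\<B>. \<Sum>S\<in>I. c S * character S Z * (character S B - 1))"
      unfolding p I_def[symmetric] sum_subtractf[symmetric]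
      by (intro sum.cong) (simp_all add: character_sym_diff finS I_def algebra_simps)
    then show ?thesis by (simp add: sum.swap[of _ I] sum_distrib_left)
  qed
  moreover have "(\<Sum>B\<in>\<B>. character S B - 1) = -2 * real (card (odd_blocks S))" for S
  proof -
    have "(\<Sum>B\<in>\<B>. character S B - 1) = (\<Sum>B\<in>\<B>. if B \<in> odd_blocks S then -2 else 0)"
      using character_cases[of S] by (intro sum.cong) (auto simp: odd_blocks_def)
    also have "\<dots> = (\<Sum>B\<in>odd_blocks S. -2)"
      using fin\<B> by (intro sum.mono_neutral_cong_right) (auto simp: odd_blocks_def)
    finally show ?thesis by simp
  qed
  ultimately have "(\<Sum>B\<in>\<B>. p (sym_diff Z B) - p Z) = -2 * poly (pderiv P) 1"
    by (simp add: sum_distrib_left mult_ac)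
  moreover have "real (card \<B>) * \<delta> \<le> \<epsilon> * (\<Sum>B\<in>\<B>. p (sym_diff Z B) - p Z)"
    unfolding sum_distrib_left using gap by (intro sum_bounded_below) simp
  moreover have "\<epsilon> = 1 \<or> \<epsilon> = -1" using \<open>\<bar>\<epsilon>\<bar> = 1\<close> by (auto simp: abs_if split: if_splits)
  ultimately show ?thesis using deriv by auto
qed

section \<open>Cauchy-Schwarz and sums over basis states\<close>

lemma complex_of_real_cmod_power2: "complex_of_real ((cmod z)\<^sup>2) = cnj z * z"
  by (metis complex_norm_square mult.commute)

lemma Cauchy_Schwarz_cmod_sum:
  "cmod (\<Sum>i\<in>I. a i * b i) \<le> sqrt (\<Sum>i\<in>I. (cmod (a i))\<^sup>2) * sqrt (\<Sum>i\<in>I. (cmod (b i))\<^sup>2)"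
proof -
  have "cmod (\<Sum>i\<in>I. a i * b i) \<le> (\<Sum>i\<in>I. cmod (a i) * cmod (b i))"
    by (rule order_trans[OF norm_sum]) (simp add: norm_mult)
  also have "\<dots> \<le> sqrt ((\<Sum>i\<in>I. (cmod (a i))\<^sup>2) * (\<Sum>i\<in>I. (cmod (b i))\<^sup>2))"
    by (intro real_le_rsqrt Cauchy_Schwarz_ineq_sum)
  finally show ?thesis by (simp add: real_sqrt_mult)
qed

lemma sum_Pow_Un:
  assumes "finite A" "finite B" "A \<inter> B = {}"
  shows "(\<Sum>S\<in>Pow (A \<union> B). h S) = (\<Sum>S\<in>Pow A. \<Sum>T\<in>Pow B. h (S \<union> T))"
proof -
  have "(\<Sum>S\<in>Pow (A \<union> B). h S) = (\<Sum>(S, T)\<in>Pow A \<times> Pow B. h (S \<union> T))"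
    by (rule sum.reindex_bij_witness[of _ "\<lambda>(S, T). S \<union> T" "\<lambda>S. (S \<inter> A, S \<inter> B)"])
      (use assms(3) in \<open>auto simp flip: Int_Un_distrib intro: arg_cong[of _ _ h]\<close>)
  then show ?thesis by (simp add: sum.cartesian_product)
qed

lemma sum_Pow_remove:
  assumes "finite A" "q \<in> A"
  shows "(\<Sum>S\<in>Pow A. h S) = (\<Sum>S\<in>Pow (A - {q}). h S) + (\<Sum>S\<in>Pow (A - {q}). h (insert q S))"
proof -
  have "A = (A - {q}) \<union> {q}" using assms by auto
  then have "(\<Sum>S\<in>Pow A. h S) = (\<Sum>S\<in>Pow (A - {q}). \<Sum>T\<in>Pow {q}. h (S \<union> T))"
    using sum_Pow_Un[of "A - {q}" "{q}" h] assms by auto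
  also have "\<dots> = (\<Sum>S\<in>Pow (A - {q}). h S + h (insert q S))"
    by (intro sum.cong) (auto simp: Pow_insert add.commute)
  finally show ?thesis by (simp add: sum.distrib)
qed

section \<open>Contractions\<close>

definition norm_sq :: "nat set \<Rightarrow> qstate \<Rightarrow> real" where
  "norm_sq A w = (\<Sum>S\<in>Pow A. (cmod (w S))\<^sup>2)"

definition mult_vec :: "nat set \<Rightarrow> qop \<Rightarrow> qstate \<Rightarrow> qstate" where
  "mult_vec A X w S = (\<Sum>T\<in>Pow A. X S T * w T)"

text \<open>The blocks of a unitary operator with respect to a passed qubit need not be unitary.
  Contractions are closed under products, adjoints, such blocks and tensoring with matrix units,
  which is all that the backward induction requires.\<close>

definition contraction_on :: "nat set \<Rightarrow> qop \<Rightarrow> bool" where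
  "contraction_on A X \<longleftrightarrow> (\<forall>w. norm_sq A (mult_vec A X w) \<le> norm_sq A w)"

lemma norm_sq_nonneg: "norm_sq A w \<ge> 0"
  by (simp add: norm_sq_def sum_nonneg)

lemma norm_sq_mult_vec_unitary:
  assumes "finite A" "unitary_on A U"
  shows "norm_sq A (mult_vec A U w) = norm_sq A w"
proof -
  have "complex_of_real (norm_sq A (mult_vec A U w)) =
      (\<Sum>S\<in>Pow A. (\<Sum>T\<in>Pow A. cnj (U S T) * cnj (w T)) * (\<Sum>T\<in>Pow A. U S T * w T))"
    by (simp add: norm_sq_def mult_vec_def complex_of_real_cmod_power2 del: of_real_power)
  also have "\<dots> = (\<Sum>S\<in>Pow A. \<Sum>T\<in>Pow A. \<Sum>T'\<in>Pow A. cnj (w T) * w T' * (cnj (U S T) * U S T'))"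
    unfolding sum_product by (intro sum.cong refl) (simp add: mult_ac)
  also have "\<dots> = (\<Sum>T\<in>Pow A. \<Sum>T'\<in>Pow A. \<Sum>S\<in>Pow A. cnj (w T) * w T' * (cnj (U S T) * U S T'))"
    by (subst sum.swap) (intro sum.cong refl sum.swap)
  also have "\<dots> = (\<Sum>T\<in>Pow A. \<Sum>T'\<in>Pow A. cnj (w T) * w T' * of_bool (T = T'))"
    using assms(2) by (intro sum.cong) (auto simp: unitary_on_def simp flip: sum_distrib_left)
  also have "\<dots> = (\<Sum>T\<in>Pow A. cnj (w T) * w T)"
    using assms(1) by (intro sum.cong) (simp_all add: of_bool_def if_distrib cong: if_cong)
  also have "\<dots> = complex_of_real (norm_sq A w)"
    by (simp add: norm_sq_def complex_of_real_cmod_power2 del: of_real_power)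
  finally show ?thesis by (simp only: of_real_eq_iff)
qed

lemma contraction_unitary:
  "finite A \<Longrightarrow> unitary_on A U \<Longrightarrow> contraction_on A U"
  by (simp add: contraction_on_def norm_sq_mult_vec_unitary)

lemma unitary_adjoint: "unitary_on A U \<Longrightarrow> unitary_on A (\<lambda>S T. cnj (U T S))"
  by (auto simp: unitary_on_def)

lemma mult_vec_adjoint:
  "(\<Sum>S\<in>Pow A. cnj (a S) * mult_vec A X b S) =
   (\<Sum>S\<in>Pow A. cnj (mult_vec A (\<lambda>S T. cnj (X T S)) a S) * b S)"
proof -
  have "(\<Sum>S\<in>Pow A. cnj (a S) * mult_vec A X b S) = (\<Sum>S\<in>Pow A. \<Sum>T\<in>Pow A. cnj (a S) * X S T * b T)"
    by (simp add: mult_vec_def sum_distrib_left mult_ac)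
  also have "\<dots> = (\<Sum>T\<in>Pow A. \<Sum>S\<in>Pow A. cnj (a S) * X S T * b T)" by (rule sum.swap)
  finally show ?thesis by (simp add: mult_vec_def sum_distrib_left sum_distrib_right mult_ac)
qed

text \<open>Let v be the adjoint applied to w. The squared norm of v is the inner product of w with
  X v, hence at most |w| |X v| and so at most |w| |v|; it remains to cancel |v|.\<close>

lemma contraction_adjoint:
  assumes "contraction_on A X"
  shows "contraction_on A (\<lambda>S T. cnj (X T S))"
  unfolding contraction_on_def
proof
  fix w
  define v where "v = mult_vec A (\<lambda>S T. cnj (X T S)) w"
  have "complex_of_real (norm_sq A v) = (\<Sum>S\<in>Pow A. cnj (v S) * v S)"
    by (simp add: norm_sq_def complex_of_real_cmod_power2 del: of_real_power)
  also have "\<dots> = (\<Sum>S\<in>Pow A. cnj (w S) * mult_vec A X v S)"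
    by (simp only: mult_vec_adjoint v_def)
  finally have "norm_sq A v = cmod (\<Sum>S\<in>Pow A. cnj (w S) * mult_vec A X v S)"
    by (metis norm_of_real abs_of_nonneg norm_sq_nonneg)
  also have "\<dots> \<le> sqrt (norm_sq A w) * sqrt (norm_sq A (mult_vec A X v))"
    using Cauchy_Schwarz_cmod_sum[of "\<lambda>S. cnj (w S)"] by (simp add: norm_sq_def)
  also have "\<dots> \<le> sqrt (norm_sq A w) * sqrt (norm_sq A v)"
    using assms by (intro mult_left_mono real_sqrt_le_mono) (auto simp: contraction_on_def norm_sq_nonneg)
  finally have "sqrt (norm_sq A v) * sqrt (norm_sq A v) \<le> sqrt (norm_sq A w) * sqrt (norm_sq A v)"
    by (simp add: norm_sq_nonneg)
  then show "norm_sq A (mult_vec A (\<lambda>S T. cnj (X T S)) w) \<le> norm_sq A w"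
    unfolding v_def[symmetric] using norm_sq_nonneg[of A v] norm_sq_nonneg[of A w]
    by (cases "norm_sq A v = 0") (auto simp: mult_le_cancel_right simp del: real_sqrt_mult_self)
qed

definition op_mult :: "nat set \<Rightarrow> qop \<Rightarrow> qop \<Rightarrow> qop" where
  "op_mult A X Y S T = (\<Sum>R\<in>Pow A. X S R * Y R T)"

lemma mult_vec_op_mult: "mult_vec A (op_mult A X Y) w = mult_vec A X (mult_vec A Y w)"
proof
  fix S
  have "mult_vec A (op_mult A X Y) w S = (\<Sum>T\<in>Pow A. \<Sum>R\<in>Pow A. X S R * Y R T * w T)"
    by (simp add: mult_vec_def op_mult_def sum_distrib_right)
  also have "\<dots> = (\<Sum>R\<in>Pow A. \<Sum>T\<in>Pow A. X S R * Y R T * w T)" by (rule sum.swap)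
  finally show "mult_vec A (op_mult A X Y) w S = mult_vec A X (mult_vec A Y w) S"
    by (simp add: mult_vec_def sum_distrib_left mult_ac)
qed

lemma contraction_op_mult:
  "contraction_on A X \<Longrightarrow> contraction_on A Y \<Longrightarrow> contraction_on A (op_mult A X Y)"
  unfolding contraction_on_def mult_vec_op_mult by (meson order_trans)

lemma contraction_diagonal:
  assumes "finite A"
  shows "contraction_on A (\<lambda>S T. of_bool (S = T \<and> Q S))"
  unfolding contraction_on_def
proof
  fix w
  have "mult_vec A (\<lambda>S T. of_bool (S = T \<and> Q S)) w S = of_bool (Q S) * w S" if "S \<in> Pow A" for S
  proof -
    have "mult_vec A (\<lambda>S T. of_bool (S = T \<and> Q S)) w S = (\<Sum>T\<in>Pow A. if S = T then of_bool (Q S) * w S else 0)"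
      unfolding mult_vec_def by (intro sum.cong) auto
    then show ?thesis using that assms by simp
  qed
  then show "norm_sq A (mult_vec A (\<lambda>S T. of_bool (S = T \<and> Q S)) w) \<le> norm_sq A w"
    unfolding norm_sq_def by (intro sum_mono) (auto simp: of_bool_def)
qed

text \<open>\<open>X\<close> tensored with the matrix unit \<open>|\<beta>\<rangle>\<langle>\<gamma>|\<close> on the qubit \<open>q\<close>, and the \<open>(\<beta>, \<gamma>)\<close> block of \<open>X\<close>
  with respect to the qubit \<open>q\<close>.\<close>

definition tensor_unit :: "nat \<Rightarrow> bool \<Rightarrow> bool \<Rightarrow> qop \<Rightarrow> qop" where
  "tensor_unit q \<beta> \<gamma> X S T = of_bool ((q \<in> S) = \<beta> \<and> (q \<in> T) = \<gamma>) * X (S - {q}) (T - {q})"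

definition qubit_block :: "nat \<Rightarrow> bool \<Rightarrow> bool \<Rightarrow> qop \<Rightarrow> qop" where
  "qubit_block q \<beta> \<gamma> X S T = X (if \<beta> then insert q S else S) (if \<gamma> then insert q T else T)"

lemma norm_sq_remove:
  assumes "finite A" "q \<in> A"
  shows "norm_sq A w = norm_sq (A - {q}) w + norm_sq (A - {q}) (\<lambda>S. w (insert q S))"
  unfolding norm_sq_def by (rule sum_Pow_remove[OF assms])

lemma norm_sq_cong: "(\<And>S. S \<subseteq> A \<Longrightarrow> v S = w S) \<Longrightarrow> norm_sq A v = norm_sq A w"
  unfolding norm_sq_def by (intro sum.cong) auto

text \<open>Only the component of the vector with value \<open>\<gamma>\<close> at \<open>q\<close>
  is read, and \<open>X\<close> of it is written to the component with value \<open>\<beta>\<close>,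
  so no norm is gained.\<close>

lemma contraction_tensor_unit:
  assumes "finite A" "q \<in> A" "contraction_on (A - {q}) X"
  shows "contraction_on A (tensor_unit q \<beta> \<gamma> X)"
  unfolding contraction_on_def
proof
  fix w :: qstate
  define w' where "w' = (\<lambda>S. w (if \<gamma> then insert q S else S))"
  have vec: "mult_vec A (tensor_unit q \<beta> \<gamma> X) w S =
      of_bool ((q \<in> S) = \<beta>) * mult_vec (A - {q}) X w' (S - {q})" for S
  proof -
    show ?thesis
      unfolding mult_vec_def sum_Pow_remove[OF assms(1,2)] sum_distrib_left sum.distrib[symmetric]
    proof (intro sum.cong refl)
      fix T assume "T \<in> Pow (A - {q})"
      then have "q \<notin> T" "T - {q} = T" by auto
      then show "tensor_unit q \<beta> \<gamma> X S T * w T + tensor_unit q \<beta> \<gamma> X S (insert q T) * w (insert q T) =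
          of_bool ((q \<in> S) = \<beta>) * (X (S - {q}) T * w' T)"
        by (cases \<gamma>) (simp_all add: tensor_unit_def w'_def)
    qed
  qed
  have "norm_sq A (mult_vec A (tensor_unit q \<beta> \<gamma> X) w) = norm_sq (A - {q}) (mult_vec (A - {q}) X w')"
  proof -
    have "norm_sq (A - {q}) (mult_vec A (tensor_unit q \<beta> \<gamma> X) w) =
        norm_sq (A - {q}) (\<lambda>S. of_bool (\<not> \<beta>) * mult_vec (A - {q}) X w' S)"
      by (intro norm_sq_cong) (auto simp: vec Diff_insert_absorb dest!: subsetD)
    moreover have "norm_sq (A - {q}) (\<lambda>S. mult_vec A (tensor_unit q \<beta> \<gamma> X) w (insert q S)) =
        norm_sq (A - {q}) (\<lambda>S. of_bool \<beta> * mult_vec (A - {q}) X w' S)"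
      by (intro norm_sq_cong arg_cong2[of _ _ _ _ "(*)"]) (auto simp: vec intro!: arg_cong2[of _ _ _ _ "(*)"] arg_cong[of _ _ "mult_vec (A - {q}) X w'"])
    ultimately show ?thesis
      unfolding norm_sq_remove[OF assms(1,2), of "mult_vec A (tensor_unit q \<beta> \<gamma> X) w"]
      by (cases \<beta>) (auto simp: norm_sq_def)
  qed
  also have "\<dots> \<le> norm_sq (A - {q}) w'" using assms(3) by (simp add: contraction_on_def)
  also have "\<dots> \<le> norm_sq A w"
    unfolding norm_sq_remove[OF assms(1,2), of w] w'_def
    using norm_sq_nonneg[of "A - {q}"] by (cases \<gamma>) simp_all
  finally show "norm_sq A (mult_vec A (tensor_unit q \<beta> \<gamma> X) w) \<le> norm_sq A w" .
qed

text \<open>Embed the vector as the component with value \<open>\<gamma>\<close> at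
  \<open>q\<close>, which preserves the norm, apply \<open>Y\<close>, and discard the component
  whose value is not \<open>\<beta>\<close>.\<close>

lemma contraction_qubit_block:
  assumes "finite B" "q \<notin> B" "contraction_on (insert q B) Y"
  shows "contraction_on B (qubit_block q \<beta> \<gamma> Y)"
  unfolding contraction_on_def
proof
  fix w :: qstate
  define w' where "w' = (\<lambda>T. of_bool ((q \<in> T) = \<gamma>) * w (T - {q}))"
  have fin: "finite (insert q B)" and ins: "insert q B - {q} = B" using assms by auto
  note remove = sum_Pow_remove[OF fin insertI1, unfolded ins]
  have *: "q \<notin> T" "T - {q} = T" if "T \<subseteq> B" for T using that assms(2) by auto
  have vec: "mult_vec B (qubit_block q \<beta> \<gamma> Y) w S =
      mult_vec (insert q B) Y w' (if \<beta> then insert q S else S)" for S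
    unfolding mult_vec_def remove sum.distrib[symmetric]
    by (intro sum.cong) (auto simp: qubit_block_def w'_def *)
  have "norm_sq B (mult_vec B (qubit_block q \<beta> \<gamma> Y) w) \<le> norm_sq (insert q B) (mult_vec (insert q B) Y w')"
    unfolding norm_sq_remove[OF fin insertI1, unfolded ins] vec
    using norm_sq_nonneg[of B] by (cases \<beta>) simp_all
  also have "\<dots> \<le> norm_sq (insert q B) w'" using assms(3) by (simp add: contraction_on_def)
  also have "\<dots> = norm_sq B w"
    unfolding norm_sq_def remove by (cases \<gamma>) (auto simp: w'_def * intro!: sum.cong)
  finally show "norm_sq B (mult_vec B (qubit_block q \<beta> \<gamma> Y) w) \<le> norm_sq B w" .
qed

section \<open>Acceptance probabilities of quantum protocols\<close>

definition quad_form :: "nat set \<Rightarrow> qstate \<Rightarrow> qop \<Rightarrow> complex" where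
  "quad_form D \<psi> E = (\<Sum>S\<in>Pow D. \<Sum>T\<in>Pow D. cnj (\<psi> S) * E S T * \<psi> T)"

text \<open>The Heisenberg picture: \<open>E\<close> preceded by \<open>U\<close> and followed by
  its adjoint, where \<open>U\<close> acts on \<open>A\<close> only. Moving operators from the state
  to the observable makes the latter independent of the initial state.\<close>

definition conjugate_op :: "nat set \<Rightarrow> qop \<Rightarrow> qop \<Rightarrow> qop" where
  "conjugate_op A U E S T = (\<Sum>R\<in>Pow A. \<Sum>R'\<in>Pow A.
     cnj (U R (S \<inter> A)) * E (R \<union> (S - A)) (R' \<union> (T - A)) * U R' (T \<inter> A))"

lemma apply_op_Un:
  assumes "S \<subseteq> A" "T \<inter> A = {}"
  shows "apply_op A U \<psi> (S \<union> T) = (\<Sum>R\<in>Pow A. U S R * \<psi> (R \<union> T))"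
proof -
  have "(S \<union> T) \<inter> A = S" "S \<union> T - A = T" using assms by auto
  then show ?thesis by (simp add: apply_op_def)
qed

text \<open>The basis states of \<open>B\<close> are summed outermost: once they are fixed, an
  operator on \<open>A\<close> affects only the two inner sums.\<close>

lemma quad_form_Un:
  assumes "finite A" "finite B" "A \<inter> B = {}"
  shows "quad_form (A \<union> B) \<psi> E = (\<Sum>S2\<in>Pow B. \<Sum>T2\<in>Pow B. \<Sum>S1\<in>Pow A. \<Sum>T1\<in>Pow A.
    cnj (\<psi> (S1 \<union> S2)) * E (S1 \<union> S2) (T1 \<union> T2) * \<psi> (T1 \<union> T2))"
proof -
  have "quad_form (A \<union> B) \<psi> E = (\<Sum>S1\<in>Pow A. \<Sum>S2\<in>Pow B. \<Sum>T1\<in>Pow A. \<Sum>T2\<in>Pow B.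
      cnj (\<psi> (S1 \<union> S2)) * E (S1 \<union> S2) (T1 \<union> T2) * \<psi> (T1 \<union> T2))"
    unfolding quad_form_def sum_Pow_Un[OF assms] ..
  also have "\<dots> = (\<Sum>S2\<in>Pow B. \<Sum>S1\<in>Pow A. \<Sum>T2\<in>Pow B. \<Sum>T1\<in>Pow A.
      cnj (\<psi> (S1 \<union> S2)) * E (S1 \<union> S2) (T1 \<union> T2) * \<psi> (T1 \<union> T2))"
    by (subst sum.swap) (intro sum.cong refl sum.swap)
  also have "\<dots> = (\<Sum>S2\<in>Pow B. \<Sum>T2\<in>Pow B. \<Sum>S1\<in>Pow A. \<Sum>T1\<in>Pow A.
      cnj (\<psi> (S1 \<union> S2)) * E (S1 \<union> S2) (T1 \<union> T2) * \<psi> (T1 \<union> T2))"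
    by (intro sum.cong refl sum.swap)
  finally show ?thesis .
qed

lemma sum_swap_inner_outer:
  "(\<Sum>a\<in>A. \<Sum>b\<in>B. \<Sum>c\<in>C. \<Sum>d\<in>D. f a b c d) = (\<Sum>c\<in>C. \<Sum>d\<in>D. \<Sum>a\<in>A. \<Sum>b\<in>B. f a b c d)"
proof -
  have "(\<Sum>a\<in>A. \<Sum>b\<in>B. \<Sum>c\<in>C. \<Sum>d\<in>D. f a b c d) = (\<Sum>a\<in>A. \<Sum>c\<in>C. \<Sum>d\<in>D. \<Sum>b\<in>B. f a b c d)"
    by (intro sum.cong refl) (subst sum.swap, intro sum.cong refl sum.swap)
  also have "\<dots> = (\<Sum>c\<in>C. \<Sum>d\<in>D. \<Sum>a\<in>A. \<Sum>b\<in>B. f a b c d)"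
    by (subst sum.swap) (intro sum.cong refl sum.swap)
  finally show ?thesis .
qed

lemma quad_form_apply_op:
  assumes "finite D" "A \<subseteq> D"
  shows "quad_form D (apply_op A U \<psi>) E = quad_form D \<psi> (conjugate_op A U E)"
proof -
  define B where "B = D - A"
  have D: "D = A \<union> B" and fin: "finite A" "finite B" and disj: "A \<inter> B = {}"
    using assms finite_subset by (auto simp: B_def)
  have key: "(\<Sum>S1\<in>Pow A. \<Sum>T1\<in>Pow A. cnj (apply_op A U \<psi> (S1 \<union> S2)) * E (S1 \<union> S2) (T1 \<union> T2) *
        apply_op A U \<psi> (T1 \<union> T2)) =
      (\<Sum>R\<in>Pow A. \<Sum>R'\<in>Pow A. cnj (\<psi> (R \<union> S2)) * conjugate_op A U E (R \<union> S2) (R' \<union> T2) * \<psi> (R' \<union> T2))"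
    (is "?l = ?r") if "S2 \<in> Pow B" "T2 \<in> Pow B" for S2 T2
  proof -
    have disj': "S2 \<inter> A = {}" "T2 \<inter> A = {}" using that disj by auto
    have "?l = (\<Sum>S1\<in>Pow A. \<Sum>T1\<in>Pow A. \<Sum>R\<in>Pow A. \<Sum>R'\<in>Pow A.
        cnj (\<psi> (R \<union> S2)) * (cnj (U S1 R) * E (S1 \<union> S2) (T1 \<union> T2) * U T1 R') * \<psi> (R' \<union> T2))"
      using disj' by (intro sum.cong refl)
        (simp add: apply_op_Un sum_distrib_left sum_distrib_right mult_ac)
    also have "\<dots> = (\<Sum>R\<in>Pow A. \<Sum>R'\<in>Pow A. \<Sum>S1\<in>Pow A. \<Sum>T1\<in>Pow A.
        cnj (\<psi> (R \<union> S2)) * (cnj (U S1 R) * E (S1 \<union> S2) (T1 \<union> T2) * U T1 R') * \<psi> (R' \<union> T2))"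
      by (rule sum_swap_inner_outer)
    also have "\<dots> = ?r"
    proof (intro sum.cong refl)
      fix R R' assume "R \<in> Pow A" "R' \<in> Pow A"
      then have "(R \<union> S2) \<inter> A = R" "R \<union> S2 - A = S2" "(R' \<union> T2) \<inter> A = R'" "R' \<union> T2 - A = T2"
        using disj' by auto
      then show "(\<Sum>S1\<in>Pow A. \<Sum>T1\<in>Pow A. cnj (\<psi> (R \<union> S2)) *
          (cnj (U S1 R) * E (S1 \<union> S2) (T1 \<union> T2) * U T1 R') * \<psi> (R' \<union> T2)) =
          cnj (\<psi> (R \<union> S2)) * conjugate_op A U E (R \<union> S2) (R' \<union> T2) * \<psi> (R' \<union> T2)"
        by (simp add: conjugate_op_def sum_distrib_left sum_distrib_right)
    qed
    finally show ?thesis .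
  qed
  then show ?thesis unfolding D quad_form_Un[OF fin disj] by (intro sum.cong refl key)
qed

text \<open>The number \<open>m\<close> measures communication: local operators preserve it, passing
  a qubit multiplies it by 4, and the sizes of \<open>A\<close> and \<open>B\<close> do not
  enter.\<close>

definition product_sum :: "nat set \<Rightarrow> nat set \<Rightarrow> nat \<Rightarrow> ('x \<Rightarrow> 'y \<Rightarrow> qop) \<Rightarrow> bool" where
  "product_sum A B m E \<longleftrightarrow> (\<exists>L. length L = m \<and>
     (\<forall>(X, Y)\<in>set L. (\<forall>x. contraction_on A (X x)) \<and> (\<forall>y. contraction_on B (Y y))) \<and>
     (\<forall>x y S T. S \<subseteq> A \<union> B \<longrightarrow> T \<subseteq> A \<union> B \<longrightarrow>
       E x y S T = (\<Sum>(X, Y)\<leftarrow>L. X x (S \<inter> A) (T \<inter> A) * Y y (S \<inter> B) (T \<inter> B))))"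

lemma product_sum_swap:
  assumes "product_sum A B m E"
  shows "product_sum B A m (\<lambda>y x. E x y)"
proof -
  obtain L where L: "length L = m"
    "\<forall>(X, Y)\<in>set L. (\<forall>x. contraction_on A (X x)) \<and> (\<forall>y. contraction_on B (Y y))"
    "\<And>x y S T. S \<subseteq> A \<union> B \<Longrightarrow> T \<subseteq> A \<union> B \<Longrightarrow>
       E x y S T = (\<Sum>(X, Y)\<leftarrow>L. X x (S \<inter> A) (T \<inter> A) * Y y (S \<inter> B) (T \<inter> B))"
    using assms unfolding product_sum_def by blast
  show ?thesis
    unfolding product_sum_def
    by (rule exI[of _ "map (\<lambda>(X, Y). (Y, X)) L"])
      (use L(1,2) in \<open>auto simp: L(3) Un_commute case_prod_unfold mult.commute o_def\<close>)
qed

text \<open>As \<open>U\<close> acts on \<open>A\<close> alone, every product keeps its second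
  factor, and its first is conjugated by a unitary operator.\<close>

lemma product_sum_conjugate:
  assumes "finite A" "A \<inter> B = {}" "\<And>x. unitary_on A (U x)" "product_sum A B m E"
  shows "product_sum A B m (\<lambda>x y. conjugate_op A (U x) (E x y))"
proof -
  obtain L where L: "length L = m"
    "\<forall>(X, Y)\<in>set L. (\<forall>x. contraction_on A (X x)) \<and> (\<forall>y. contraction_on B (Y y))"
    "\<And>x y S T. S \<subseteq> A \<union> B \<Longrightarrow> T \<subseteq> A \<union> B \<Longrightarrow>
       E x y S T = (\<Sum>(X, Y)\<leftarrow>L. X x (S \<inter> A) (T \<inter> A) * Y y (S \<inter> B) (T \<inter> B))"
    using assms(4) unfolding product_sum_def by blast
  define C where "C = (\<lambda>X x. op_mult A (\<lambda>S T. cnj (U x T S)) (op_mult A (X x) (U x)))"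
  have "contraction_on A (C X x)" if "(X, Y) \<in> set L" for X Y x
  proof -
    have "contraction_on A (X x)" using that L(2) by auto
    then show ?thesis
      unfolding C_def using contraction_unitary[OF assms(1)] assms(3) unitary_adjoint
      by (intro contraction_op_mult) blast+
  qed
  moreover have "conjugate_op A (U x) (E x y) S T =
      (\<Sum>(X, Y)\<leftarrow>L. C X x (S \<inter> A) (T \<inter> A) * Y y (S \<inter> B) (T \<inter> B))"
    if ST: "S \<subseteq> A \<union> B" "T \<subseteq> A \<union> B" for x y S T
  proof -
    have "E x y (R \<union> (S - A)) (R' \<union> (T - A)) = (\<Sum>(X, Y)\<leftarrow>L. X x R R' * Y y (S \<inter> B) (T \<inter> B))"
      if "R \<in> Pow A" "R' \<in> Pow A" for R R'
    proof -
      have "R \<union> (S - A) \<subseteq> A \<union> B" "R' \<union> (T - A) \<subseteq> A \<union> B" using that ST by auto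
      moreover have "(R \<union> (S - A)) \<inter> A = R" "(R \<union> (S - A)) \<inter> B = S \<inter> B"
          "(R' \<union> (T - A)) \<inter> A = R'" "(R' \<union> (T - A)) \<inter> B = T \<inter> B"
        using that ST assms(2) by auto
      ultimately show ?thesis by (simp add: L(3))
    qed
    then have "conjugate_op A (U x) (E x y) S T = (\<Sum>R\<in>Pow A. \<Sum>R'\<in>Pow A.
        cnj (U x R (S \<inter> A)) * (\<Sum>(X, Y)\<leftarrow>L. X x R R' * Y y (S \<inter> B) (T \<inter> B)) * U x R' (T \<inter> A))"
      by (simp add: conjugate_op_def)
    also have "\<dots> = (\<Sum>(X, Y)\<leftarrow>L. (\<Sum>R\<in>Pow A. \<Sum>R'\<in>Pow A.
        cnj (U x R (S \<inter> A)) * (X x R R' * Y y (S \<inter> B) (T \<inter> B)) * U x R' (T \<inter> A)))"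
      by (induction L) (auto simp: case_prod_unfold sum.distrib ring_distribs)
    also have "\<dots> = (\<Sum>(X, Y)\<leftarrow>L. C X x (S \<inter> A) (T \<inter> A) * Y y (S \<inter> B) (T \<inter> B))"
      by (simp add: C_def op_mult_def sum_distrib_left sum_distrib_right mult_ac)
    finally show ?thesis .
  qed
  ultimately show ?thesis
    unfolding product_sum_def using L(1,2)
    by (intro exI[of _ "map (\<lambda>(X, Y). (C X, Y)) L"]) (auto simp: case_prod_unfold o_def)
qed

text \<open>Passing the qubit \<open>q\<close> replaces each product by four products, one for each block of the
  second factor with respect to \<open>q\<close>.\<close>

lemma product_sum_send:
  fixes E :: "'x \<Rightarrow> 'y \<Rightarrow> qop"
  assumes "finite A" "finite B" "A \<inter> B = {}" "q \<in> A" "product_sum (A - {q}) (insert q B) m E"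
  shows "product_sum A B (4 * m) E"
proof -
  obtain L where L: "length L = m"
    "\<forall>(X, Y)\<in>set L. (\<forall>x. contraction_on (A - {q}) (X x)) \<and> (\<forall>y. contraction_on (insert q B) (Y y))"
    "\<And>x y S T. S \<subseteq> (A - {q}) \<union> insert q B \<Longrightarrow> T \<subseteq> (A - {q}) \<union> insert q B \<Longrightarrow> E x y S T =
      (\<Sum>(X, Y)\<leftarrow>L. X x (S \<inter> (A - {q})) (T \<inter> (A - {q})) * Y y (S \<inter> insert q B) (T \<inter> insert q B))"
    using assms(5) unfolding product_sum_def by blast
  have D: "(A - {q}) \<union> insert q B = A \<union> B" and "q \<notin> B" using assms(3,4) by auto
  define bits where "bits = [(True, True), (True, False), (False, True), (False, False)]"
  define split where "split = (\<lambda>(X :: 'x \<Rightarrow> qop, Y :: 'y \<Rightarrow> qop). map (\<lambda>(\<beta>, \<gamma>).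
    (\<lambda>x. tensor_unit q \<beta> \<gamma> (X x), \<lambda>y. qubit_block q \<beta> \<gamma> (Y y))) bits)"
  have "length (concat (map split L)) = 4 * m"
    unfolding L(1)[symmetric] by (induction L) (auto simp: split_def bits_def)
  moreover have "\<forall>(X, Y)\<in>set (concat (map split L)).
      (\<forall>x. contraction_on A (X x)) \<and> (\<forall>y. contraction_on B (Y y))"
    using L(2) assms(1,2,4) \<open>q \<notin> B\<close>
    by (fastforce simp: split_def bits_def intro!: contraction_tensor_unit contraction_qubit_block)
  moreover have "E x y S T =
      (\<Sum>(X, Y)\<leftarrow>concat (map split L). X x (S \<inter> A) (T \<inter> A) * Y y (S \<inter> B) (T \<inter> B))"
    if "S \<subseteq> A \<union> B" "T \<subseteq> A \<union> B" for x y S T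
  proof -
    have sets: "Z \<inter> insert q B = (if q \<in> Z then insert q (Z \<inter> B) else Z \<inter> B)"
        "Z \<inter> (A - {q}) = Z \<inter> A - {q}" "q \<in> Z \<inter> A \<longleftrightarrow> q \<in> Z" for Z
      using assms(4) by auto
    \<comment> \<open>Of the four terms only the one matching the values of \<open>q\<close> in
      \<open>S\<close> and \<open>T\<close> survives.\<close>
    have "(\<Sum>(X, Y)\<leftarrow>split (X, Y). X x (S \<inter> A) (T \<inter> A) * Y y (S \<inter> B) (T \<inter> B)) =
        X x (S \<inter> (A - {q})) (T \<inter> (A - {q})) * Y y (S \<inter> insert q B) (T \<inter> insert q B)" for X Y
      unfolding sets split_def bits_def
      by (cases "q \<in> S"; cases "q \<in> T") (simp_all add: tensor_unit_def qubit_block_def sets del: Int_iff)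
    then have "(\<Sum>(X, Y)\<leftarrow>concat (map split L). X x (S \<inter> A) (T \<inter> A) * Y y (S \<inter> B) (T \<inter> B)) =
        (\<Sum>(X, Y)\<leftarrow>L. X x (S \<inter> (A - {q})) (T \<inter> (A - {q})) * Y y (S \<inter> insert q B) (T \<inter> insert q B))"
      by (induction L) (auto simp: case_prod_unfold)
    then show ?thesis using that L(3)[unfolded D] by simp
  qed
  ultimately show ?thesis unfolding product_sum_def by blast
qed

lemma product_sum_projection:
  assumes "finite A" "finite B" "q \<in> A"
  shows "product_sum A B 1 (\<lambda>x y S T. of_bool (S = T \<and> (q \<in> S) = b))"
proof -
  have "S = T \<and> (q \<in> S) = b \<longleftrightarrow> (S \<inter> A = T \<inter> A \<and> (q \<in> S \<inter> A) = b) \<and> S \<inter> B = T \<inter> B"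
    if "S \<subseteq> A \<union> B" "T \<subseteq> A \<union> B" for S T using that assms(3) by blast
  then show ?thesis
    unfolding product_sum_def
    using contraction_diagonal[OF assms(1), of "\<lambda>S. (q \<in> S) = b"]
      contraction_diagonal[OF assms(2), of "\<lambda>_. True"]
    by (intro exI[of _ "[(\<lambda>x S T. of_bool (S = T \<and> (q \<in> S) = b), \<lambda>y S T. of_bool (S = T \<and> True))]"])
      (auto simp: of_bool_conj)
qed

lemma outcome_prob_quad_form:
  "complex_of_real (outcome_prob N \<psi> q b) =
    quad_form {..<N} \<psi> (\<lambda>S T. of_bool (S = T \<and> (q \<in> S) = b))"
proof -
  have "quad_form {..<N} \<psi> (\<lambda>S T. of_bool (S = T \<and> (q \<in> S) = b)) =
      (\<Sum>S\<in>Pow {..<N}. \<Sum>T\<in>Pow {..<N}. if S = T then of_bool ((q \<in> S) = b) * (cnj (\<psi> S) * \<psi> S) else 0)"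
    unfolding quad_form_def by (intro sum.cong) auto
  also have "\<dots> = (\<Sum>S\<in>Pow {..<N}. of_bool ((q \<in> S) = b) * complex_of_real ((cmod (\<psi> S))\<^sup>2))"
    by (intro sum.cong) (simp_all add: complex_of_real_cmod_power2 del: of_real_power)
  also have "\<dots> = (\<Sum>S | S \<subseteq> {..<N} \<and> (q \<in> S) = b. complex_of_real ((cmod (\<psi> S))\<^sup>2))"
    by (intro sum.mono_neutral_cong_right) auto
  finally show ?thesis by (simp add: outcome_prob_def)
qed

text \<open>The observable starts as the final projection, a single product, and is pulled back to
  the start of the protocol. \<open>E\<close> is chosen before \<open>\<psi>\<close> because the
  state changes along the induction. Bob's cases are Alice's with the players swapped.\<close>

lemma q_prob_product_sum:
  assumes "q_valid N A P" "A \<subseteq> {..<N}"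
  shows "\<exists>E. product_sum A ({..<N} - A) (4 ^ q_cost P) E \<and>
    (\<forall>\<psi> x y. complex_of_real (q_prob N A \<psi> P x y b) = quad_form {..<N} \<psi> (E x y))"
  using assms
proof (induction P arbitrary: A)
  case (Alice_outputs U q)
  define E where "E = (\<lambda>(x::'a) (y::'b). conjugate_op A (U x) (\<lambda>S T. of_bool (S = T \<and> (q \<in> S) = b)))"
  have "finite A" using Alice_outputs.prems finite_subset by blast
  then have "product_sum A ({..<N} - A) 1 E"
    unfolding E_def using Alice_outputs.prems
    by (intro product_sum_conjugate product_sum_projection) auto
  then show ?case
    using Alice_outputs.prems
    by (intro exI[of _ E]) (simp add: E_def outcome_prob_quad_form quad_form_apply_op)
next
  case (Bob_outputs V q)
  let ?B = "{..<N} - A"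
  define E where "E = (\<lambda>(x::'a) (y::'b). conjugate_op ?B (V y) (\<lambda>S T. of_bool (S = T \<and> (q \<in> S) = b)))"
  have "finite A" using Bob_outputs.prems finite_subset by blast
  then have "product_sum ?B A 1 (\<lambda>y x. E x y)"
    unfolding E_def using Bob_outputs.prems
    by (intro product_sum_conjugate product_sum_projection) auto
  then have "product_sum A ?B 1 E" by (rule product_sum_swap)
  then show ?case
    by (intro exI[of _ E]) (simp add: E_def outcome_prob_quad_form quad_form_apply_op)
next
  case (Alice_sends U q P)
  let ?B = "{..<N} - A"
  have fin: "finite A" "finite ?B" using Alice_sends.prems finite_subset by blast+
  have q: "q \<in> A" "{..<N} - (A - {q}) = insert q ?B" using Alice_sends.prems by auto
  obtain E where E: "product_sum (A - {q}) (insert q ?B) (4 ^ q_cost P) E"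
    "\<And>\<psi> x y. complex_of_real (q_prob N (A - {q}) \<psi> P x y b) = quad_form {..<N} \<psi> (E x y)"
    using Alice_sends.IH[of "A - {q}"] Alice_sends.prems unfolding q(2) by auto
  have "product_sum A ?B (4 * 4 ^ q_cost P) (\<lambda>x y. conjugate_op A (U x) (E x y))"
    using fin q E(1) Alice_sends.prems by (intro product_sum_conjugate product_sum_send) auto
  then show ?case
    using Alice_sends.prems by (intro exI) (auto simp: E(2) quad_form_apply_op)
next
  case (Bob_sends V q P)
  let ?B = "{..<N} - A"
  have fin: "finite A" "finite ?B" using Bob_sends.prems finite_subset by blast+
  have q: "q \<in> ?B" "{..<N} - insert q A = ?B - {q}" using Bob_sends.prems by auto
  obtain E where E: "product_sum (insert q A) (?B - {q}) (4 ^ q_cost P) E"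
    "\<And>\<psi> x y. complex_of_real (q_prob N (insert q A) \<psi> P x y b) = quad_form {..<N} \<psi> (E x y)"
    using Bob_sends.IH[of "insert q A"] Bob_sends.prems unfolding q(2) by auto
  have "product_sum ?B A (4 * 4 ^ q_cost P) (\<lambda>y x. conjugate_op ?B (V y) (E x y))"
    using fin q Bob_sends.prems product_sum_swap[OF E(1)]
    by (intro product_sum_conjugate product_sum_send[where q = q]) auto
  then have "product_sum A ?B (4 * 4 ^ q_cost P) (\<lambda>x y. conjugate_op ?B (V y) (E x y))"
    by (rule product_sum_swap)
  then show ?case
    by (intro exI) (auto simp: E(2) quad_form_apply_op)
qed

theorem q_prob_factorization:
  fixes P :: "('x, 'y) qprotocol"
  assumes "q_valid N A P" "A \<subseteq> {..<N}" "is_qstate N \<psi>"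
  obtains L :: "(('x \<Rightarrow> qstate) \<times> ('y \<Rightarrow> qstate)) list"
  where "length L = 4 ^ q_cost P"
    "\<And>u v x. (u, v) \<in> set L \<Longrightarrow> norm_sq {..<N} (u x) \<le> 1"
    "\<And>u v y. (u, v) \<in> set L \<Longrightarrow> norm_sq {..<N} (v y) \<le> 1"
    "\<And>x y. complex_of_real (q_prob N A \<psi> P x y b) = (\<Sum>(u, v)\<leftarrow>L. \<Sum>R\<in>Pow {..<N}. u x R * v y R)"
proof -
  define B where "B = {..<N} - A"
  have D: "{..<N} = A \<union> B" and fin: "finite A" "finite B" and disj: "A \<inter> B = {}"
    using assms(2) finite_subset by (auto simp: B_def)
  obtain E where E: "product_sum A B (4 ^ q_cost P) E"
    "\<And>x y. complex_of_real (q_prob N A \<psi> P x y b) = quad_form {..<N} \<psi> (E x y)"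
    using q_prob_product_sum[OF assms(1,2)] unfolding B_def by blast
  obtain L where L: "length L = 4 ^ q_cost P"
    "\<forall>(X, Y)\<in>set L. (\<forall>x. contraction_on A (X x)) \<and> (\<forall>y. contraction_on B (Y y))"
    "\<And>x y S T. S \<subseteq> A \<union> B \<Longrightarrow> T \<subseteq> A \<union> B \<Longrightarrow>
       E x y S T = (\<Sum>(X, Y)\<leftarrow>L. X x (S \<inter> A) (T \<inter> A) * Y y (S \<inter> B) (T \<inter> B))"
    using E(1) unfolding product_sum_def by blast
  \<comment> \<open>The bra goes to Alice and the ket to Bob: \<open>v\<close> is the state with
    \<open>Y\<close> applied to \<open>B\<close>, and \<open>u\<close> is the conjugate of the state
    with the adjoint of \<open>X\<close> applied to \<open>A\<close>. Pairing them gives the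
    expectation of the product, and both norms are at most 1 whatever \<open>N\<close> and
    \<open>\<psi>\<close> are.\<close>
  define u where "u = (\<lambda>(X :: 'x \<Rightarrow> qop) x R. \<Sum>S\<in>Pow A. cnj (\<psi> (S \<union> (R \<inter> B))) * X x S (R \<inter> A))"
  define v where "v = (\<lambda>(Y :: 'y \<Rightarrow> qop) y R. \<Sum>T\<in>Pow B. Y y (R \<inter> B) T * \<psi> ((R \<inter> A) \<union> T))"
  have sets: "(T \<union> S) \<inter> A = T" "(T \<union> S) \<inter> B = S" if "T \<in> Pow A" "S \<in> Pow B" for S T
    using that disj by auto
  have norm_\<psi>: "(\<Sum>T\<in>Pow A. \<Sum>S\<in>Pow B. (cmod (\<psi> (T \<union> S)))\<^sup>2) = 1"
    using assms(3) unfolding is_qstate_def D sum_Pow_Un[OF fin disj] .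
  have "norm_sq {..<N} (v Y y) \<le> 1" if "(X, Y) \<in> set L" for X Y y
  proof -
    have Y: "contraction_on B (Y y)" using L(2) that by auto
    have "norm_sq {..<N} (v Y y) = (\<Sum>T\<in>Pow A. norm_sq B (mult_vec B (Y y) (\<lambda>S. \<psi> (T \<union> S))))"
      unfolding norm_sq_def D sum_Pow_Un[OF fin disj] mult_vec_def v_def
      by (intro sum.cong refl) (simp only: sets)
    also have "\<dots> \<le> (\<Sum>T\<in>Pow A. norm_sq B (\<lambda>S. \<psi> (T \<union> S)))"
      using Y by (intro sum_mono) (simp add: contraction_on_def)
    finally show ?thesis using norm_\<psi> by (simp add: norm_sq_def)
  qed
  moreover have "norm_sq {..<N} (u X x) \<le> 1" if "(X, Y) \<in> set L" for X Y x
  proof -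
    define X' where "X' = (\<lambda>S T. cnj (X x T S))"
    have "contraction_on A (X x)" using L(2) that by auto
    then have X: "contraction_on A X'" unfolding X'_def by (rule contraction_adjoint)
    have "norm_sq {..<N} (u X x) = (\<Sum>S\<in>Pow B. norm_sq A (mult_vec A X' (\<lambda>T. \<psi> (T \<union> S))))"
    proof -
      have "cmod (u X x (T \<union> S)) = cmod (mult_vec A X' (\<lambda>T. \<psi> (T \<union> S)) T)"
        if "T \<in> Pow A" "S \<in> Pow B" for S T
      proof -
        have "u X x (T \<union> S) = cnj (mult_vec A X' (\<lambda>T. \<psi> (T \<union> S)) T)"
          unfolding u_def mult_vec_def X'_def sets[OF that] by (simp add: mult.commute)
        then show ?thesis by simp
      qed
      then show ?thesis
        unfolding norm_sq_def D sum_Pow_Un[OF fin disj] by (subst sum.swap) (intro sum.cong, auto)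
    qed
    also have "\<dots> \<le> (\<Sum>S\<in>Pow B. norm_sq A (\<lambda>T. \<psi> (T \<union> S)))"
      using X by (intro sum_mono) (simp add: contraction_on_def)
    also have "\<dots> = 1" unfolding norm_sq_def using norm_\<psi> by (subst sum.swap)
    finally show ?thesis .
  qed
  moreover have "complex_of_real (q_prob N A \<psi> P x y b) =
      (\<Sum>(X, Y)\<leftarrow>L. \<Sum>R\<in>Pow {..<N}. u X x R * v Y y R)" for x y
  proof -
    have "quad_form {..<N} \<psi> (E x y) = (\<Sum>S2\<in>Pow B. \<Sum>T2\<in>Pow B. \<Sum>S1\<in>Pow A. \<Sum>T1\<in>Pow A.
        cnj (\<psi> (S1 \<union> S2)) * (\<Sum>(X, Y)\<leftarrow>L. X x S1 T1 * Y y S2 T2) * \<psi> (T1 \<union> T2))"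
      unfolding D quad_form_Un[OF fin disj]
      by (intro sum.cong refl) (subst L(3), auto simp: sets)
    also have "\<dots> = (\<Sum>(X, Y)\<leftarrow>L. \<Sum>S2\<in>Pow B. \<Sum>T2\<in>Pow B. \<Sum>S1\<in>Pow A. \<Sum>T1\<in>Pow A.
        cnj (\<psi> (S1 \<union> S2)) * (X x S1 T1 * Y y S2 T2) * \<psi> (T1 \<union> T2))"
      by (induction L) (auto simp: case_prod_unfold sum.distrib ring_distribs)
    also have "\<dots> = (\<Sum>(X, Y)\<leftarrow>L. \<Sum>R\<in>Pow {..<N}. u X x R * v Y y R)"
    proof -
      have "(\<Sum>S2\<in>Pow B. \<Sum>T2\<in>Pow B. \<Sum>S1\<in>Pow A. \<Sum>T1\<in>Pow A.
          cnj (\<psi> (S1 \<union> S2)) * (X x S1 T1 * Y y S2 T2) * \<psi> (T1 \<union> T2)) =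
          (\<Sum>R\<in>Pow {..<N}. u X x R * v Y y R)" for X Y
      proof -
        have "(\<Sum>T2\<in>Pow B. \<Sum>S1\<in>Pow A. \<Sum>T1\<in>Pow A.
            cnj (\<psi> (S1 \<union> S2)) * (X x S1 T1 * Y y S2 T2) * \<psi> (T1 \<union> T2)) =
            (\<Sum>T1\<in>Pow A. u X x (T1 \<union> S2) * v Y y (T1 \<union> S2))" if "S2 \<in> Pow B" for S2
        proof -
          have "(\<Sum>T2\<in>Pow B. \<Sum>S1\<in>Pow A. \<Sum>T1\<in>Pow A.
              cnj (\<psi> (S1 \<union> S2)) * (X x S1 T1 * Y y S2 T2) * \<psi> (T1 \<union> T2)) =
              (\<Sum>T2\<in>Pow B. \<Sum>T1\<in>Pow A. \<Sum>S1\<in>Pow A.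
              cnj (\<psi> (S1 \<union> S2)) * (X x S1 T1 * Y y S2 T2) * \<psi> (T1 \<union> T2))"
            by (intro sum.cong refl sum.swap)
          also have "\<dots> = (\<Sum>T1\<in>Pow A. \<Sum>T2\<in>Pow B. \<Sum>S1\<in>Pow A.
              cnj (\<psi> (S1 \<union> S2)) * (X x S1 T1 * Y y S2 T2) * \<psi> (T1 \<union> T2))"
            by (rule sum.swap)
          also have "\<dots> = (\<Sum>T1\<in>Pow A. \<Sum>S1\<in>Pow A. \<Sum>T2\<in>Pow B.
              cnj (\<psi> (S1 \<union> S2)) * (X x S1 T1 * Y y S2 T2) * \<psi> (T1 \<union> T2))"
            by (intro sum.cong refl sum.swap)
          also have "\<dots> = (\<Sum>T1\<in>Pow A. u X x (T1 \<union> S2) * v Y y (T1 \<union> S2))"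
            unfolding u_def v_def using that
            by (intro sum.cong refl) (simp only: sets sum_product, simp add: mult_ac)
          finally show ?thesis .
        qed
        then have "(\<Sum>S2\<in>Pow B. \<Sum>T2\<in>Pow B. \<Sum>S1\<in>Pow A. \<Sum>T1\<in>Pow A.
            cnj (\<psi> (S1 \<union> S2)) * (X x S1 T1 * Y y S2 T2) * \<psi> (T1 \<union> T2)) =
            (\<Sum>S2\<in>Pow B. \<Sum>T1\<in>Pow A. u X x (T1 \<union> S2) * v Y y (T1 \<union> S2))"
          by (rule sum.cong[OF refl])
        also have "\<dots> = (\<Sum>T1\<in>Pow A. \<Sum>S2\<in>Pow B. u X x (T1 \<union> S2) * v Y y (T1 \<union> S2))"
          by (rule sum.swap)
        finally show ?thesis unfolding D sum_Pow_Un[OF fin disj] .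
      qed
      then show ?thesis by simp
    qed
    finally show ?thesis by (simp add: E(2))
  qed
  ultimately show ?thesis
    using L(1) by (intro that[of "map (\<lambda>(X, Y). (u X, v Y)) L"]) (auto simp: case_prod_unfold o_def)
qed

section \<open>Conservation of total probability\<close>

lemma norm_sq_apply_op:
  assumes "unitary_on A U" "A \<subseteq> {..<N}"
  shows "norm_sq {..<N} (apply_op A U \<psi>) = norm_sq {..<N} \<psi>"
proof -
  define B where "B = {..<N} - A"
  have D: "{..<N} = A \<union> B" and fin: "finite A" "finite B" and disj: "A \<inter> B = {}"
    using assms(2) finite_subset by (auto simp: B_def)
  have "norm_sq {..<N} (apply_op A U \<psi>) = (\<Sum>S\<in>Pow B. norm_sq A (mult_vec A U (\<lambda>T. \<psi> (T \<union> S))))"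
    unfolding norm_sq_def D sum_Pow_Un[OF fin disj] mult_vec_def using disj
    by (subst sum.swap) (intro sum.cong refl arg_cong[of _ _ "\<lambda>z. (cmod z)\<^sup>2"] apply_op_Un, auto)
  also have "\<dots> = (\<Sum>S\<in>Pow B. norm_sq A (\<lambda>T. \<psi> (T \<union> S)))"
    using norm_sq_mult_vec_unitary[OF fin(1) assms(1)] by simp
  also have "\<dots> = norm_sq {..<N} \<psi>"
    unfolding norm_sq_def D sum_Pow_Un[OF fin disj] by (rule sum.swap)
  finally show ?thesis .
qed

lemma outcome_prob_nonneg: "outcome_prob N \<psi> q b \<ge> 0"
  by (simp add: outcome_prob_def sum_nonneg)

lemma outcome_prob_sum: "outcome_prob N \<psi> q True + outcome_prob N \<psi> q False = norm_sq {..<N} \<psi>"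
proof -
  have "Pow {..<N} = {S. S \<subseteq> {..<N} \<and> (q \<in> S) = True} \<union> {S. S \<subseteq> {..<N} \<and> (q \<in> S) = False}"
    by auto
  then show ?thesis
    unfolding outcome_prob_def norm_sq_def by (subst sum.union_disjoint[symmetric]) auto
qed

lemma q_prob_nonneg: "q_prob N A \<psi> P x y b \<ge> 0"
  by (induction P arbitrary: A \<psi>) (simp_all add: outcome_prob_nonneg)

lemma q_prob_sum:
  assumes "q_valid N A P" "A \<subseteq> {..<N}"
  shows "q_prob N A \<psi> P x y True + q_prob N A \<psi> P x y False = norm_sq {..<N} \<psi>"
  using assms
proof (induction P arbitrary: A \<psi>)
  case (Alice_sends U q P)
  then have "A - {q} \<subseteq> {..<N}" by auto
  with Alice_sends show ?case by (simp add: norm_sq_apply_op)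
next
  case (Bob_sends V q P)
  then have "insert q A \<subseteq> {..<N}" by auto
  with Bob_sends show ?case by (simp add: norm_sq_apply_op)
qed (auto simp: outcome_prob_sum norm_sq_apply_op)

section \<open>Orthogonality of the characters\<close>

lemma character_eq_prod:
  assumes "finite S"
  shows "character S Z = (\<Prod>i\<in>S. if i \<in> Z then -1 else 1)"
proof -
  have "(\<Prod>i\<in>S. if i \<in> Z then -1 else 1 :: real) = (\<Prod>i\<in>S \<inter> Z. -1)"
    using assms by (intro prod.mono_neutral_cong_right) auto
  then show ?thesis by (simp add: character_def)
qed

lemma sum_Pow_prod:
  fixes e :: "'a \<Rightarrow> real"
  assumes "finite V"
  shows "(\<Sum>S\<in>Pow V. \<Prod>i\<in>S. e i) = (\<Prod>i\<in>V. 1 + e i)"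
  using prod_add[OF assms, of e "\<lambda>_. 1"] by (simp add: add.commute)

lemma sum_Pow_power:
  assumes "finite V"
  shows "(\<Sum>S\<in>Pow V. a ^ card S) = (1 + a :: real) ^ card V"
  using sum_Pow_prod[OF assms, of "\<lambda>_. a"] by simp

text \<open>The sum factors over \<open>V\<close>, and a coordinate lying in just one of
  \<open>Z\<close> and \<open>W\<close> contributes 1 - 1 = 0.\<close>

lemma character_orthogonality:
  assumes "finite V" "Z \<subseteq> V" "W \<subseteq> V"
  shows "(\<Sum>S\<in>Pow V. character S Z * character S W) = (if Z = W then 2 ^ card V else 0)"
proof -
  define e where "e = (\<lambda>i. (if i \<in> Z then -1 else 1) * (if i \<in> W then -1 else 1) :: real)"
  have "(\<Sum>S\<in>Pow V. character S Z * character S W) = (\<Sum>S\<in>Pow V. \<Prod>i\<in>S. e i)"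
  proof (intro sum.cong refl)
    fix S assume "S \<in> Pow V"
    then have "finite S" using assms(1) finite_subset by blast
    then show "character S Z * character S W = (\<Prod>i\<in>S. e i)"
      by (simp add: character_eq_prod e_def prod.distrib)
  qed
  also have "\<dots> = (\<Prod>i\<in>V. 1 + e i)" by (rule sum_Pow_prod[OF assms(1)])
  also have "\<dots> = (if Z = W then 2 ^ card V else 0)"
  proof (cases "Z = W")
    case True
    then have "1 + e i = 2" for i by (simp add: e_def)
    then show ?thesis using True by simp
  next
    case False
    then obtain i where "i \<in> V" "(i \<in> Z) \<noteq> (i \<in> W)" using assms by blast
    then have "\<exists>i\<in>V. 1 + e i = 0" by (intro bexI[of _ i]) (auto simp: e_def)
    then show ?thesis using False assms(1) prod_zero by auto
  qed
  finally show ?thesis .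
qed

section \<open>Fourier coefficients on blocks of orthogonal sign rows\<close>

text \<open>Alice's block values index the rows of a sign matrix, Bob's its columns.
  \<open>balanced\<close> makes an output bit uniform whatever Alice holds;
  \<open>orthogonal\<close> makes the matrices of characters small in spectral norm.\<close>

locale orthogonal_signs =
  fixes n :: nat and AA :: "'a set" and BB :: "'b set" and h :: "'a \<Rightarrow> 'b \<Rightarrow> real"
  assumes finite_AA: "finite AA" and AA_nonempty: "AA \<noteq> {}"
    and finite_BB: "finite BB" and BB_nonempty: "BB \<noteq> {}"
    and sign: "h a b = 1 \<or> h a b = -1"
    and balanced: "a \<in> AA \<Longrightarrow> (\<Sum>b\<in>BB. h a b) = 0"
    and orthogonal: "a \<in> AA \<Longrightarrow> a' \<in> AA \<Longrightarrow>
      (\<Sum>b\<in>BB. h a b * h a' b) = (if a = a' then real (card BB) else 0)"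
begin

definition XX :: "(nat \<Rightarrow> 'a) set" where "XX = PiE {..<n} (\<lambda>_. AA)"

definition YY :: "(nat \<Rightarrow> 'b) set" where "YY = PiE {..<n} (\<lambda>_. BB)"

definition signs :: "(nat \<Rightarrow> 'a) \<Rightarrow> (nat \<Rightarrow> 'b) \<Rightarrow> nat set" where
  "signs x y = {i. i < n \<and> h (x i) (y i) = -1}"

lemma finite_XX: "finite XX"
  unfolding XX_def using finite_AA by (auto intro: finite_PiE)

lemma card_XX: "card XX = card AA ^ n" and card_YY: "card YY = card BB ^ n"
  by (simp_all add: XX_def YY_def card_PiE)

lemma card_AA_pos: "card AA > 0" and card_BB_pos: "card BB > 0"
  using finite_AA AA_nonempty finite_BB BB_nonempty by (auto simp: card_gt_0_iff)

lemma character_signs: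
  assumes "S \<subseteq> {..<n}"
  shows "character S (signs x y) = (\<Prod>i\<in>S. h (x i) (y i))"
proof -
  have "finite S" using assms finite_subset by blast
  then show ?thesis
    unfolding character_eq_prod[OF \<open>finite S\<close>] using assms sign
    by (intro prod.cong) (auto simp: signs_def subset_eq)
qed

text \<open>Bob's coordinates vary independently, so sums over his inputs reduce to the one-block
  properties \<open>balanced\<close> and \<open>orthogonal\<close>; coordinates outside
  \<open>S\<close> are free.\<close>

lemma sum_YY_prod:
  assumes "S \<subseteq> {..<n}"
  shows "(\<Sum>y\<in>YY. \<Prod>i\<in>S. f i (y i)) = (\<Prod>i\<in>S. \<Sum>b\<in>BB. f i b) * real (card BB) ^ (n - card S)"
proof -
  define f' where "f' = (\<lambda>i b. if i \<in> S then f i b else 1 :: real)"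
  have "(\<Prod>i\<in>S. f i (y i)) = (\<Prod>i<n. f' i (y i))" for y
    using assms by (intro prod.mono_neutral_cong_left) (auto simp: f'_def)
  then have "(\<Sum>y\<in>YY. \<Prod>i\<in>S. f i (y i)) = (\<Prod>i<n. \<Sum>b\<in>BB. f' i b)"
    unfolding YY_def using finite_BB by (subst prod_sum_PiE) auto
  also have "\<dots> = (\<Prod>i\<in>S. \<Sum>b\<in>BB. f' i b) * (\<Prod>i\<in>{..<n} - S. \<Sum>b\<in>BB. f' i b)"
    using assms by (subst prod.subset_diff[of S]) (auto simp: mult.commute)
  also have "(\<Prod>i\<in>S. \<Sum>b\<in>BB. f' i b) = (\<Prod>i\<in>S. \<Sum>b\<in>BB. f i b)"
    by (intro prod.cong) (auto simp: f'_def)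
  also have "(\<Prod>i\<in>{..<n} - S. \<Sum>b\<in>BB. f' i b) = (\<Prod>i\<in>{..<n} - S. real (card BB))"
    by (intro prod.cong) (auto simp: f'_def)
  also have "\<dots> = real (card BB) ^ (n - card S)"
    using assms by (simp add: card_Diff_subset finite_subset)
  finally show ?thesis .
qed

lemma sum_YY_character:
  assumes "S \<subseteq> {..<n}" "x \<in> XX"
  shows "(\<Sum>y\<in>YY. character S (signs x y)) = (if S = {} then real (card BB) ^ n else 0)"
proof -
  have "finite S" using assms finite_subset by blast
  have "(\<Prod>i\<in>S. \<Sum>b\<in>BB. h (x i) b) = (if S = {} then 1 else 0)"
    using assms balanced \<open>finite S\<close> by (auto simp: XX_def PiE_iff prod_zero_iff)
  then show ?thesis
    using sum_YY_prod[OF assms(1), of "\<lambda>i. h (x i)"] by (simp add: character_signs[OF assms(1)])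
qed

lemma sum_YY_character_character:
  assumes "S \<subseteq> {..<n}" "x \<in> XX" "x' \<in> XX"
  shows "(\<Sum>y\<in>YY. character S (signs x y) * character S (signs x' y)) =
    (if \<forall>i\<in>S. x i = x' i then real (card BB) ^ n else 0)"
proof -
  have fin: "finite S" using assms finite_subset by blast
  have "card S \<le> n" using card_mono[OF _ assms(1)] by simp
  have "(\<Prod>i\<in>S. \<Sum>b\<in>BB. h (x i) b * h (x' i) b) = (\<Prod>i\<in>S. if x i = x' i then real (card BB) else 0)"
    using assms orthogonal by (intro prod.cong) (auto simp: XX_def PiE_iff)
  also have "\<dots> = (if \<forall>i\<in>S. x i = x' i then real (card BB) ^ card S else 0)"
    using fin by (auto simp: prod_zero_iff)
  finally show ?thesis
    using sum_YY_prod[OF assms(1), of "\<lambda>i b. h (x i) b * h (x' i) b"] \<open>card S \<le> n\<close>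
    by (auto simp: character_signs[OF assms(1)] prod.distrib simp flip: power_add)
qed

lemma card_agreeing:
  assumes "S \<subseteq> {..<n}" "x \<in> XX"
  shows "card {x'\<in>XX. \<forall>i\<in>S. x i = x' i} = card AA ^ (n - card S)"
proof -
  have "{x'\<in>XX. \<forall>i\<in>S. x i = x' i} = PiE {..<n} (\<lambda>i. if i \<in> S then {x i} else AA)"
  proof (intro set_eqI iffI)
    fix x' assume "x' \<in> {x'\<in>XX. \<forall>i\<in>S. x i = x' i}"
    then show "x' \<in> PiE {..<n} (\<lambda>i. if i \<in> S then {x i} else AA)" by (auto simp: XX_def PiE_iff)
  next
    fix x' assume x': "x' \<in> PiE {..<n} (\<lambda>i. if i \<in> S then {x i} else AA)"
    have "x' i \<in> AA" if "i < n" for i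
      using x' that assms(2) by (cases "i \<in> S") (auto simp: XX_def PiE_iff dest!: bspec[of _ _ i])
    moreover have "x i = x' i" if "i \<in> S" for i
      using x' that assms(1) by (auto simp: PiE_iff dest!: bspec[of _ _ i])
    ultimately show "x' \<in> {x'\<in>XX. \<forall>i\<in>S. x i = x' i}" using x' by (auto simp: XX_def PiE_iff)
  qed
  then have "card {x'\<in>XX. \<forall>i\<in>S. x i = x' i} = (\<Prod>i<n. if i \<in> S then 1 else card AA)"
    by (simp add: card_PiE if_distrib cong: if_cong)
  also have "\<dots> = (\<Prod>i\<in>{..<n} - S. card AA)"
    by (intro prod.mono_neutral_cong_right) auto
  finally show ?thesis using assms by (simp add: card_Diff_subset finite_subset)
qed

text \<open>A Schur test for the Gram matrix of the rows.\<close>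

lemma sum_character_rows_le:
  fixes a :: "(nat \<Rightarrow> 'a) \<Rightarrow> complex"
  assumes S: "S \<subseteq> {..<n}"
  shows "(\<Sum>y\<in>YY. (cmod (\<Sum>x\<in>XX. of_real (character S (signs x y)) * a x))\<^sup>2) \<le>
    real (card BB) ^ n * real (card AA) ^ (n - card S) * (\<Sum>x\<in>XX. (cmod (a x))\<^sup>2)"
proof -
  let ?\<chi> = "\<lambda>x y. complex_of_real (character S (signs x y))"
  define N where "N = real (card BB) ^ n"
  define agree where "agree = (\<lambda>x x'. \<forall>i\<in>S. x i = (x' i :: 'a))"
  have N: "(\<Sum>y\<in>YY. ?\<chi> x y * ?\<chi> x' y) = (if agree x x' then of_real N else 0)" if "x \<in> XX" "x' \<in> XX" for x x'
    using sum_YY_character_character[OF S that] by (auto simp: agree_def N_def simp flip: of_real_mult of_real_sum)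
  have "complex_of_real (\<Sum>y\<in>YY. (cmod (\<Sum>x\<in>XX. ?\<chi> x y * a x))\<^sup>2) =
      (\<Sum>y\<in>YY. (\<Sum>x\<in>XX. ?\<chi> x y * cnj (a x)) * (\<Sum>x\<in>XX. ?\<chi> x y * a x))"
    by (simp add: complex_of_real_cmod_power2 del: of_real_power)
  also have "\<dots> = (\<Sum>y\<in>YY. \<Sum>x\<in>XX. \<Sum>x'\<in>XX. cnj (a x) * a x' * (?\<chi> x y * ?\<chi> x' y))"
    unfolding sum_product by (intro sum.cong refl) (simp add: mult_ac)
  also have "\<dots> = (\<Sum>x\<in>XX. \<Sum>x'\<in>XX. \<Sum>y\<in>YY. cnj (a x) * a x' * (?\<chi> x y * ?\<chi> x' y))"
    by (subst sum.swap) (intro sum.cong refl sum.swap)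
  also have "\<dots> = (\<Sum>x\<in>XX. \<Sum>x'\<in>XX. cnj (a x) * a x' * (if agree x x' then of_real N else 0))"
    by (intro sum.cong refl) (simp add: N flip: sum_distrib_left)
  finally have eq: "complex_of_real (\<Sum>y\<in>YY. (cmod (\<Sum>x\<in>XX. ?\<chi> x y * a x))\<^sup>2) = \<dots>" .
  have "(\<Sum>y\<in>YY. (cmod (\<Sum>x\<in>XX. ?\<chi> x y * a x))\<^sup>2) =
      cmod (\<Sum>x\<in>XX. \<Sum>x'\<in>XX. cnj (a x) * a x' * (if agree x x' then of_real N else 0))"
    unfolding eq[symmetric] norm_of_real by (simp add: sum_nonneg)
  also have "\<dots> \<le> (\<Sum>x\<in>XX. \<Sum>x'\<in>XX. cmod (cnj (a x) * a x' * (if agree x x' then of_real N else 0)))"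
    by (intro order_trans[OF norm_sum] sum_mono norm_sum)
  \<comment> \<open>Bounding a product by half the sum of squares splits the double sum into two
    halves. They are equal because \<open>agree\<close> is symmetric, and each row has
    \<open>card AA ^ (n - card S)\<close> nonzero entries.\<close>
  also have "\<dots> \<le> (\<Sum>x\<in>XX. \<Sum>x'\<in>XX. if agree x x' then N / 2 * ((cmod (a x))\<^sup>2 + (cmod (a x'))\<^sup>2) else 0)"
  proof (intro sum_mono)
    fix x x'
    have "2 * (cmod (a x) * cmod (a x')) \<le> (cmod (a x))\<^sup>2 + (cmod (a x'))\<^sup>2"
      using sum_squares_bound[of "cmod (a x)" "cmod (a x')"] by simp
    then have "N / 2 * (2 * (cmod (a x) * cmod (a x'))) \<le> N / 2 * ((cmod (a x))\<^sup>2 + (cmod (a x'))\<^sup>2)"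
      by (intro mult_left_mono) (auto simp: N_def)
    moreover have "N \<ge> 0" by (simp add: N_def)
    ultimately show "cmod (cnj (a x) * a x' * (if agree x x' then of_real N else 0)) \<le>
        (if agree x x' then N / 2 * ((cmod (a x))\<^sup>2 + (cmod (a x'))\<^sup>2) else 0)"
      by (simp add: norm_mult mult_ac)
  qed
  also have "\<dots> = (\<Sum>x\<in>XX. \<Sum>x'\<in>XX. if agree x x' then N / 2 * (cmod (a x))\<^sup>2 else 0) +
      (\<Sum>x\<in>XX. \<Sum>x'\<in>XX. if agree x x' then N / 2 * (cmod (a x'))\<^sup>2 else 0)"
    unfolding sum.distrib[symmetric] by (intro sum.cong refl) (simp add: distrib_left)
  also have "(\<Sum>x\<in>XX. \<Sum>x'\<in>XX. if agree x x' then N / 2 * (cmod (a x'))\<^sup>2 else 0) =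
      (\<Sum>x\<in>XX. \<Sum>x'\<in>XX. if agree x x' then N / 2 * (cmod (a x))\<^sup>2 else 0)"
    by (subst sum.swap) (intro sum.cong refl, auto simp: agree_def)
  also have "(\<Sum>x\<in>XX. \<Sum>x'\<in>XX. if agree x x' then N / 2 * (cmod (a x))\<^sup>2 else 0) =
      (\<Sum>x\<in>XX. real (card AA) ^ (n - card S) * (N / 2 * (cmod (a x))\<^sup>2))"
  proof (intro sum.cong refl)
    fix x assume "x \<in> XX"
    have "(\<Sum>x'\<in>XX. if agree x x' then N / 2 * (cmod (a x))\<^sup>2 else 0) =
        (\<Sum>x'\<in>{x'\<in>XX. agree x x'}. N / 2 * (cmod (a x))\<^sup>2)"
      using finite_XX by (intro sum.mono_neutral_cong_right) auto
    then show "(\<Sum>x'\<in>XX. if agree x x' then N / 2 * (cmod (a x))\<^sup>2 else 0) =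
        real (card AA) ^ (n - card S) * (N / 2 * (cmod (a x))\<^sup>2)"
      using card_agreeing[OF S \<open>x \<in> XX\<close>] by (simp add: agree_def)
  qed
  finally show ?thesis by (simp add: N_def sum_distrib_left mult_ac flip: sum.distrib)
qed

text \<open>The first square root bounds the spectral norm of the matrix with entries
  \<open>character S (signs x y)\<close>.\<close>

lemma character_bilinear_le:
  fixes a :: "(nat \<Rightarrow> 'a) \<Rightarrow> complex" and b :: "(nat \<Rightarrow> 'b) \<Rightarrow> complex"
  assumes "S \<subseteq> {..<n}"
  shows "cmod (\<Sum>x\<in>XX. \<Sum>y\<in>YY. of_real (character S (signs x y)) * (a x * b y)) \<le>
    sqrt (real (card BB) ^ n * real (card AA) ^ (n - card S)) *
      (sqrt (\<Sum>x\<in>XX. (cmod (a x))\<^sup>2) * sqrt (\<Sum>y\<in>YY. (cmod (b y))\<^sup>2))"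
proof -
  have "(\<Sum>x\<in>XX. \<Sum>y\<in>YY. of_real (character S (signs x y)) * (a x * b y)) =
      (\<Sum>y\<in>YY. (\<Sum>x\<in>XX. of_real (character S (signs x y)) * a x) * b y)"
    by (subst sum.swap) (simp add: sum_distrib_left sum_distrib_right mult_ac)
  also have "cmod \<dots> \<le> sqrt (\<Sum>y\<in>YY. (cmod (\<Sum>x\<in>XX. of_real (character S (signs x y)) * a x))\<^sup>2) *
      sqrt (\<Sum>y\<in>YY. (cmod (b y))\<^sup>2)"
    by (rule Cauchy_Schwarz_cmod_sum)
  also have "\<dots> \<le> sqrt (real (card BB) ^ n * real (card AA) ^ (n - card S) * (\<Sum>x\<in>XX. (cmod (a x))\<^sup>2)) *
      sqrt (\<Sum>y\<in>YY. (cmod (b y))\<^sup>2)"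
    by (intro mult_right_mono real_sqrt_le_mono sum_character_rows_le assms) (simp add: sum_nonneg)
  finally show ?thesis by (simp add: real_sqrt_mult mult_ac)
qed

text \<open>Each index \<open>R\<close> gives a bilinear form with the same spectral bound.
  Cauchy-Schwarz over \<open>R\<close> then sees only total squared norms, at most
  \<open>card XX\<close> and \<open>card YY\<close>, so the size of \<open>D\<close>
  disappears.\<close>

lemma character_factorization_le:
  fixes u :: "(nat \<Rightarrow> 'a) \<Rightarrow> qstate" and v :: "(nat \<Rightarrow> 'b) \<Rightarrow> qstate"
  assumes S: "S \<subseteq> {..<n}" and u: "\<And>x. norm_sq D (u x) \<le> 1" and v: "\<And>y. norm_sq D (v y) \<le> 1"
  shows "cmod (\<Sum>x\<in>XX. \<Sum>y\<in>YY. of_real (character S (signs x y)) * (\<Sum>R\<in>Pow D. u x R * v y R)) \<le>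
    real (card AA) ^ n * real (card BB) ^ n / sqrt (real (card AA)) ^ card S"
proof -
  define K where "K = sqrt (real (card BB) ^ n * real (card AA) ^ (n - card S))"
  define \<alpha> where "\<alpha> = (\<lambda>R. sqrt (\<Sum>x\<in>XX. (cmod (u x R))\<^sup>2))"
  define \<beta> where "\<beta> = (\<lambda>R. sqrt (\<Sum>y\<in>YY. (cmod (v y R))\<^sup>2))"
  have "(\<Sum>x\<in>XX. \<Sum>y\<in>YY. of_real (character S (signs x y)) * (\<Sum>R\<in>Pow D. u x R * v y R)) =
      (\<Sum>x\<in>XX. \<Sum>R\<in>Pow D. \<Sum>y\<in>YY. of_real (character S (signs x y)) * (u x R * v y R))"
    unfolding sum_distrib_left by (intro sum.cong refl sum.swap)
  also have "\<dots> = (\<Sum>R\<in>Pow D. \<Sum>x\<in>XX. \<Sum>y\<in>YY. of_real (character S (signs x y)) * (u x R * v y R))"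
    by (rule sum.swap)
  also have "cmod \<dots> \<le> (\<Sum>R\<in>Pow D. K * (\<alpha> R * \<beta> R))"
    unfolding K_def \<alpha>_def \<beta>_def by (intro order_trans[OF norm_sum] sum_mono character_bilinear_le S)
  also have "\<dots> = K * (\<Sum>R\<in>Pow D. \<alpha> R * \<beta> R)" by (simp add: sum_distrib_left)
  also have "\<dots> \<le> K * sqrt ((\<Sum>R\<in>Pow D. (\<alpha> R)\<^sup>2) * (\<Sum>R\<in>Pow D. (\<beta> R)\<^sup>2))"
    by (intro mult_left_mono real_le_rsqrt Cauchy_Schwarz_ineq_sum) (simp add: K_def)
  also have "\<dots> \<le> K * sqrt (real (card AA) ^ n * real (card BB) ^ n)"
  proof -
    have "(\<Sum>R\<in>Pow D. (\<alpha> R)\<^sup>2) = (\<Sum>x\<in>XX. norm_sq D (u x))"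
      unfolding norm_sq_def by (subst sum.swap) (simp add: \<alpha>_def sum_nonneg)
    also have "\<dots> \<le> real (card XX)" using sum_bounded_above[of XX "\<lambda>x. norm_sq D (u x)" 1] u by simp
    finally have "(\<Sum>R\<in>Pow D. (\<alpha> R)\<^sup>2) \<le> real (card AA) ^ n" by (simp add: card_XX)
    moreover have "(\<Sum>R\<in>Pow D. (\<beta> R)\<^sup>2) = (\<Sum>y\<in>YY. norm_sq D (v y))"
      unfolding norm_sq_def by (subst sum.swap) (simp add: \<beta>_def sum_nonneg)
    moreover have "\<dots> \<le> real (card YY)" using sum_bounded_above[of YY "\<lambda>y. norm_sq D (v y)" 1] v by simp
    ultimately show ?thesis
      by (intro mult_left_mono real_sqrt_le_mono mult_mono) (auto simp: K_def card_YY sum_nonneg norm_sq_nonneg)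
  qed
  also have "\<dots> = real (card AA) ^ n * real (card BB) ^ n / sqrt (real (card AA)) ^ card S"
  proof -
    have "card S \<le> n" using card_mono[OF _ S] by simp
    then have "real (card AA) ^ n = real (card AA) ^ (n - card S) * real (card AA) ^ card S"
      by (simp flip: power_add)
    moreover have "sqrt (real (card AA)) ^ n = sqrt (real (card AA)) ^ (n - card S) * sqrt (real (card AA)) ^ card S"
      using \<open>card S \<le> n\<close> by (simp flip: power_add)
    moreover have "sqrt (real (card AA)) ^ j * sqrt (real (card AA)) ^ j = real (card AA) ^ j"
        "sqrt (real (card BB)) ^ j * sqrt (real (card BB)) ^ j = real (card BB) ^ j" for j
      by (simp_all flip: power_mult_distrib)
    ultimately show ?thesis
      using card_AA_pos unfolding K_def real_sqrt_mult real_sqrt_power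
      by (simp add: field_simps)
  qed
  finally show ?thesis .
qed

text \<open>The mean of \<open>character S\<close> times \<open>P\<close> over uniform inputs, which
  is the Fourier coefficient at \<open>S\<close> of the averages of \<open>P\<close> over inputs
  with equal \<open>signs\<close>.\<close>

definition coefficient :: "((nat \<Rightarrow> 'a) \<Rightarrow> (nat \<Rightarrow> 'b) \<Rightarrow> real) \<Rightarrow> nat set \<Rightarrow> real" where
  "coefficient P S = (\<Sum>x\<in>XX. \<Sum>y\<in>YY. character S (signs x y) * P x y) / (real (card AA) ^ n * real (card BB) ^ n)"

lemma abs_coefficient_le:
  assumes S: "S \<subseteq> {..<n}"
    and P: "\<And>x y. complex_of_real (P x y) = (\<Sum>(u, v)\<leftarrow>L. \<Sum>R\<in>Pow D. u x R * v y R)"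
    and L: "\<And>u v x. (u, v) \<in> set L \<Longrightarrow> norm_sq D (u x) \<le> 1"
      "\<And>u v y. (u, v) \<in> set L \<Longrightarrow> norm_sq D (v y) \<le> 1"
  shows "\<bar>coefficient P S\<bar> \<le> real (length L) / sqrt (real (card AA)) ^ card S"
proof -
  define T where "T = real (card AA) ^ n * real (card BB) ^ n"
  have "T > 0" using card_AA_pos card_BB_pos by (simp add: T_def)
  have "complex_of_real (\<Sum>x\<in>XX. \<Sum>y\<in>YY. character S (signs x y) * P x y) =
      (\<Sum>x\<in>XX. \<Sum>y\<in>YY. of_real (character S (signs x y)) * (\<Sum>(u, v)\<leftarrow>L. \<Sum>R\<in>Pow D. u x R * v y R))"
    by (simp add: P)
  also have "\<dots> = (\<Sum>(u, v)\<leftarrow>L. \<Sum>x\<in>XX. \<Sum>y\<in>YY. of_real (character S (signs x y)) * (\<Sum>R\<in>Pow D. u x R * v y R))"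
    by (induction L) (auto simp: case_prod_unfold sum.distrib distrib_left)
  also have "cmod \<dots> \<le> (\<Sum>(u, v)\<leftarrow>L. cmod (\<Sum>x\<in>XX. \<Sum>y\<in>YY. of_real (character S (signs x y)) * (\<Sum>R\<in>Pow D. u x R * v y R)))"
    by (induction L) (auto simp: case_prod_unfold intro: norm_triangle_mono)
  also have "\<dots> \<le> (\<Sum>(u, v)\<leftarrow>L. T / sqrt (real (card AA)) ^ card S)"
    unfolding T_def using L by (intro sum_list_mono) (auto intro!: character_factorization_le S)
  also have "\<dots> = real (length L) * (T / sqrt (real (card AA)) ^ card S)"
    by (simp add: case_prod_unfold sum_list_triv)
  finally have "\<bar>\<Sum>x\<in>XX. \<Sum>y\<in>YY. character S (signs x y) * P x y\<bar> \<le> real (length L) * (T / sqrt (real (card AA)) ^ card S)"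
    by (simp only: norm_of_real)
  then show ?thesis
    using \<open>T > 0\<close> unfolding coefficient_def T_def[symmetric] by (simp add: field_simps)
qed

text \<open>The weight is the reciprocal of the number of inputs with \<open>signs x y = Z\<close>: the series averages
  \<open>P\<close> over these inputs.\<close>

lemma fourier_series_eq:
  assumes "Z \<subseteq> {..<n}"
  shows "(\<Sum>S\<in>Pow {..<n}. coefficient P S * character S Z) =
    (\<Sum>x\<in>XX. \<Sum>y\<in>YY. of_bool (signs x y = Z) * (2 ^ n / (real (card AA) ^ n * real (card BB) ^ n)) * P x y)"
proof -
  define T where "T = real (card AA) ^ n * real (card BB) ^ n"
  have "(\<Sum>S\<in>Pow {..<n}. coefficient P S * character S Z) =
      (\<Sum>S\<in>Pow {..<n}. \<Sum>x\<in>XX. \<Sum>y\<in>YY. (P x y / T) * (character S (signs x y) * character S Z))"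
    unfolding coefficient_def T_def[symmetric]
    by (simp add: sum_distrib_left sum_divide_distrib mult_ac)
  also have "\<dots> = (\<Sum>x\<in>XX. \<Sum>y\<in>YY. \<Sum>S\<in>Pow {..<n}. (P x y / T) * (character S (signs x y) * character S Z))"
    by (subst sum.swap) (intro sum.cong refl sum.swap)
  also have "\<dots> = (\<Sum>x\<in>XX. \<Sum>y\<in>YY. of_bool (signs x y = Z) * (2 ^ n / T) * P x y)"
  proof (intro sum.cong refl)
    fix x y
    have "signs x y \<subseteq> {..<n}" by (auto simp: signs_def)
    then show "(\<Sum>S\<in>Pow {..<n}. (P x y / T) * (character S (signs x y) * character S Z)) =
        of_bool (signs x y = Z) * (2 ^ n / T) * P x y"
      using character_orthogonality[of "{..<n}" "signs x y" Z] assms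
      unfolding sum_distrib_left[symmetric] by simp
  qed
  finally show ?thesis by (simp add: T_def)
qed

text \<open>\<open>balanced\<close> kills every coefficient except the one at the empty set.
  Together with \<open>fourier_series_mono\<close> this carries constant bounds on acceptance
  probabilities over to the series.\<close>

lemma fourier_series_const:
  assumes "Z \<subseteq> {..<n}"
  shows "(\<Sum>S\<in>Pow {..<n}. coefficient (\<lambda>_ _. r) S * character S Z) = r"
proof -
  have "coefficient (\<lambda>_ _. r) S = (if S = {} then r else 0)" if "S \<in> Pow {..<n}" for S
    using that card_AA_pos card_BB_pos
    by (simp add: coefficient_def sum_YY_character card_XX flip: sum_distrib_right)
  then have "(\<Sum>S\<in>Pow {..<n}. coefficient (\<lambda>_ _. r) S * character S Z) =
      (\<Sum>S\<in>Pow {..<n}. if S = {} then r else 0)"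
    by (intro sum.cong) auto
  then show ?thesis by simp
qed

lemma fourier_series_mono:
  assumes Z: "Z \<subseteq> {..<n}"
    and le: "\<And>x y. x \<in> XX \<Longrightarrow> y \<in> YY \<Longrightarrow> signs x y = Z \<Longrightarrow> P x y \<le> P' x y"
  shows "(\<Sum>S\<in>Pow {..<n}. coefficient P S * character S Z) \<le>
    (\<Sum>S\<in>Pow {..<n}. coefficient P' S * character S Z)"
  unfolding fourier_series_eq[OF Z]
  by (intro sum_mono) (use le in \<open>auto simp: of_bool_def intro!: divide_right_mono mult_left_mono\<close>)

end

section \<open>The inner product function\<close>

definition ip_sign :: "nat \<Rightarrow> bool list \<Rightarrow> bool list \<Rightarrow> real" where
  "ip_sign k x y = (if IP k x y then -1 else 1)"

lemma ip_sign_eq_prod: "ip_sign k x y = (\<Prod>i<k. if x ! i \<and> y ! i then -1 else 1)"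
proof -
  define m where "m = (\<Sum>i<k. of_bool (x ! i) * of_bool (y ! i) :: nat)"
  have "(\<Prod>i<k. if x ! i \<and> y ! i then -1 else 1) = (\<Prod>i<k. (-1 :: real) ^ (of_bool (x ! i) * of_bool (y ! i)))"
    by (intro prod.cong) auto
  also have "\<dots> = (-1) ^ m" unfolding m_def power_sum ..
  also have "\<dots> = ip_sign k x y"
    unfolding ip_sign_def IP_def m_def[symmetric] by (cases "even m") (auto simp: odd_iff_mod_2_eq_one)
  finally show ?thesis ..
qed

lemma cube_Suc: "cube (Suc k) = (\<lambda>(b, y). b # y) ` (UNIV \<times> cube k)"
  by (auto simp: cube_def length_Suc_conv)

lemma finite_cube: "finite (cube k)"
  by (induction k) (simp_all add: cube_Suc, simp add: cube_def)

lemma card_cube: "card (cube k) = 2 ^ k"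
proof (induction k)
  case (Suc k)
  have "inj_on (\<lambda>(b, y). b # y) (UNIV \<times> cube k)" by (auto simp: inj_on_def)
  then show ?case using Suc by (simp add: cube_Suc card_image card_cartesian_product)
qed (simp add: cube_def)

lemma sum_cube_prod:
  fixes t :: "nat \<Rightarrow> bool \<Rightarrow> real"
  shows "(\<Sum>y\<in>cube k. \<Prod>i<k. t i (y ! i)) = (\<Prod>i<k. t i True + t i False)"
proof (induction k arbitrary: t)
  case (Suc k)
  have "inj_on (\<lambda>(b, y). b # y) (UNIV \<times> cube k)" by (auto simp: inj_on_def)
  then have "(\<Sum>y\<in>cube (Suc k). \<Prod>i<Suc k. t i (y ! i)) =
      (\<Sum>(b, y)\<in>UNIV \<times> cube k. t 0 b * (\<Prod>i<k. t (Suc i) (y ! i)))"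
    unfolding cube_Suc by (subst sum.reindex) (auto simp: case_prod_unfold prod.lessThan_Suc_shift simp del: prod.lessThan_Suc)
  also have "\<dots> = (\<Sum>b\<in>UNIV. \<Sum>y\<in>cube k. t 0 b * (\<Prod>i<k. t (Suc i) (y ! i)))"
    by (simp add: sum.cartesian_product)
  also have "\<dots> = (\<Sum>b\<in>UNIV. t 0 b * (\<Prod>i<k. t (Suc i) True + t (Suc i) False))"
    using Suc[of "\<lambda>i. t (Suc i)"] by (simp flip: sum_distrib_left)
  finally show ?case by (simp add: UNIV_bool prod.lessThan_Suc_shift distrib_right del: prod.lessThan_Suc)
qed (simp add: cube_def)

text \<open>These are the rows of the Sylvester-Hadamard matrix: where \<open>x\<close> and
  \<open>x'\<close> differ, the two choices of \<open>y ! i\<close> cancel.\<close>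

lemma ip_sign_orthogonal:
  assumes "x \<in> cube k" "x' \<in> cube k"
  shows "(\<Sum>y\<in>cube k. ip_sign k x y * ip_sign k x' y) = (if x = x' then 2 ^ k else 0)"
proof -
  define t where "t = (\<lambda>i b. (if x ! i \<and> b then -1 else 1) * (if x' ! i \<and> b then -1 else 1) :: real)"
  have "(\<Sum>y\<in>cube k. ip_sign k x y * ip_sign k x' y) = (\<Sum>y\<in>cube k. \<Prod>i<k. t i (y ! i))"
    by (simp add: ip_sign_eq_prod t_def prod.distrib)
  also have "\<dots> = (\<Prod>i<k. t i True + t i False)" by (rule sum_cube_prod)
  also have "\<dots> = (if x = x' then 2 ^ k else 0)"
  proof (cases "x = x'")
    case True
    then have "t i True + t i False = 2" for i by (simp add: t_def)
    then show ?thesis using True by simp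
  next
    case False
    then obtain i where "i < k" "x ! i \<noteq> x' ! i" using assms by (auto simp: cube_def list_eq_iff_nth_eq)
    then have "\<exists>i\<in>{..<k}. t i True + t i False = 0" by (intro bexI[of _ i]) (auto simp: t_def)
    then show ?thesis using False prod_zero[of "{..<k}"] by auto
  qed
  finally show ?thesis .
qed

text \<open>The zero string gives the constant row, so orthogonality to it is exactly balancedness
  of every other row.\<close>

lemma orthogonal_signs_IP:
  assumes "k \<ge> 1"
  shows "orthogonal_signs (cube k - {replicate k False}) (cube k) (ip_sign k)"
proof
  have "replicate k True \<in> cube k - {replicate k False}" using assms by (cases k) (auto simp: cube_def)
  then show "cube k - {replicate k False} \<noteq> {}" "cube k \<noteq> {}" by auto
  fix a a' assume a: "a \<in> cube k - {replicate k False}"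
  have "ip_sign k (replicate k False) y = 1" for y by (simp add: ip_sign_eq_prod)
  moreover have "replicate k False \<in> cube k" by (simp add: cube_def)
  ultimately show "(\<Sum>b\<in>cube k. ip_sign k a b) = 0"
    using ip_sign_orthogonal[of a k "replicate k False"] a by auto
  assume "a' \<in> cube k - {replicate k False}"
  then show "(\<Sum>b\<in>cube k. ip_sign k a b * ip_sign k a' b) = (if a = a' then real (card (cube k)) else 0)"
    using ip_sign_orthogonal[of a k a'] a by (simp add: card_cube)
qed (auto simp: finite_cube ip_sign_def)

section \<open>Exact protocols\<close>

definition basis_state :: "nat set \<Rightarrow> qstate" where
  "basis_state W = (\<lambda>S. of_bool (S = W))"

definition perm_op :: "(nat set \<Rightarrow> nat set) \<Rightarrow> qop" where
  "perm_op \<pi> = (\<lambda>S T. of_bool (S = \<pi> T))"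

definition toggle :: "nat \<Rightarrow> bool \<Rightarrow> nat set \<Rightarrow> nat set" where
  "toggle q c S = (if c then sym_diff S {q} else S)"

lemma toggle_toggle: "toggle q c (toggle q c S) = S"
  by (auto simp: toggle_def)

lemma unitary_perm_op:
  assumes "finite A" "\<And>S. S \<subseteq> A \<Longrightarrow> \<pi> S \<subseteq> A" "\<And>S. S \<subseteq> A \<Longrightarrow> \<pi> (\<pi> S) = S"
  shows "unitary_on A (perm_op \<pi>)"
  unfolding unitary_on_def
proof (intro ballI conjI)
  fix S T assume ST: "S \<in> Pow A" "T \<in> Pow A"
  have "(\<Sum>R\<in>Pow A. cnj (perm_op \<pi> R S) * perm_op \<pi> R T) = (\<Sum>R\<in>Pow A. if R = \<pi> S then of_bool (\<pi> S = \<pi> T) else 0)"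
    by (intro sum.cong) (auto simp: perm_op_def)
  also have "\<dots> = of_bool (\<pi> S = \<pi> T)" using ST assms(1,2) by simp
  also have "\<pi> S = \<pi> T \<longleftrightarrow> S = T" using ST assms(3) by (metis PowD)
  finally show "(\<Sum>R\<in>Pow A. cnj (perm_op \<pi> R S) * perm_op \<pi> R T) = of_bool (S = T)" .
  have "(\<Sum>R\<in>Pow A. perm_op \<pi> S R * cnj (perm_op \<pi> T R)) = (\<Sum>R\<in>Pow A. if R = \<pi> S then of_bool (S = T) else 0)"
  proof (intro sum.cong refl)
    fix R assume "R \<in> Pow A"
    then have "S = \<pi> R \<longleftrightarrow> R = \<pi> S" using ST assms(3) by (metis PowD)
    moreover have "T = \<pi> R \<longleftrightarrow> R = \<pi> T" using ST \<open>R \<in> Pow A\<close> assms(3) by (metis PowD)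
    moreover have "\<pi> S = \<pi> T \<longleftrightarrow> S = T" using ST assms(3) by (metis PowD)
    ultimately show "perm_op \<pi> S R * cnj (perm_op \<pi> T R) = (if R = \<pi> S then of_bool (S = T) else 0)"
      by (auto simp: perm_op_def)
  qed
  also have "\<dots> = of_bool (S = T)" using ST assms(1,2) by simp
  finally show "(\<Sum>R\<in>Pow A. perm_op \<pi> S R * cnj (perm_op \<pi> T R)) = of_bool (S = T)" .
qed

lemma unitary_toggle:
  assumes "finite A" "q \<in> A"
  shows "unitary_on A (perm_op (toggle q c))"
  using assms by (intro unitary_perm_op) (auto simp: toggle_toggle, auto simp: toggle_def split: if_splits)

lemma apply_op_perm_op:
  assumes "finite A" "\<And>S. S \<subseteq> A \<Longrightarrow> \<pi> S \<subseteq> A"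
  shows "apply_op A (perm_op \<pi>) (basis_state W) = basis_state (\<pi> (W \<inter> A) \<union> (W - A))"
proof
  fix S
  have "apply_op A (perm_op \<pi>) (basis_state W) S =
      (\<Sum>R\<in>Pow A. if R = W \<inter> A then of_bool (S \<inter> A = \<pi> (W \<inter> A) \<and> S - A = W - A) else 0)"
    unfolding apply_op_def
  proof (intro sum.cong refl)
    fix R assume "R \<in> Pow A"
    then have "R \<union> (S - A) = W \<longleftrightarrow> R = W \<inter> A \<and> S - A = W - A" by blast
    then show "perm_op \<pi> (S \<inter> A) R * basis_state W (R \<union> (S - A)) =
        (if R = W \<inter> A then of_bool (S \<inter> A = \<pi> (W \<inter> A) \<and> S - A = W - A) else 0)"
      by (auto simp: perm_op_def basis_state_def)
  qed
  also have "\<dots> = of_bool (S \<inter> A = \<pi> (W \<inter> A) \<and> S - A = W - A)" using assms(1) by simp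
  also have "S \<inter> A = \<pi> (W \<inter> A) \<and> S - A = W - A \<longleftrightarrow> S = \<pi> (W \<inter> A) \<union> (W - A)"
    using assms(2)[of "W \<inter> A"] by blast
  finally show "apply_op A (perm_op \<pi>) (basis_state W) S = basis_state (\<pi> (W \<inter> A) \<union> (W - A)) S"
    by (simp add: basis_state_def)
qed

lemma apply_op_toggle:
  assumes "finite A" "q \<in> A"
  shows "apply_op A (perm_op (toggle q c)) (basis_state W) = basis_state (toggle q c W)"
proof -
  have "toggle q c (W \<inter> A) \<union> (W - A) = toggle q c W" using assms(2) by (auto simp: toggle_def)
  then show ?thesis
    using assms by (subst apply_op_perm_op) (auto simp: toggle_def split: if_splits)
qed

lemma outcome_prob_basis_state:
  assumes "W \<subseteq> {..<N}"
  shows "outcome_prob N (basis_state W) q b = of_bool ((q \<in> W) = b)"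
proof -
  have "outcome_prob N (basis_state W) q b = (\<Sum>S | S \<subseteq> {..<N} \<and> (q \<in> S) = b. if S = W then 1 else 0)"
    unfolding outcome_prob_def by (intro sum.cong) (auto simp: basis_state_def)
  then show ?thesis using assms by (auto simp: sum.delta)
qed

text \<open>Qubit number \<open>q\<close> carries bit number \<open>q\<close> of Alice's input;
  toggling writes the bit into a qubit that starts as 0.\<close>

primrec transmit :: "nat list \<Rightarrow> (bool list, 'y) qprotocol \<Rightarrow> (bool list, 'y) qprotocol" where
  "transmit [] P = P"
| "transmit (q # qs) P = Alice_sends (\<lambda>x. perm_op (toggle q (x ! q))) q (transmit qs P)"

lemma q_valid_transmit:
  assumes "distinct qs" "set qs \<subseteq> A" "finite A"
  shows "q_valid N A (transmit qs P) \<longleftrightarrow> q_valid N (A - set qs) P"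
  using assms
proof (induction qs arbitrary: A)
  case (Cons q qs)
  then have "set qs \<subseteq> A - {q}" "A - set (q # qs) = A - {q} - set qs" by auto
  then show ?case using Cons by (simp add: unitary_toggle)
qed simp

lemma q_prob_transmit:
  assumes "distinct qs" "set qs \<subseteq> A" "finite A" "W \<inter> set qs = {}"
  shows "q_prob N A (basis_state W) (transmit qs P) x y b =
    q_prob N (A - set qs) (basis_state (W \<union> {i\<in>set qs. x ! i})) P x y b"
  using assms
proof (induction qs arbitrary: A W)
  case (Cons q qs)
  let ?W = "toggle q (x ! q) W"
  have sets: "set qs \<subseteq> A - {q}" "A - {q} - set qs = A - set (q # qs)" "?W \<inter> set qs = {}"
    "?W \<union> {i\<in>set qs. x ! i} = W \<union> {i\<in>set (q # qs). x ! i}"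
    using Cons.prems by (auto simp: toggle_def)
  have "q_prob N A (basis_state W) (transmit (q # qs) P) x y b =
      q_prob N (A - {q}) (basis_state ?W) (transmit qs P) x y b"
    using Cons.prems by (simp add: apply_op_toggle)
  also have "\<dots> = q_prob N (A - {q} - set qs) (basis_state (?W \<union> {i\<in>set qs. x ! i})) P x y b"
    using Cons.prems sets(1,3) by (intro Cons.IH) auto
  finally show ?case unfolding sets .
qed simp

text \<open>This makes the \<open>LEAST\<close> in \<open>quantum_cc\<close> meaningful. Alice sends
  her whole input in the qubits below \<open>m\<close>, and Bob writes the value of \<open>F\<close>
  into his qubit \<open>m\<close>.\<close>

lemma exists_exact_quantum_protocol:
  "\<exists>N A \<psi> P. q_computes (cube m) Y F N A \<psi> P"
proof -
  define decode where "decode = (\<lambda>S. map (\<lambda>i. i \<in> S) [0..<m])"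
  \<comment> \<open>Bob's toggle of qubit \<open>m\<close> is controlled by the other qubits only.
    \<open>decode\<close> ignores qubit \<open>m\<close>, so the map is an involution and its matrix
    is unitary.\<close>
  define \<pi> where "\<pi> = (\<lambda>y S. toggle m (F (decode S) y) S)"
  define P where "P = transmit [0..<m] (Bob_outputs (\<lambda>y. perm_op (\<pi> y)) m)"
  have diff: "{..<m} - {0..<m} = {}" by auto
  have "decode (toggle m c S) = decode S" for c S by (auto simp: decode_def toggle_def)
  then have \<pi>_\<pi>: "\<pi> y (\<pi> y S) = S" for y S by (simp add: \<pi>_def toggle_toggle)
  have \<pi>_sub: "\<pi> y S \<subseteq> {..<Suc m}" if "S \<subseteq> {..<Suc m}" for y S
    using that by (auto simp: \<pi>_def toggle_def split: if_splits)
  have "q_valid (Suc m) {..<m} P"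
    unfolding P_def using \<pi>_sub \<pi>_\<pi> by (subst q_valid_transmit) (auto simp: diff subset_iff intro!: unitary_perm_op)
  moreover have "is_qstate (Suc m) (basis_state {})"
  proof -
    have "(\<Sum>S\<in>Pow {..<Suc m}. (cmod (basis_state {} S))\<^sup>2) = (\<Sum>S\<in>Pow {..<Suc m}. if S = {} then 1 else 0)"
      by (intro sum.cong) (auto simp: basis_state_def)
    then show ?thesis unfolding is_qstate_def by (simp add: sum.delta)
  qed
  moreover have "q_prob (Suc m) {..<m} (basis_state {}) P x y (\<not> F x y) = 0" if "x \<in> cube m" for x y
  proof -
    let ?W = "{q\<in>{..<m}. x ! q}"
    have dec: "decode ?W = x" using that by (auto simp: decode_def cube_def intro!: nth_equalityI)
    have W: "?W \<subseteq> {..<Suc m}" by auto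
    have "m \<in> \<pi> y ?W \<longleftrightarrow> F x y" unfolding \<pi>_def dec by (auto simp: toggle_def)
    moreover have "q_prob (Suc m) {..<m} (basis_state {}) P x y (\<not> F x y) =
        outcome_prob (Suc m) (apply_op {..<Suc m} (perm_op (\<pi> y)) (basis_state ?W)) m (\<not> F x y)"
      unfolding P_def by (subst q_prob_transmit) (auto simp: diff)
    moreover have "apply_op {..<Suc m} (perm_op (\<pi> y)) (basis_state ?W) = basis_state (\<pi> y ?W)"
      using apply_op_perm_op[of "{..<Suc m}" "\<pi> y" ?W] \<pi>_sub W
      by (simp add: Int_absorb2 Diff_eq_empty_iff[THEN iffD2])
    ultimately show ?thesis using \<pi>_sub[OF W] by (simp add: outcome_prob_basis_state)
  qed
  ultimately have "q_computes (cube m) Y F (Suc m) {..<m} (basis_state {}) P"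
    by (auto simp: q_computes_def)
  then show ?thesis by blast
qed

section \<open>Optimal protocols and protocols without communication\<close>

lemma quantum_cc_attained:
  obtains N A \<psi> P where "q_computes (cube m) Y F N A \<psi> P" "q_cost P = quantum_cc (cube m) Y F"
proof -
  have "\<exists>c N A \<psi> P. q_computes (cube m) Y F N A \<psi> P \<and> q_cost P = c"
    using exists_exact_quantum_protocol by blast
  then have "\<exists>N A \<psi> P. q_computes (cube m) Y F N A \<psi> P \<and> q_cost P = quantum_cc (cube m) Y F"
    unfolding quantum_cc_def by (rule LeastI_ex)
  then show ?thesis using that by blast
qed

lemma det_cc_le:
  assumes "det_solvable F c (X \<times> Y)"
  shows "det_cc X Y F \<le> c"
proof -
  obtain P where P: "det_cost P \<le> c" "det_computes X Y F P"
    using assms by (auto simp: det_solvable_def det_computes_def)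
  have "det_cc X Y F \<le> det_cost P" unfolding det_cc_def using P(2) by (intro Least_le) blast
  with P(1) show ?thesis by simp
qed

lemma q_computes_accept:
  assumes "q_computes X Y F N A \<psi> P" "x \<in> X" "y \<in> Y"
  shows "F x y \<Longrightarrow> q_prob N A \<psi> P x y True \<ge> 2 / 3" "\<not> F x y \<Longrightarrow> q_prob N A \<psi> P x y True \<le> 1 / 3"
proof -
  have "q_prob N A \<psi> P x y (\<not> F x y) \<le> 1 / 3" using assms by (simp add: q_computes_def)
  moreover have "q_prob N A \<psi> P x y True + q_prob N A \<psi> P x y False = 1"
    using assms q_prob_sum[of N A P \<psi> x y] by (simp add: q_computes_def is_qstate_def norm_sq_def)
  ultimately show "F x y \<Longrightarrow> q_prob N A \<psi> P x y True \<ge> 2 / 3" "\<not> F x y \<Longrightarrow> q_prob N A \<psi> P x y True \<le> 1 / 3"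
    by auto
qed

text \<open>Without messages the acceptance probability is determined by the input of the player who
  outputs. This serves the case in which the claimed bound is 0.\<close>

lemma zero_communication:
  assumes "q_computes X Y F N A \<psi> P" "q_cost P = 0"
  shows "(\<forall>x\<in>X. \<forall>y\<in>Y. \<forall>y'\<in>Y. F x y = F x y') \<or> (\<forall>x\<in>X. \<forall>x'\<in>X. \<forall>y\<in>Y. F x y = F x' y)"
proof -
  have F: "F x y \<longleftrightarrow> q_prob N A \<psi> P x y True > 1 / 2" if "x \<in> X" "y \<in> Y" for x y
    using q_computes_accept[OF assms(1) that] by fastforce
  show ?thesis using assms(2) by (cases P) (auto simp: F)
qed

section \<open>Deterministic evaluation of one inner product\<close>

lemma det_solvable_Alice:
  assumes "det_solvable F c {(x, y)\<in>D. a x}" "det_solvable F c {(x, y)\<in>D. \<not> a x}"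
  shows "det_solvable F (c + 1) D"
proof -
  obtain P P' where "det_cost P \<le> c" "\<forall>(x, y)\<in>{(x, y)\<in>D. a x}. det_run P x y = F x y"
    "det_cost P' \<le> c" "\<forall>(x, y)\<in>{(x, y)\<in>D. \<not> a x}. det_run P' x y = F x y"
    using assms unfolding det_solvable_def by auto
  then show ?thesis unfolding det_solvable_def by (intro exI[of _ "Alice_says a P P'"]) auto
qed

lemma det_solvable_Bob:
  assumes "det_solvable F c {(x, y)\<in>D. a y}" "det_solvable F c {(x, y)\<in>D. \<not> a y}"
  shows "det_solvable F (c + 1) D"
proof -
  obtain P P' where "det_cost P \<le> c" "\<forall>(x, y)\<in>{(x, y)\<in>D. a y}. det_run P x y = F x y"
    "det_cost P' \<le> c" "\<forall>(x, y)\<in>{(x, y)\<in>D. \<not> a y}. det_run P' x y = F x y"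
    using assms unfolding det_solvable_def by auto
  then show ?thesis unfolding det_solvable_def by (intro exI[of _ "Bob_says a P P'"]) auto
qed

lemma IP_cong: "(\<And>i. i < k \<Longrightarrow> x ! i = x' ! i) \<Longrightarrow> IP k x y = IP k x' y"
  unfolding IP_def by (intro arg_cong[of _ _ "\<lambda>s. s mod 2 = 1"] sum.cong) auto

lemma IP_zero [simp]:
  "(\<And>i. i < k \<Longrightarrow> \<not> x ! i) \<Longrightarrow> \<not> IP k x y" "(\<And>i. i < k \<Longrightarrow> \<not> y ! i) \<Longrightarrow> \<not> IP k x y"
  by (simp_all add: IP_def)

text \<open>Alice announces the \<open>k\<close> bits of her block, and Bob replies with the inner
  product.\<close>

lemma det_solvable_IP:
  assumes "det_solvable F c {(x, y)\<in>D. IP k (\<alpha> x) (\<beta> y)}" "det_solvable F c {(x, y)\<in>D. \<not> IP k (\<alpha> x) (\<beta> y)}"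
  shows "det_solvable F (c + (k + 1)) D"
proof -
  define bits where "bits = (\<lambda>x (y :: 'b). {t. t < k \<and> \<alpha> x ! t})"
  have "det_solvable F ((c + 1) + card {..<k} * 1) D"
  proof (rule det_solvable_queries[where g = bits])
    fix R assume "R \<subseteq> {..<k}"
    \<comment> \<open>Alice's block as rebuilt from the announced bits; \<open>IP k\<close> reads
      only the first \<open>k\<close> positions, so it cannot tell \<open>a\<close> from
      \<open>\<alpha> x\<close>.\<close>
    define a where "a = map (\<lambda>t. t \<in> R) [0..<k]"
    have IP_a: "IP k (\<alpha> x) b = IP k a b" if "bits x y \<inter> {..<k} = R" for x y b
      by (intro IP_cong) (use that in \<open>auto simp: a_def bits_def\<close>)
    show "det_solvable F (c + 1) {(x, y)\<in>D. bits x y \<inter> {..<k} = R}"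
    proof (rule det_solvable_Bob[where a = "\<lambda>y. IP k a (\<beta> y)"])
      have "{(x, y) \<in> {(x, y)\<in>D. bits x y \<inter> {..<k} = R}. IP k a (\<beta> y)} \<subseteq> {(x, y)\<in>D. IP k (\<alpha> x) (\<beta> y)}"
        using IP_a by auto
      then show "det_solvable F c {(x, y) \<in> {(x, y)\<in>D. bits x y \<inter> {..<k} = R}. IP k a (\<beta> y)}"
        using assms(1) unfolding det_solvable_def by (meson subsetD)
      have "{(x, y) \<in> {(x, y)\<in>D. bits x y \<inter> {..<k} = R}. \<not> IP k a (\<beta> y)} \<subseteq> {(x, y)\<in>D. \<not> IP k (\<alpha> x) (\<beta> y)}"
        using IP_a by auto
      then show "det_solvable F c {(x, y) \<in> {(x, y)\<in>D. bits x y \<inter> {..<k} = R}. \<not> IP k a (\<beta> y)}"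
        using assms(2) unfolding det_solvable_def by (meson subsetD)
    qed
  next
    fix i D' c' assume "i \<in> {..<k}"
    assume "det_solvable F c' {(x, y)\<in>D'. i \<in> bits x y}" "det_solvable F c' {(x, y)\<in>D'. i \<notin> bits x y}"
    then show "det_solvable F (c' + 1) D'" unfolding bits_def by (rule det_solvable_Alice)
  qed simp
  then show ?thesis by (simp add: algebra_simps)
qed

section \<open>Approximating Fourier series\<close>

lemma pow_1_add_le_3:
  assumes "0 \<le> a" "real n * a \<le> 1"
  shows "(1 + a) ^ n \<le> 3"
proof -
  have "(1 + a) ^ n \<le> exp a ^ n" using assms(1) by (intro power_mono exp_ge_add_one_self) auto
  also have "\<dots> = exp (real n * a)" by (simp add: exp_of_nat_mult)
  also have "\<dots> \<le> exp 1" using assms(2) by simp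
  also have "\<dots> \<le> 3" by (rule exp_le)
  finally show ?thesis .
qed

text \<open>The series stands for the averaged acceptance probability, \<open>r\<close> for the
  inverse square root of the number of nonzero strings, and the bound on \<open>r\<close> for the
  lower bound on \<open>k\<close>.\<close>

locale approximating_series =
  fixes V :: "nat set" and c :: "nat set \<Rightarrow> real" and f :: "nat set \<Rightarrow> bool" and q :: nat and r :: real
  assumes finV: "finite V" and V_nonempty: "V \<noteq> {}"
    and r: "0 \<le> r" "5 * real (card V) * r \<le> 1"
    and decay: "\<And>S. S \<subseteq> V \<Longrightarrow> \<bar>c S\<bar> \<le> 4 ^ q * r ^ card S"
    and accept: "\<And>Z. Z \<subseteq> V \<Longrightarrow> f Z \<Longrightarrow> (\<Sum>S\<in>Pow V. c S * character S Z) \<ge> 2 / 3"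
    and reject: "\<And>Z. Z \<subseteq> V \<Longrightarrow> \<not> f Z \<Longrightarrow> (\<Sum>S\<in>Pow V. c S * character S Z) \<le> 1 / 3"
    and range: "\<And>Z. Z \<subseteq> V \<Longrightarrow> 0 \<le> (\<Sum>S\<in>Pow V. c S * character S Z)"
      "\<And>Z. Z \<subseteq> V \<Longrightarrow> (\<Sum>S\<in>Pow V. c S * character S Z) \<le> 1"
begin

text \<open>With n the size of \<open>V\<close>, \<open>r\<close> is at most 1 / (5 n). Beyond
  degree 2 q + 2 the powers of 1 / 5 are at most 5 ^ (- 2 q - 3), the powers of 1 / n sum to at most
  3, and (4 / 25) ^ q is at most 1. This leaves 3 / 125.\<close>

lemma fourier_tail_le:
  "\<bar>(\<Sum>S\<in>Pow V. c S * character S Z) - (\<Sum>S | S \<subseteq> V \<and> card S \<le> 2 * q + 2. c S * character S Z)\<bar> \<le> 1 / 12"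
proof -
  define H where "H = {S. S \<subseteq> V \<and> \<not> card S \<le> 2 * q + 2}"
  have n: "card V > 0" using finV V_nonempty by (simp add: card_gt_0_iff)
  have finH: "finite H" "finite {S. S \<subseteq> V \<and> card S \<le> 2 * q + 2}" using finV by (auto simp: H_def)
  have "Pow V = H \<union> {S. S \<subseteq> V \<and> card S \<le> 2 * q + 2}" by (auto simp: H_def)
  then have "(\<Sum>S\<in>Pow V. c S * character S Z) - (\<Sum>S | S \<subseteq> V \<and> card S \<le> 2 * q + 2. c S * character S Z) =
      (\<Sum>S\<in>H. c S * character S Z)"
    using finH by (simp add: sum.union_disjoint H_def disjoint_iff)
  also have "\<bar>\<dots>\<bar> \<le> (\<Sum>S\<in>H. 4 ^ q * ((1 / 5) ^ (2 * q + 3) * (1 / real (card V)) ^ card S))"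
  proof (intro order_trans[OF sum_abs] sum_mono)
    fix S assume S: "S \<in> H"
    have "r \<le> 1 / 5 * (1 / real (card V))" using r(2) n by (simp add: field_simps)
    then have "r ^ card S \<le> (1 / 5 * (1 / real (card V))) ^ card S" using r(1) by (intro power_mono)
    also have "\<dots> = (1 / 5) ^ card S * (1 / real (card V)) ^ card S" by (rule power_mult_distrib)
    also have "\<dots> \<le> (1 / 5) ^ (2 * q + 3) * (1 / real (card V)) ^ card S"
      using S by (intro mult_right_mono power_decreasing) (auto simp: H_def)
    finally have "4 ^ q * r ^ card S \<le> 4 ^ q * ((1 / 5) ^ (2 * q + 3) * (1 / real (card V)) ^ card S)" by simp
    moreover have "\<bar>c S\<bar> \<le> 4 ^ q * r ^ card S" using decay S by (simp add: H_def)
    ultimately show "\<bar>c S * character S Z\<bar> \<le> 4 ^ q * ((1 / 5) ^ (2 * q + 3) * (1 / real (card V)) ^ card S)"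
      unfolding abs_mult abs_character by linarith
  qed
  also have "\<dots> \<le> (\<Sum>S\<in>Pow V. 4 ^ q * ((1 / 5) ^ (2 * q + 3) * (1 / real (card V)) ^ card S))"
    using finV by (intro sum_mono2) (auto simp: H_def)
  also have "\<dots> = 4 ^ q * (1 / 5) ^ (2 * q + 3) * (1 + 1 / real (card V)) ^ card V"
    unfolding sum_Pow_power[OF finV, symmetric] by (simp add: sum_distrib_left mult.assoc)
  also have "\<dots> \<le> 4 ^ q * (1 / 5) ^ (2 * q + 3) * 3"
    using n by (intro mult_left_mono pow_1_add_le_3) auto
  also have "4 ^ q * (1 / 5) ^ (2 * q + 3) * 3 = (4 / 25) ^ q * (3 / 125 :: real)"
    by (simp add: power_add power_mult power_divide power3_eq_cube power2_eq_square)
  also have "\<dots> \<le> 1 * (3 / 125)" by (intro mult_right_mono power_le_one) auto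
  finally show ?thesis by simp
qed

text \<open>The tail error 1 / 12 puts the truncation within 7 / 12 of 1 / 2 and leaves a gap of 7 /
  12 - 5 / 12 = 1 / 6 between accepted and rejected inputs. Dividing 2 * 7 / 12 by 1 / 6 gives the
  factor 7.\<close>

lemma block_sensitivity_le_fourier: "block_sensitivity_le V f (7 * (2 * q + 2)\<^sup>2)"
  unfolding block_sensitivity_le_def
proof (intro allI impI)
  fix Z \<B> assume Z: "Z \<subseteq> V" and \<B>: "\<B> \<subseteq> Pow V" "disjoint \<B>" "\<forall>B\<in>\<B>. f (sym_diff Z B) \<noteq> f Z"
  define p where "p = (\<lambda>Z. \<Sum>S | S \<subseteq> V \<and> card S \<le> 2 * q + 2. c S * character S Z)"
  have tail: "\<bar>(\<Sum>S\<in>Pow V. c S * character S Z) - p Z\<bar> \<le> 1 / 12" for Z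
    unfolding p_def by (rule fourier_tail_le)
  define \<epsilon> :: real where "\<epsilon> = (if f Z then -1 else 1)"
  have "real (card \<B>) * (1 / 6) \<le> 2 * (7 / 12) * (real (2 * q + 2))\<^sup>2"
  proof (rule disjoint_blocks_le_degree[where V = V and p = p and c = c and m = "1 / 2" and Z = Z and \<epsilon> = \<epsilon>])
    fix W assume "W \<subseteq> V"
    then show "\<bar>p W - 1 / 2\<bar> \<le> 7 / 12"
      using tail[of W] range[of W] by linarith
  next
    show "{} \<notin> \<B>" using \<B>(3) by force
    fix B assume B: "B \<in> \<B>"
    then have W: "sym_diff Z B \<subseteq> V" "f (sym_diff Z B) \<noteq> f Z" using Z \<B> by blast+
    have "p Z \<ge> 7 / 12 \<and> p (sym_diff Z B) \<le> 5 / 12" if "f Z"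
      using tail[of Z] tail[of "sym_diff Z B"] that W(2) accept[OF Z] reject[OF W(1)] by linarith
    moreover have "p Z \<le> 5 / 12 \<and> p (sym_diff Z B) \<ge> 7 / 12" if "\<not> f Z"
      using tail[of Z] tail[of "sym_diff Z B"] that W(2) reject[OF Z] accept[OF W(1)] by linarith
    ultimately show "1 / 6 \<le> \<epsilon> * (p (sym_diff Z B) - p Z)"
      by (cases "f Z") (auto simp: \<epsilon>_def)
  qed (use finV Z \<B> in \<open>auto simp: p_def \<epsilon>_def\<close>)
  then have "real (card \<B>) \<le> real (7 * (2 * q + 2)\<^sup>2)" by simp
  then show "card \<B> \<le> 7 * (2 * q + 2)\<^sup>2" by (simp only: of_nat_le_iff)
qed

text \<open>Flipping \<open>i\<close> affects only the characters of sets containing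
  \<open>i\<close>. Their coefficients sum to at most 3 * 4 ^ q * r in absolute value and count
  twice, while the series moves by at least 1 / 3. As \<open>r\<close> is about 2 ^ (- k / 2), this
  bounds \<open>k\<close> linearly in \<open>q\<close>.\<close>

lemma sensitive_decay:
  assumes Z: "Z \<subseteq> V" and i: "i \<in> V" and "f (sym_diff Z {i}) \<noteq> f Z"
  shows "1 \<le> 18 * 4 ^ q * r"
proof -
  let ?p = "\<lambda>Z. \<Sum>S\<in>Pow V. c S * character S Z"
  have W: "sym_diff Z {i} \<subseteq> V" using Z i by auto
  have n: "card V > 0" using finV V_nonempty by (simp add: card_gt_0_iff)
  have "1 / 3 \<le> \<bar>?p (sym_diff Z {i}) - ?p Z\<bar>"
    using accept[OF Z] reject[OF Z] accept[OF W] reject[OF W] assms(3) by (cases "f Z") linarith+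
  also have "?p (sym_diff Z {i}) - ?p Z = (\<Sum>S\<in>Pow V. c S * character S Z * (character S {i} - 1))"
    unfolding sum_subtractf[symmetric]
  proof (intro sum.cong refl)
    fix S assume "S \<in> Pow V"
    then have "finite S" using finV finite_subset by blast
    show "c S * character S (sym_diff Z {i}) - c S * character S Z = c S * character S Z * (character S {i} - 1)"
      unfolding character_sym_diff[OF \<open>finite S\<close>] by (simp add: algebra_simps)
  qed
  also have "\<bar>\<dots>\<bar> \<le> (\<Sum>S\<in>Pow V. if i \<in> S then 2 * 4 ^ q * r ^ card S else 0)"
  proof (intro order_trans[OF sum_abs] sum_mono)
    fix S assume "S \<in> Pow V"
    then have "\<bar>c S\<bar> \<le> 4 ^ q * r ^ card S" using decay by simp
    moreover have "character S {i} = (if i \<in> S then -1 else 1)" by (simp add: character_def)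
    ultimately show "\<bar>c S * character S Z * (character S {i} - 1)\<bar> \<le> (if i \<in> S then 2 * 4 ^ q * r ^ card S else 0)"
      by (simp add: abs_mult)
  qed
  also have "\<dots> = (\<Sum>S\<in>Pow (V - {i}). 2 * 4 ^ q * r * r ^ card S)"
  proof -
    have "(\<Sum>S\<in>Pow (V - {i}). if i \<in> S then 2 * 4 ^ q * r ^ card S else 0) = 0"
      by (intro sum.neutral) auto
    moreover have "(\<Sum>S\<in>Pow (V - {i}). if i \<in> insert i S then 2 * 4 ^ q * r ^ card (insert i S) else 0) =
        (\<Sum>S\<in>Pow (V - {i}). 2 * 4 ^ q * r * r ^ card S)"
    proof (intro sum.cong refl)
      fix S assume S: "S \<in> Pow (V - {i})"
      then have "finite S" "i \<notin> S" using finV finite_subset[of S V] by auto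
      then show "(if i \<in> insert i S then 2 * 4 ^ q * r ^ card (insert i S) else 0) = 2 * 4 ^ q * r * r ^ card S"
        by simp
    qed
    ultimately show ?thesis unfolding sum_Pow_remove[OF finV i] by simp
  qed
  also have "\<dots> = 2 * 4 ^ q * r * (1 + r) ^ card (V - {i})"
    using finV by (simp add: sum_Pow_power flip: sum_distrib_left)
  also have "\<dots> \<le> 2 * 4 ^ q * r * 3"
  proof (intro mult_left_mono pow_1_add_le_3)
    have "real (card (V - {i})) * r \<le> 5 * real (card V) * r"
      using r(1) finV card_Diff1_le[of V i] by (intro mult_right_mono) simp_all
    then show "real (card (V - {i})) * r \<le> 1" using r(2) by linarith
  qed (use r in auto)
  finally show ?thesis by simp
qed

end

section \<open>Block composition with inner product\<close>

definition on_sets :: "nat \<Rightarrow> (bool list \<Rightarrow> bool) \<Rightarrow> nat set \<Rightarrow> bool" where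
  "on_sets n f Z = f (map (\<lambda>i. i \<in> Z) [0..<n])"

definition ip_bits :: "nat \<Rightarrow> nat \<Rightarrow> bool list \<Rightarrow> bool list \<Rightarrow> nat set" where
  "ip_bits n k x y = {i. i < n \<and> IP k (block k i x) (block k i y)}"

lemma block_comp_eq: "block_comp n k f (IP k) x y = on_sets n f (ip_bits n k x y)"
  unfolding block_comp_def on_sets_def
  by (intro arg_cong[of _ _ f] map_cong) (auto simp: ip_bits_def)

lemma ip_bits_subset: "ip_bits n k x y \<subseteq> {..<n}"
  by (auto simp: ip_bits_def)

text \<open>If the composed function depends on one player's input only, giving the other player
  zeros shows that it is constant.\<close>

lemma ip_bits_zero:
  "ip_bits n k (replicate (n * k) False) y = {}" "ip_bits n k y (replicate (n * k) False) = {}"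
proof -
  have "\<not> block k i (replicate (n * k) False) ! j" if "i < n" "j < k" for i j
  proof -
    have "Suc i * k \<le> n * k" using that by (intro mult_right_mono) auto
    then have "k \<le> n * k - i * k" by simp
    then show ?thesis using that by (simp add: block_def min_def)
  qed
  then show "ip_bits n k (replicate (n * k) False) y = {}" "ip_bits n k y (replicate (n * k) False) = {}"
    by (auto simp: ip_bits_def)
qed

definition join_blocks :: "nat \<Rightarrow> (nat \<Rightarrow> bool list) \<Rightarrow> bool list" where
  "join_blocks n \<xi> = concat (map \<xi> [0..<n])"

lemma length_join_blocks: "(\<And>i. i < n \<Longrightarrow> length (\<xi> i) = k) \<Longrightarrow> length (join_blocks n \<xi>) = n * k"
  by (induction n) (auto simp: join_blocks_def)

lemma block_join_blocks:
  assumes "\<And>i. i < n \<Longrightarrow> length (\<xi> i) = k" "i < n"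
  shows "block k i (join_blocks n \<xi>) = \<xi> i"
  using assms
proof (induction n)
  case (Suc n)
  have len: "length (join_blocks n \<xi>) = n * k" using Suc.prems by (intro length_join_blocks) auto
  have join: "join_blocks (Suc n) \<xi> = join_blocks n \<xi> @ \<xi> n" by (simp add: join_blocks_def)
  show ?case
  proof (cases "i = n")
    case True
    then show ?thesis using Suc.prems by (simp add: block_def join len)
  next
    case False
    then have "Suc i * k \<le> n * k" using Suc.prems by (intro mult_right_mono) auto
    then have "k + i * k \<le> n * k" by simp
    then have "k \<le> n * k - i * k" "i * k \<le> n * k" by linarith+
    then have "block k i (join_blocks (Suc n) \<xi>) = block k i (join_blocks n \<xi>)"
      by (simp add: block_def join len)
    then show ?thesis using Suc False by auto
  qed
qed simp

text \<open>The decay comes from factoring the acceptance probability; the other bounds pass from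
  probabilities to their averages.\<close>

lemma approximating_series_block_comp:
  assumes "k \<ge> 1" "n \<ge> 1" "25 * (real n)\<^sup>2 \<le> 2 ^ k - 1"
    and comp: "q_computes (cube (n * k)) (cube (n * k)) (block_comp n k f (IP k)) N A \<psi> P"
  shows "\<exists>c. approximating_series {..<n} c (on_sets n f) (q_cost P) (1 / sqrt (2 ^ k - 1))"
proof -
  interpret orthogonal_signs n "cube k - {replicate k False}" "cube k" "ip_sign k"
    using orthogonal_signs_IP[OF assms(1)] .
  have valid: "A \<subseteq> {..<N}" "is_qstate N \<psi>" "q_valid N A P" using comp by (auto simp: q_computes_def)
  have card_AA: "real (card (cube k - {replicate k False})) = 2 ^ k - 1"
  proof -
    have "replicate k False \<in> cube k" by (simp add: cube_def)
    then show ?thesis by (simp add: card_Diff_singleton card_cube of_nat_diff)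
  qed
  \<comment> \<open>Indexing inputs by tuples of blocks restricts Alice to nonzero blocks and makes
    the blocks independent coordinates.\<close>
  define P' where "P' = (\<lambda>\<xi> \<eta>. q_prob N A \<psi> P (join_blocks n \<xi>) (join_blocks n \<eta>) True)"
  obtain L where L: "length L = 4 ^ q_cost P"
    "\<And>u v x. (u, v) \<in> set L \<Longrightarrow> norm_sq {..<N} (u x) \<le> 1"
    "\<And>u v y. (u, v) \<in> set L \<Longrightarrow> norm_sq {..<N} (v y) \<le> 1"
    "\<And>x y. complex_of_real (q_prob N A \<psi> P x y True) = (\<Sum>(u, v)\<leftarrow>L. \<Sum>R\<in>Pow {..<N}. u x R * v y R)"
    using q_prob_factorization[OF valid(3,1,2), of True] by blast
  define L' where "L' = map (\<lambda>(u, v). (\<lambda>\<xi>. u (join_blocks n \<xi>), \<lambda>\<eta>. v (join_blocks n \<eta>))) L"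
  have join: "join_blocks n \<xi> \<in> cube (n * k)" "join_blocks n \<eta> \<in> cube (n * k)"
    "ip_bits n k (join_blocks n \<xi>) (join_blocks n \<eta>) = signs \<xi> \<eta>" if "\<xi> \<in> XX" "\<eta> \<in> YY" for \<xi> \<eta>
  proof -
    have "\<xi> i \<in> cube k" "\<eta> i \<in> cube k" if "i < n" for i
      using \<open>\<xi> \<in> XX\<close> \<open>\<eta> \<in> YY\<close> that by (auto simp: XX_def YY_def PiE_iff)
    then have len: "length (\<xi> i) = k" "length (\<eta> i) = k" if "i < n" for i
      using that by (auto simp: cube_def)
    show "join_blocks n \<xi> \<in> cube (n * k)" "join_blocks n \<eta> \<in> cube (n * k)"
      using length_join_blocks[OF len(1)] length_join_blocks[OF len(2)] by (auto simp: cube_def)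
    show "ip_bits n k (join_blocks n \<xi>) (join_blocks n \<eta>) = signs \<xi> \<eta>"
      using block_join_blocks[of n \<xi> k, OF len(1)] block_join_blocks[of n \<eta> k, OF len(2)]
      by (auto simp: ip_bits_def signs_def ip_sign_def)
  qed
  have P'_accept: "P' \<xi> \<eta> \<ge> 2 / 3" if "\<xi> \<in> XX" "\<eta> \<in> YY" "on_sets n f (signs \<xi> \<eta>)" for \<xi> \<eta>
    unfolding P'_def using q_computes_accept(1)[OF comp join(1,2)[OF that(1,2)]] that join(3)[OF that(1,2)]
    by (simp add: block_comp_eq)
  have P'_reject: "P' \<xi> \<eta> \<le> 1 / 3" if "\<xi> \<in> XX" "\<eta> \<in> YY" "\<not> on_sets n f (signs \<xi> \<eta>)" for \<xi> \<eta>
    unfolding P'_def using q_computes_accept(2)[OF comp join(1,2)[OF that(1,2)]] that join(3)[OF that(1,2)]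
    by (simp add: block_comp_eq)
  have P'_range: "0 \<le> P' \<xi> \<eta>" "P' \<xi> \<eta> \<le> 1" for \<xi> \<eta>
    using q_prob_sum[OF valid(3,1), of \<psi> "join_blocks n \<xi>" "join_blocks n \<eta>"] valid(2)
      q_prob_nonneg[of N A \<psi> P "join_blocks n \<xi>" "join_blocks n \<eta>" True]
      q_prob_nonneg[of N A \<psi> P "join_blocks n \<xi>" "join_blocks n \<eta>" False]
    by (auto simp: P'_def is_qstate_def norm_sq_def)
  define M :: real where "M = 2 ^ k - 1"
  have "0 < 25 * (real n)\<^sup>2" using assms(2) by simp
  then have M: "M > 0" using assms(3) unfolding M_def by linarith
  have "approximating_series {..<n} (coefficient P') (on_sets n f) (q_cost P) (1 / sqrt M)"
  proof
    show "finite {..<n}" by simp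
    show "{..<n} \<noteq> {}" using assms(2) by (auto simp: lessThan_empty_iff)
    show "0 \<le> 1 / sqrt M" using M by simp
    have "5 * real n \<le> sqrt M"
      using assms(3) by (intro real_le_rsqrt) (simp add: power_mult_distrib M_def)
    then show "5 * real (card {..<n}) * (1 / sqrt M) \<le> 1" using M by (simp add: field_simps)
    fix S assume S: "S \<subseteq> {..<n}"
    have "\<bar>coefficient P' S\<bar> \<le> real (length L') / sqrt (real (card (cube k - {replicate k False}))) ^ card S"
    proof (rule abs_coefficient_le[OF S, where D = "{..<N}"])
      show "complex_of_real (P' \<xi> \<eta>) = (\<Sum>(u, v)\<leftarrow>L'. \<Sum>R\<in>Pow {..<N}. u \<xi> R * v \<eta> R)" for \<xi> \<eta>
        by (simp add: P'_def L(4) L'_def case_prod_unfold o_def)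
    qed (use L(2,3) in \<open>auto simp: L'_def\<close>)
    then show "\<bar>coefficient P' S\<bar> \<le> 4 ^ q_cost P * (1 / sqrt M) ^ card S"
      using L(1) by (simp add: L'_def card_AA M_def power_divide)
  next
    fix Z assume Z: "Z \<subseteq> {..<n}"
    show "0 \<le> (\<Sum>S\<in>Pow {..<n}. coefficient P' S * character S Z)"
      using fourier_series_mono[OF Z, of "\<lambda>_ _. 0" P'] P'_range by (simp add: fourier_series_const[OF Z])
    show "(\<Sum>S\<in>Pow {..<n}. coefficient P' S * character S Z) \<le> 1"
      using fourier_series_mono[OF Z, of P' "\<lambda>_ _. 1"] P'_range by (simp add: fourier_series_const[OF Z])
    show "(\<Sum>S\<in>Pow {..<n}. coefficient P' S * character S Z) \<ge> 2 / 3" if "on_sets n f Z"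
      using fourier_series_mono[OF Z, of "\<lambda>_ _. 2 / 3" P'] P'_accept that by (simp add: fourier_series_const[OF Z])
    show "(\<Sum>S\<in>Pow {..<n}. coefficient P' S * character S Z) \<le> 1 / 3" if "\<not> on_sets n f Z"
      using fourier_series_mono[OF Z, of P' "\<lambda>_ _. 1 / 3"] P'_reject that by (simp add: fourier_series_const[OF Z])
  qed
  then show ?thesis unfolding M_def by blast
qed

text \<open>Take a minimal sensitive block inside the difference of \<open>Z\<close> and
  \<open>W\<close>. Flipping all of it but one element does not change the value, so the last
  element is sensitive.\<close>

lemma exists_sensitive_element:
  assumes "finite V" "Z \<subseteq> V" "W \<subseteq> V" "f Z \<noteq> f W"
  obtains Z' i where "Z' \<subseteq> V" "i \<in> V" "f (sym_diff Z' {i}) \<noteq> f Z'"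
proof -
  have "sym_diff Z (sym_diff Z W) = W" by auto
  moreover have "finite (sym_diff Z W)" using assms(1-3) finite_subset by blast
  ultimately obtain B where B: "B \<subseteq> sym_diff Z W" "f (sym_diff Z B) \<noteq> f Z"
      "\<And>i. i \<in> B \<Longrightarrow> f (sym_diff Z (B - {i})) = f Z"
    using sensitive_block_minimal[of "sym_diff Z W" f Z] assms(4) by metis
  from B(2) have "B \<noteq> {}" by auto
  then obtain i where i: "i \<in> B" by blast
  have "sym_diff (sym_diff Z (B - {i})) {i} = sym_diff Z B" using i by auto
  then show ?thesis
    using B i assms(2,3) by (intro that[of "sym_diff Z (B - {i})" i]) auto
qed

theorem corollary1p6:
  "\<exists>C::real. C > 0 \<and>
     (\<forall>(k::nat) (n::nat) (f :: bool list \<Rightarrow> bool).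
        k \<ge> 1 \<longrightarrow> n \<ge> 1 \<longrightarrow> real k \<ge> 2 * log 2 (real n) + 5 \<longrightarrow>
        real (det_cc (cube (n * k)) (cube (n * k)) (block_comp n k f (IP k)))
          \<le> C * real (quantum_cc (cube (n * k)) (cube (n * k)) (block_comp n k f (IP k))) ^ 7)"
\<comment> \<open>For q >= 1 the block sensitivity is at most 7 * (2 q + 2) ^ 2 <= 112 q ^ 2, to be
  cubed, and a query costs k + 1 <= 14 q bits.\<close>
proof (intro exI[of _ "112 ^ 3 * 14 :: real"] conjI allI impI)
  fix k n :: nat and f :: "bool list \<Rightarrow> bool"
  assume k: "k \<ge> 1" and n: "n \<ge> 1" and kn: "real k \<ge> 2 * log 2 (real n) + 5"
  define F where "F = block_comp n k f (IP k)"
  define X where "X = cube (n * k)"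
  define q where "q = quantum_cc X X F"
  obtain N A \<psi> P where comp: "q_computes X X F N A \<psi> P" and cost: "q_cost P = q"
    using quantum_cc_attained unfolding X_def q_def by metis
  have F: "F x y = on_sets n f (ip_bits n k x y)" for x y
    by (simp add: F_def block_comp_eq)
  have const: "real (det_cc X X F) \<le> 112 ^ 3 * 14 * real q ^ 7"
    if "\<And>x y. x \<in> X \<Longrightarrow> y \<in> X \<Longrightarrow> F x y = b" for b
  proof -
    have "det_solvable F 0 (X \<times> X)" using that by (intro det_solvable_const) auto
    then have "det_cc X X F \<le> 0" by (rule det_cc_le)
    then show ?thesis by simp
  qed
  have "real (det_cc X X F) \<le> 112 ^ 3 * 14 * real q ^ 7"
  proof (cases "q = 0")
    case True
    define zero where "zero = replicate (n * k) False"
    have zero: "zero \<in> X" by (simp add: zero_def X_def cube_def)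
    have F_zero: "F x zero = on_sets n f {}" "F zero x = on_sets n f {}" for x
      using ip_bits_zero[of n k x] by (simp_all add: F zero_def)
    have "F x y = on_sets n f {}" if "x \<in> X" "y \<in> X" for x y
      using zero_communication[OF comp] cost True zero that F_zero by metis
    then show ?thesis by (rule const)
  next
    case False
    then have q: "q \<ge> 1" by simp
    define M :: real where "M = 2 ^ k - 1"
    have M: "25 * (real n)\<^sup>2 \<le> M"
    proof -
      \<comment> \<open>The summand 5 in the bound on \<open>k\<close> yields 32. Lowering it to 25
        absorbs the removed zero string and makes the square root 5 n.\<close>
      have "32 * (real n)\<^sup>2 = 2 powr (2 * log 2 (real n) + 5)"
        using n by (simp add: powr_add mult.commute[of 2 "log 2 _"] powr_powr[symmetric])
      also have "\<dots> \<le> 2 powr real k" using kn by simp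
      also have "\<dots> = 2 ^ k" by (simp add: powr_realpow)
      finally have "32 * (real n)\<^sup>2 \<le> 2 ^ k" .
      moreover have "1 \<le> (real n)\<^sup>2" using n by simp
      ultimately show ?thesis by (simp add: M_def)
    qed
    moreover have "0 < 25 * (real n)\<^sup>2" using n by simp
    ultimately have "M > 0" by linarith
    obtain c where c: "approximating_series {..<n} c (on_sets n f) q (1 / sqrt M)"
      using approximating_series_block_comp[OF k n M[unfolded M_def] comp[unfolded X_def F_def]]
      unfolding cost M_def by blast
    show ?thesis
    proof (cases "\<exists>Z W. Z \<subseteq> {..<n} \<and> W \<subseteq> {..<n} \<and> on_sets n f Z \<noteq> on_sets n f W")
      case True
      then obtain Z i where Zi: "Z \<subseteq> {..<n}" "i \<in> {..<n}" "on_sets n f (sym_diff Z {i}) \<noteq> on_sets n f Z"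
        using exists_sensitive_element[OF finite_lessThan, of _ n _ "on_sets n f"] by metis
      have "1 \<le> 18 * 4 ^ q * (1 / sqrt M)" by (rule approximating_series.sensitive_decay[OF c Zi])
      then have "sqrt M \<le> 18 * 4 ^ q" using \<open>M > 0\<close> by (simp add: field_simps)
      then have "M \<le> (18 * 4 ^ q)\<^sup>2" by (rule sqrt_le_D)
      also have "\<dots> = 324 * 16 ^ q" by (simp add: power_mult_distrib power2_eq_square flip: power_mult_distrib)
      finally have "(2::real) ^ k \<le> 324 * 16 ^ q + 1" by (simp add: M_def)
      moreover have "(1::real) \<le> 16 ^ q" by simp
      \<comment> \<open>512 = 2 ^ 9 is the least power of two above 324 + 1; rounding up turns the
        bound into one on the exponent \<open>k\<close>.\<close>
      ultimately have "(2::real) ^ k \<le> 512 * 16 ^ q" by linarith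
      also have "\<dots> = 2 ^ (9 + 4 * q)" by (simp add: power_add power_mult)
      finally have "k \<le> 9 + 4 * q" by simp
      then have kq: "k + 1 \<le> 14 * q" using q by simp
      have "det_solvable F ((7 * (2 * q + 2)\<^sup>2) ^ 3 * (k + 1)) (X \<times> X)"
      proof (rule det_solvable_block_sensitivity)
        show "block_sensitivity_le {..<n} (on_sets n f) (7 * (2 * q + 2)\<^sup>2)"
          by (rule approximating_series.block_sensitivity_le_fourier[OF c])
        show "F x y = on_sets n f (ip_bits n k x y)" for x y by (rule F)
        show "ip_bits n k x y \<subseteq> {..<n}" for x y by (rule ip_bits_subset)
        fix i D c assume "i \<in> {..<n}"
        then have "i \<in> ip_bits n k x y \<longleftrightarrow> IP k (block k i x) (block k i y)" for x y
          by (simp add: ip_bits_def)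
        moreover assume "det_solvable F c {(x, y)\<in>D. i \<in> ip_bits n k x y}"
          "det_solvable F c {(x, y)\<in>D. i \<notin> ip_bits n k x y}"
        ultimately show "det_solvable F (c + (k + 1)) D"
          by (intro det_solvable_IP[where \<alpha> = "block k i" and \<beta> = "block k i"]) simp_all
      qed simp
      then have "det_cc X X F \<le> (7 * (2 * q + 2)\<^sup>2) ^ 3 * (k + 1)" by (rule det_cc_le)
      also have "\<dots> \<le> (7 * (4 * q)\<^sup>2) ^ 3 * (14 * q)"
        using q kq by (intro mult_le_mono power_mono mult_le_mono2) auto
      also have "\<dots> = 112 ^ 3 * 14 * (q ^ 6 * q)"
        by (simp add: power_mult_distrib flip: power_mult)
      also have "q ^ 6 * q = q ^ 7" using power_add[of q 6 1] by simp
      finally have "real (det_cc X X F) \<le> real (112 ^ 3 * 14 * q ^ 7)" by (simp only: of_nat_le_iff)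
      then show ?thesis by simp
    next
      case False
      then have "F x y = on_sets n f {}" if "x \<in> X" "y \<in> X" for x y
        unfolding F using ip_bits_subset[of n k x y] empty_subsetI[of "{..<n}"] by blast
      then show ?thesis by (rule const)
    qed
  qed
  then show "real (det_cc (cube (n * k)) (cube (n * k)) (block_comp n k f (IP k)))
      \<le> 112 ^ 3 * 14 * real (quantum_cc (cube (n * k)) (cube (n * k)) (block_comp n k f (IP k))) ^ 7"
    by (simp only: q_def X_def F_def)
qed simp

end
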